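(* Let $B>0$. Then $(q,1,B)$ does not satisfy the Northcott property, i.e. $S_{q,1,B}=\{[K]: |\zeta_K^*(1)|\le B\}$ is infinite.
   Context: $q\equiv1\pmod 4$. $K$ ranges over isomorphism classes $[K]$ of global function fields in one variable with constant field $\mathbb F_q$; $\zeta_K^*(1)$ is the first nonzero Taylor coefficient of $\zeta_K$ at $s=1$ (residue at the simple pole), equal to $h_Kq^{-g}/((1-q^{-1})\log q)$. Notation $s=\sigma+i\tau$, $\sigma=\operatorname{Re}(s)$. *)

theory Defs
  imports
    "HOL-Algebra.Algebra"
    "HOL-Library.Multiset"
    "HOL-Number_Theory.Prime_Powers"
    "HOL-Complex_Analysis.Complex_Analysis"
begin

section \<open>Function fields and their places\<close>

text \<open>
  The field \<open>K\<close> is a function field in one variable with (full) constant field \<open>k\<close>: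
  it is a finite extension of \<open>k(t)\<close> for some \<open>t\<close> transcendental over \<open>k\<close>,
  and every element of \<open>K\<close> algebraic over \<open>k\<close> lies in \<open>k\<close>.
\<close>

definition function_field :: "'a ring \<Rightarrow> 'a set \<Rightarrow> bool" where
  "function_field K k \<longleftrightarrow>
     field K \<and> subfield k K \<and>
     (\<exists>t\<in>carrier K. ring.transcendental K k t \<and>
        ring.finite_dimension K (generate_field K (insert t k)) (carrier K)) \<and>
     (\<forall>x\<in>carrier K. ring.algebraic K k x \<longrightarrow> x \<in> k)"

definition global_function_field :: "nat \<Rightarrow> 'a ring \<Rightarrow> 'a set \<Rightarrow> bool" where
  "global_function_field q K k \<longleftrightarrow> function_field K k \<and> finite k \<and> card k = q"

text \<open>
  A place is represented by its valuation ring: a proper subring \<open>V\<close> of \<open>K\<close> containing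
  the constants such that \<open>z \<in> V\<close> or \<open>z\<inverse> \<in> V\<close> for every nonzero \<open>z\<close> in \<open>K\<close>.  In a function
  field these rings are automatically discrete valuation rings with fraction field \<open>K\<close>.
\<close>

definition places :: "'a ring \<Rightarrow> 'a set \<Rightarrow> 'a set set" where
  "places K k =
     {V. subring V K \<and> k \<subseteq> V \<and> V \<noteq> carrier K \<and>
         (\<forall>z\<in>carrier K - {\<zero>\<^bsub>K\<^esub>}. z \<in> V \<or> inv\<^bsub>K\<^esub> z \<in> V)}"

definition place_ideal :: "'a ring \<Rightarrow> 'a set \<Rightarrow> 'a set" where
  "place_ideal K V = V - Units (K\<lparr>carrier := V\<rparr>)"

definition residue_field :: "'a ring \<Rightarrow> 'a set \<Rightarrow> 'a set ring" where
  "residue_field K V = (K\<lparr>carrier := V\<rparr>) Quot (place_ideal K V)"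

definition place_norm :: "'a ring \<Rightarrow> 'a set \<Rightarrow> nat" where
  "place_norm K V = card (carrier (residue_field K V))"

section \<open>The zeta function\<close>

text \<open>Effective divisors, written additively, are finite multisets of places.\<close>

definition effective_divisors :: "'a ring \<Rightarrow> 'a set \<Rightarrow> 'a set multiset set" where
  "effective_divisors K k = {D. set_mset D \<subseteq> places K k}"

definition divisor_norm :: "'a ring \<Rightarrow> 'a set multiset \<Rightarrow> nat" where
  "divisor_norm K D = (\<Prod>V\<in>#D. place_norm K V)"

definition zeta_series :: "'a ring \<Rightarrow> 'a set \<Rightarrow> complex \<Rightarrow> complex" where
  "zeta_series K k s =
     (\<Sum>\<^sub>\<infinity>D\<in>effective_divisors K k. of_nat (divisor_norm K D) powr (-s))"

text \<open>
  The series above defines the zeta function only for \<open>Re s > 1\<close>; the zeta function is its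
  meromorphic continuation to the whole plane.  The latter is unique as a function since
  \<^const>\<open>nicely_meromorphic_on\<close> fixes the value \<open>0\<close> at poles and excludes removable singularities.
\<close>

definition zeta :: "'a ring \<Rightarrow> 'a set \<Rightarrow> complex \<Rightarrow> complex" where
  "zeta K k =
     (THE f. f nicely_meromorphic_on UNIV \<and> (\<forall>s. Re s > 1 \<longrightarrow> f s = zeta_series K k s))"

text \<open>The first nonzero coefficient of the Laurent expansion of the zeta function at \<open>s\<close>.\<close>

definition zeta_star :: "'a ring \<Rightarrow> 'a set \<Rightarrow> complex \<Rightarrow> complex" where
  "zeta_star K k s =
     fls_nth (laurent_expansion (zeta K k) s) (fls_subdegree (laurent_expansion (zeta K k) s))"

section \<open>The Northcott property\<close>

text \<open>
  Global function fields are countable, so each of them is isomorphic to one whose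
  elements are natural numbers; isomorphism classes are formed among these.
\<close>

definition global_function_fields :: "nat \<Rightarrow> nat ring set" where
  "global_function_fields q = {K. \<exists>k. global_function_field q K k}"

definition isomorphism_rel :: "nat \<Rightarrow> (nat ring \<times> nat ring) set" where
  "isomorphism_rel q =
     {(K, L). K \<in> global_function_fields q \<and> L \<in> global_function_fields q \<and> K \<simeq> L}"

definition northcott_set :: "nat \<Rightarrow> complex \<Rightarrow> real \<Rightarrow> nat ring set set" where
  "northcott_set q s B =
     {K. \<exists>k. global_function_field q K k \<and> norm (zeta_star K k s) \<le> B} // isomorphism_rel q"

definition northcott_property :: "nat \<Rightarrow> complex \<Rightarrow> real \<Rightarrow> bool" where
  "northcott_property q s B \<longleftrightarrow> finite (northcott_set q s B)"

end

theory Submission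
  imports
    Defs
    "HOL-Computational_Algebra.Computational_Algebra"
    "HOL-Computational_Algebra.Field_as_Ring"
    "HOL-Algebra.Algebraic_Closure_Type"
    "HOL-Real_Asymp.Real_Asymp"
begin

text \<open>
  Let \<open>K = \<bbbF>\<^sub>q(t, \<surd>D)\<close> with \<open>D\<close> monic and squarefree of degree \<open>2g + 1\<close>, and let \<open>A j\<close> be the number of
  ideals of norm degree \<open>j\<close> of the ring \<open>\<bbbF>\<^sub>q[t][\<surd>D]\<close>. For large \<open>j\<close> the quotient \<open>A j / q\<^sup>j\<close> is a constant \<open>\<rho>\<close>,
  and the residue of the zeta function is \<open>\<rho> / ((1 - 1/q) ln q)\<close>. Counting the pairs \<open>(I, z)\<close> with \<open>z \<in> I\<close>,
  and using that \<open>I J = (z)\<close> exchanges \<open>I\<close> and \<open>J\<close>, one gets \<open>\<rho> q\<^sup>m \<le> 2 (A 0 + \<dots> + A m)\<close> for all \<open>m > g\<close>.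

  A primitive ideal is given by a monic \<open>Q\<close> and a root of \<open>b\<^sup>2 = D\<close> modulo \<open>Q\<close>. If \<open>D\<close> is a non-residue modulo every prime
  of degree at most \<open>n\<close>, then \<open>Q\<close> has no such prime factor. These \<open>D\<close> include a whole residue class, and on average
  over that class \<open>A 0 + \<dots> + A m\<close> is \<open>O(q\<^sup>m / n)\<close>. Hence the residue takes arbitrarily small positive values, which
  are invariants of the isomorphism class.
\<close>

hide_const (open) Divisibility.irreducible Divisibility.prime Polynomials.degree UnivPoly.deg

section \<open>Counting polynomials over a finite field\<close>

text \<open>The odd degree of \<open>D\<close> leaves a single infinite place, of degree one, so the
  zeta series is the generating series of the \<open>A j\<close> divided by \<open>1 - u\<close>
  with \<open>u = 1/q^s\<close>. As zeta is defined through valuation rings, these have to be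
  classified: localizations at primes and one ring at infinity.

  Riemann-Roch enters through pole orders: an ideal of degree \<open>d\<close> omits exactly
  \<open>d + g\<close> of them, which gives both the eventual constancy of \<open>A j / q^j\<close>
  and the inequality for \<open>\<rho>\<close>.

  The inequality needs \<open>m > g\<close>, whereas averaging over \<open>D = D0 + M E\<close>,
  with \<open>E\<close> monic of degree \<open>e\<close>, is under control for
  \<open>m \<le> e\<close>, where \<open>E\<close> is equidistributed modulo every \<open>Q\<close>
  of degree at most \<open>m\<close>. Since \<open>2g + 1 = deg M + e\<close>, both hold for
  \<open>m = e\<close> as soon as \<open>e\<close> exceeds \<open>deg M\<close> by a little.

  The factor \<open>1/n\<close> is the density of polynomials without prime factors of degree at
  most \<open>n\<close>. The average is taken over all \<open>D\<close> of the family, at least half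
  of which are squarefree. Finally, positivity of the residues matters: finitely many classes would
  leave a least positive value.\<close>

definition below :: "nat \<Rightarrow> 'f::{field_gcd,finite} poly set" where
  "below n = {p. p = 0 \<or> degree p < n}"

definition monics :: "nat \<Rightarrow> 'f::{field_gcd,finite} poly set" where
  "monics d = {p. lead_coeff p = 1 \<and> degree p = d}"

lemma below_0 [simp]: "below 0 = {0}"
  by (auto simp: below_def)

lemma below_Suc: "below (Suc n) = (\<lambda>(a, p). pCons a p) ` (UNIV \<times> below n)"
proof (intro equalityI subsetI)
  fix p :: "'a poly" assume p: "p \<in> below (Suc n)"
  obtain a r where "p = pCons a r" by (cases p)
  with p show "p \<in> (\<lambda>(a, p). pCons a p) ` (UNIV \<times> below n)"
    by (auto simp: below_def image_iff split: if_splits)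
qed (auto simp: below_def split: if_splits)

lemma card_below: "finite (below n :: 'f::{field_gcd,finite} poly set) \<and>
    card (below n :: 'f poly set) = CARD('f) ^ n"
proof (induction n)
  case (Suc n)
  have "inj_on (\<lambda>(a, p). pCons a p) (UNIV \<times> below n :: ('f \<times> 'f poly) set)"
    by (auto simp: inj_on_def)
  with Suc show ?case
    by (simp add: below_Suc card_image card_cartesian_product)
qed simp

lemma finite_below [simp]: "finite (below n)"
  using card_below by blast

lemma below_add: "p \<in> below n \<Longrightarrow> r \<in> below n \<Longrightarrow> p + r \<in> below n"
  using degree_add_le_max[of p r] by (auto simp: below_def)

lemma below_diff: "p \<in> below n \<Longrightarrow> r \<in> below n \<Longrightarrow> p - r \<in> below n"
  using degree_diff_le_max[of p r] by (auto simp: below_def)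

lemma monics_eq: "monics d = (\<lambda>p. monom 1 d + p) ` below d"
proof (intro equalityI subsetI)
  fix p :: "'a poly" assume p: "p \<in> monics d"
  have "p - monom 1 d \<in> below d"
  proof (cases "p - monom 1 d = 0")
    case False
    have "degree (p - monom 1 d) \<le> d"
      using p by (auto simp: monics_def degree_monom_eq intro!: degree_diff_le)
    moreover have "Polynomial.coeff (p - monom 1 d) d = 0"
      using p by (auto simp: monics_def)
    ultimately show ?thesis
      using False by (metis (mono_tags, lifting) below_def le_neq_implies_less leading_coeff_0_iff mem_Collect_eq)
  qed (simp add: below_def)
  moreover have "p = monom 1 d + (p - monom 1 d)" by simp
  ultimately show "p \<in> (\<lambda>p. monom 1 d + p) ` below d" by blast
next
  fix p :: "'a poly" assume "p \<in> (\<lambda>p. monom 1 d + p) ` below d"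
  then obtain r where r: "p = monom 1 d + r" "r \<in> below d" by blast
  show "p \<in> monics d"
  proof (cases "r = 0")
    case True then show ?thesis using r by (simp add: monics_def degree_monom_eq)
  next
    case False
    with r have dr: "degree r < d" by (simp add: below_def)
    then have "degree p = d"
      using degree_add_eq_left[of r "monom 1 d"] r by (simp add: degree_monom_eq)
    with dr r show ?thesis by (simp add: monics_def coeff_eq_0)
  qed
qed

lemma finite_monics [simp]: "finite (monics d)"
  by (simp add: monics_eq)

lemma card_monics: "card (monics d :: 'f::{field_gcd,finite} poly set) = CARD('f) ^ d"
  by (simp add: monics_eq card_image inj_on_def card_below)

lemma monics_nonzero: "p \<in> monics d \<Longrightarrow> p \<noteq> 0"
  by (auto simp: monics_def)

lemma monics_mult: "s \<in> monics a \<Longrightarrow> r \<in> monics b \<Longrightarrow> s * r \<in> monics (a + b)"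
  using monics_nonzero[of s a] monics_nonzero[of r b]
  by (auto simp: monics_def degree_mult_eq coeff_mult_degree_sum)

lemma monic_dvd_antisym:
  fixes s r :: "'f::field poly"
  assumes "s dvd r" "r dvd s" "lead_coeff s = 1" "lead_coeff r = 1"
  shows "s = r"
proof -
  obtain k where k: "r = s * k" using assms(1) by blast
  have "s \<noteq> 0" "r \<noteq> 0" using assms by auto
  then have "k \<noteq> 0" "degree r \<le> degree s" using k dvd_imp_degree_le[OF assms(2)] by auto
  then have "degree k = 0" using k \<open>s \<noteq> 0\<close> by (simp add: degree_mult_eq)
  moreover have "lead_coeff k = 1" using k assms(3,4) by (simp add: lead_coeff_mult)
  ultimately have "k = 1" by (metis degree_0_id one_pCons)
  then show ?thesis using k by simp
qed

text \<open>Division with remainder: the members are the polynomials \<open>Q * h + c mod Q\<close>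
  with \<open>h\<close> running through \<open>below (n - degree Q)\<close>.\<close>

lemma card_below_class:
  fixes Q c :: "'f::{field_gcd,finite} poly"
  assumes "Q \<noteq> 0" "degree Q \<le> n"
  shows "card {w \<in> below n. Q dvd w - c} = CARD('f) ^ (n - degree Q)"
proof -
  let ?d = "degree Q"
  let ?r = "c mod Q"
  have r: "?r = 0 \<or> degree ?r < ?d"
    using degree_mod_less[OF assms(1)] by blast
  have "{w \<in> below n. Q dvd w - c} = (\<lambda>h. Q * h + ?r) ` below (n - ?d)"
  proof (intro equalityI subsetI)
    fix w assume "w \<in> {w \<in> below n. Q dvd w - c}"
    then have w: "w \<in> below n" "w mod Q = ?r" by (auto simp: mod_eq_dvd_iff)
    have weq: "w = Q * (w div Q) + ?r" using w(2) by (metis mult_div_mod_eq)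
    have "w div Q \<in> below (n - ?d)"
    proof (cases "w div Q = 0")
      case False
      have dh: "degree (Q * (w div Q)) = ?d + degree (w div Q)"
        using False assms(1) by (simp add: degree_mult_eq)
      have "degree w = degree (Q * (w div Q))"
      proof (cases "?r = 0")
        case True then show ?thesis using weq by simp
      next
        case r0: False
        with r dh have "degree ?r < degree (Q * (w div Q))" by simp
        then show ?thesis using weq degree_add_eq_left by metis
      qed
      moreover have "w \<noteq> 0" using False by auto
      ultimately show ?thesis using w(1) dh
        by (auto simp: below_def)
    qed (simp add: below_def)
    then show "w \<in> (\<lambda>h. Q * h + ?r) ` below (n - ?d)" using weq by blast
  next
    fix w assume "w \<in> (\<lambda>h. Q * h + ?r) ` below (n - ?d)"
    then obtain h where h: "w = Q * h + ?r" "h \<in> below (n - ?d)" by blast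
    have "Q * h \<in> below n"
      using h(2) assms by (cases "h = 0") (auto simp: below_def degree_mult_eq)
    moreover have "?r \<in> below n" using r assms(2) by (auto simp: below_def)
    ultimately have "w \<in> below n" using h(1) below_add by blast
    moreover have "w mod Q = c mod Q" by (simp add: h(1))
    ultimately show "w \<in> {w \<in> below n. Q dvd w - c}" by (auto simp: mod_eq_dvd_iff)
  qed
  moreover have "inj_on (\<lambda>h. Q * h + ?r) (below (n - ?d))"
    using assms(1) by (auto simp: inj_on_def)
  ultimately show ?thesis by (simp add: card_image card_below)
qed

lemma card_monics_class:
  fixes Q c :: "'f::{field_gcd,finite} poly"
  assumes "Q \<noteq> 0" "degree Q \<le> e"
  shows "card {E \<in> monics e. Q dvd E - c} = CARD('f) ^ (e - degree Q)"
proof -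
  have "{E \<in> monics e. Q dvd E - c} =
        (\<lambda>p. monom 1 e + p) ` {w \<in> below e. Q dvd w - (c - monom 1 e)}"
    by (auto simp: monics_eq algebra_simps)
  then show ?thesis
    by (simp add: card_image inj_on_def card_below_class[OF assms])
qed

text \<open>For \<open>degree Q > e\<close> the truncated difference makes the bound 1: two members
  differ by a multiple of \<open>Q\<close> of degree at most \<open>e\<close>, which is zero. This
  range occurs below for divisibility by large squares.\<close>

lemma card_monics_class_le:
  fixes Q c :: "'f::{field_gcd,finite} poly"
  assumes "Q \<noteq> 0"
  shows "card {E \<in> monics e. Q dvd E - c} \<le> CARD('f) ^ (e - degree Q)"
proof (cases "degree Q \<le> e")
  case False
  have "x = z" if "x \<in> {E \<in> monics e. Q dvd E - c}" "z \<in> {E \<in> monics e. Q dvd E - c}" for x z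
  proof (rule ccontr)
    assume "x \<noteq> z"
    have "Q dvd (x - c) - (z - c)" using that by (blast intro: dvd_diff)
    then have "Q dvd x - z" by simp
    with \<open>x \<noteq> z\<close> have "degree Q \<le> degree (x - z)"
      by (simp add: dvd_imp_degree_le)
    also have "\<dots> \<le> e" using that by (auto simp: monics_def intro!: degree_diff_le)
    finally show False using False by simp
  qed
  then have "card {E \<in> monics e. Q dvd E - c} \<le> Suc 0"
    by (subst card_le_Suc0_iff_eq) auto
  then show ?thesis using False by simp
qed (simp add: card_monics_class[OF assms])

text \<open>\<open>M\<close> is invertible modulo \<open>Q\<close>, with inverse \<open>v\<close>
  from the Bezout identity, so the congruence has the single solution class of
  \<open>c * v\<close>.\<close>

lemma coprime_class_eq:
  fixes Q M c :: "'f::{field_gcd,finite} poly"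
  assumes "coprime Q M"
  obtains c' where "\<And>E. Q dvd c - M * E \<longleftrightarrow> Q dvd E - c'"
proof -
  obtain u v where uv: "u * Q + v * M = 1"
    using assms bezout_coefficients_fst_snd[of Q M] by (metis coprime_imp_gcd_eq_1)
  have "Q dvd c - M * E \<longleftrightarrow> Q dvd E - c * v" for E
  proof
    assume "Q dvd c - M * E"
    then have "Q dvd v * (c - M * E) - u * Q * E" by (intro dvd_diff) auto
    also have "v * (c - M * E) - u * Q * E = c * v - (u * Q + v * M) * E" by (simp add: algebra_simps)
    finally show "Q dvd E - c * v" using uv by (metis dvd_minus_iff minus_diff_eq mult_1)
  next
    assume "Q dvd E - c * v"
    then have "Q dvd u * Q * c - M * (E - c * v)" by (intro dvd_diff) auto
    also have "u * Q * c - M * (E - c * v) = (u * Q + v * M) * c - M * E" by (simp add: algebra_simps)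
    finally show "Q dvd c - M * E" using uv by simp
  qed
  then show thesis using that by blast
qed

section \<open>Polynomials without small prime factors\<close>

text \<open>The name fits the later choice of \<open>M\<close> as the product of all monics of
  degree at most \<open>n\<close>: coprimality to \<open>M\<close> then excludes all prime factors
  of degree up to \<open>n\<close>.\<close>

definition rough :: "'f::{field_gcd,finite} poly \<Rightarrow> nat \<Rightarrow> nat" where
  "rough M d = card {Q \<in> monics d. coprime Q M}"

lemma rough_le: "rough (M :: 'f::{field_gcd,finite} poly) d \<le> CARD('f) ^ d"
  unfolding rough_def card_monics[symmetric] by (intro card_mono) auto

text \<open>Coprimality to \<open>M\<close> depends only on the residue modulo \<open>M\<close>, and
  from degree \<open>degree M\<close> on all residue classes contain equally many monics. Hence the
  count grows by exactly the factor \<open>q\<close> with each degree.\<close>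

lemma rough_eq:
  fixes M :: "'f::{field_gcd,finite} poly"
  assumes "M \<noteq> 0" "degree M \<le> d"
  shows "rough M d = card {r \<in> below (degree M). coprime r M} * CARD('f) ^ (d - degree M)"
proof -
  let ?A = "{Q \<in> monics d. coprime Q M}" and ?R = "{r \<in> below (degree M). coprime r M}"
  have cm: "coprime (x mod M) M \<longleftrightarrow> coprime x M" for x
    by (metis coprime_commute coprime_mod_left_iff assms(1))
  have *: "x mod M \<in> ?R" if "x \<in> ?A" for x
    using that degree_mod_less[OF assms(1), of x] by (auto simp: below_def cm)
  have "card ?A = (\<Sum>x\<in>?A. 1)" by simp
  also have "\<dots> = (\<Sum>r\<in>?R. \<Sum>x | x \<in> ?A \<and> x mod M = r. 1)"
    by (rule sum.group[symmetric]) (use * in auto)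
  also have "\<dots> = (\<Sum>r\<in>?R. CARD('f) ^ (d - degree M))"
  proof (rule sum.cong)
    fix r assume r: "r \<in> ?R"
    then have rr: "r mod M = r" by (auto simp: below_def mod_poly_less)
    have "{x. x \<in> ?A \<and> x mod M = r} = {E \<in> monics d. M dvd E - r}"
      using r rr cm by (auto simp: mod_eq_dvd_iff[symmetric])
    then show "(\<Sum>x | x \<in> ?A \<and> x mod M = r. 1) = CARD('f) ^ (d - degree M)"
      using card_monics_class[OF assms] by simp
  qed simp
  finally show ?thesis by (simp add: rough_def)
qed

text \<open>The products \<open>s * r\<close> with \<open>s\<close> monic of degree
  \<open>k \<le> n\<close> and \<open>r\<close> rough of degree \<open>d - k\<close> are distinct
  monics of degree \<open>d\<close>. By \<open>rough_eq\<close> each of the \<open>n + 1\<close>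
  values of \<open>k\<close> contributes as many products as there are rough monics of degree
  \<open>d\<close>.\<close>

lemma rough_small:
  fixes M :: "'f::{field_gcd,finite} poly"
  assumes "M \<noteq> 0" and small: "\<And>s. lead_coeff s = 1 \<Longrightarrow> degree s \<le> n \<Longrightarrow> s dvd M"
    and "degree M + n \<le> d"
  shows "Suc n * rough M d \<le> CARD('f) ^ d"
proof -
  let ?q = "CARD('f)" and ?\<mu> = "degree M"
  let ?\<phi> = "card {r \<in> below ?\<mu>. coprime r M}"
  let ?S = "\<lambda>k. (monics k :: 'f poly set) \<times> {Q \<in> monics (d - k). coprime Q M}"
  have "Suc n * rough M d = (\<Sum>k\<le>n. ?\<phi> * ?q ^ (d - ?\<mu>))"
    using assms by (simp add: rough_eq)
  also have "\<dots> = (\<Sum>k\<le>n. ?q ^ k * rough M (d - k))"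
  proof (rule sum.cong)
    fix k assume "k \<in> {..n}"
    then have k: "d - ?\<mu> = k + (d - k - ?\<mu>)" "?\<mu> \<le> d - k" using assms(3) by auto
    have "?\<phi> * ?q ^ (d - ?\<mu>) = ?q ^ k * (?\<phi> * ?q ^ (d - k - ?\<mu>))"
      by (subst k(1)) (simp only: power_add mult.left_commute)
    then show "?\<phi> * ?q ^ (d - ?\<mu>) = ?q ^ k * rough M (d - k)"
      by (simp only: rough_eq[OF assms(1) k(2)])
  qed simp
  also have "\<dots> = (\<Sum>k\<le>n. card (?S k))"
    by (simp add: card_cartesian_product card_monics rough_def)
  also have "\<dots> = card (\<Union>k\<le>n. ?S k)"
    by (subst card_UN_disjoint) (simp, simp, force simp: monics_def, rule refl)
  also have "\<dots> = card ((\<lambda>(s, r). s * r) ` (\<Union>k\<le>n. ?S k))"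
  \<comment> \<open>The small factor divides \<open>M\<close> and is therefore coprime to any rough
    cofactor, so two small factors of the same product divide each other.\<close>
  proof (rule card_image[symmetric], rule inj_onI, clarsimp)
    fix s r s' r' :: "'f poly" and k k'
    assume a: "k \<le> n" "s \<in> monics k" "r \<in> monics (d - k)" "coprime r M"
      "k' \<le> n" "s' \<in> monics k'" "r' \<in> monics (d - k')" "coprime r' M" "s * r = s' * r'"
    have sM: "s dvd M" "s' dvd M" using a small by (auto simp: monics_def)
    have "coprime s r'" "coprime s' r"
      using coprime_divisors[OF sM(1) dvd_refl] coprime_divisors[OF sM(2) dvd_refl] a(4,8)
      by (simp_all add: coprime_commute)
    moreover have "s dvd s' * r'" "s' dvd s * r" using a(9) by (metis dvd_triv_left)+
    ultimately have "s dvd s'" "s' dvd s" by (simp_all add: coprime_dvd_mult_left_iff)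
    then have "s = s'" using a(2,6) by (intro monic_dvd_antisym) (auto simp: monics_def)
    moreover have "s \<noteq> 0" using a monics_nonzero by blast
    ultimately show "s = s' \<and> r = r'" using a(9) by simp
  qed
  also have "\<dots> \<le> card (monics d :: 'f poly set)"
  proof (rule card_mono)
    show "(\<lambda>(s, r). s * r) ` (\<Union>k\<le>n. ?S k) \<subseteq> monics d"
    proof clarsimp
      fix k and s r :: "'f poly" assume a: "k \<le> n" "s \<in> monics k" "r \<in> monics (d - k)"
      show "s * r \<in> monics d" using monics_mult[OF a(2,3)] a(1) assms(3) by simp
    qed
  qed simp
  finally show ?thesis by (simp add: card_monics)
qed

section \<open>Non-residues modulo all small primes\<close>

text \<open>On the finite set of residues modulo \<open>P\<close> squaring is not injective, as
  \<open>1\<close> and \<open>-1\<close> have the same square, and therefore not surjective.\<close>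

lemma nonresidue_exists:
  fixes P :: "'f::{field_gcd,finite} poly"
  assumes "irreducible P" "(2::'f) \<noteq> 0"
  shows "\<exists>b. \<forall>x. \<not> P dvd x * x - b"
proof -
  have P0: "P \<noteq> 0" using assms by auto
  have d: "0 < degree P"
    using assms(1) by (metis gr0I irreducible_not_unit is_unit_iff_degree P0)
  let ?B = "below (degree P) :: 'f poly set"
  let ?f = "\<lambda>x. x * x mod P"
  have mB: "x mod P \<in> ?B" for x using degree_mod_less[OF P0, of x] by (auto simp: below_def)
  have "\<not> inj_on ?f ?B"
  proof
    assume "inj_on ?f ?B"
    moreover have "1 \<in> ?B" "-1 \<in> ?B" using d by (auto simp: below_def)
    ultimately have "(1::'f poly) = -1" using inj_onD[of ?f ?B 1 "-1"] by simp
    then have "(1::'f) = -1" by (metis lead_coeff_1 lead_coeff_minus)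
    then have "(1::'f) + 1 = 1 + - 1" by (metis (no_types))
    then have "(2::'f) = 0" by simp
    with assms show False by simp
  qed
  then have "\<not> ?B \<subseteq> ?f ` ?B"
    by (metis finite_below finite_surj_inj subset_refl)
  then obtain b where b: "b \<in> ?B" "b \<notin> ?f ` ?B" by blast
  have "\<not> P dvd x * x - b" for x
  proof
    assume "P dvd x * x - b"
    then have "x * x mod P = b mod P" by (simp add: mod_eq_dvd_iff)
    moreover have "b mod P = b" using b(1) by (auto simp: below_def mod_poly_less)
    ultimately have "?f (x mod P) = b" by (simp add: mod_mult_eq)
    with b(2) mB show False by blast
  qed
  then show ?thesis by blast
qed

text \<open>Chinese remainder theorem: nonresidues for the single primes are glued to one
  \<open>b\<close>.\<close>

lemma nonresidue_exists_set:
  fixes S :: "'f::{field_gcd,finite} poly set"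
  assumes "finite S" "(2::'f) \<noteq> 0" "\<And>P. P \<in> S \<Longrightarrow> prime P"
  shows "\<exists>b. \<forall>P\<in>S. \<forall>x. \<not> P dvd x * x - b"
  using assms(1,3)
proof (induction S rule: finite_induct)
  case (insert P S)
  then obtain b where b: "\<forall>P\<in>S. \<forall>x. \<not> P dvd x * x - b" by auto
  have "prime P" using insert by simp
  then obtain b' where b': "\<forall>x. \<not> P dvd x * x - b'"
    using nonresidue_exists[OF _ assms(2)] by (meson prime_elem_imp_irreducible prime_imp_prime_elem)
  have "coprime P (\<Prod>S)"
    using insert by (intro prod_coprime_right primes_coprime) auto
  then obtain u v where uv: "u * P + v * \<Prod>S = 1"
    using bezout_coefficients_fst_snd[of P "\<Prod>S"] by (metis coprime_imp_gcd_eq_1)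
  \<comment> \<open>\<open>u * P\<close> is 0 modulo \<open>P\<close> and 1 modulo every element of
    \<open>S\<close>; for \<open>v * \<Prod>S\<close> it is the other way round.\<close>
  let ?c = "b * (u * P) + b' * (v * \<Prod>S)"
  have *: "\<not> R dvd x * x - ?c" if "R dvd ?c - e" "\<forall>x. \<not> R dvd x * x - e" for R e x
  proof
    assume "R dvd x * x - ?c"
    with that(1) have "R dvd (x * x - ?c) + (?c - e)" by (rule dvd_add[rotated])
    then show False using that(2) by simp
  qed
  have "\<not> R dvd x * x - ?c" if R: "R \<in> insert P S" for R x
  proof (cases "R = P")
    case True
    have "?c - b' = (b - b') * (u * P) + b' * (u * P + v * \<Prod>S) - b'" by (simp add: algebra_simps)
    then have "?c - b' = (b - b') * (u * P)" using uv by simp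
    then show ?thesis using *[of R b'] b' True by auto
  next
    case False
    then have "R dvd \<Prod>S" using R insert by (auto intro: dvd_prodI)
    moreover have "?c - b = (b' - b) * (v * \<Prod>S) + b * (u * P + v * \<Prod>S) - b" by (simp add: algebra_simps)
    then have "?c - b = (b' - b) * (v * \<Prod>S)" using uv by simp
    ultimately show ?thesis using *[of R b] b False R by auto
  qed
  then show ?case by blast
qed auto

lemma nonresidue_exists_dvd:
  fixes M :: "'f::{field_gcd,finite} poly"
  assumes "M \<noteq> 0" "(2::'f) \<noteq> 0"
  obtains b where "\<And>P x. irreducible P \<Longrightarrow> P dvd M \<Longrightarrow> \<not> P dvd x * x - b"
proof -
  obtain b where b: "\<forall>P\<in>prime_factors M. \<forall>x. \<not> P dvd x * x - b"
    using nonresidue_exists_set[of "prime_factors M"] assms(2) by auto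
  have "\<not> P dvd x * x - b" if "irreducible P" "P dvd M" for P x
  proof -
    have "normalize P \<in> prime_factors M"
      using that assms(1) by (auto simp: in_prime_factors_iff irreducible_imp_prime_elem)
    with b show ?thesis by (metis normalize_dvd_iff)
  qed
  then show thesis using that by blast
qed


section \<open>Counting ideal data on average\<close>

text \<open>
  The triple \<open>(c, Q, b)\<close> stands for the ideal \<open>c (Q, b + \<surd>D)\<close> of \<open>\<bbbF>\<^sub>q[t][\<surd>D]\<close>, whose norm is \<open>c\<^sup>2 Q\<close>.
\<close>

definition triples :: "nat \<Rightarrow> 'f::{field_gcd,finite} poly \<Rightarrow> ('f poly \<times> 'f poly \<times> 'f poly) set" where
  "triples m D = {(c, Q, b). lead_coeff c = 1 \<and> lead_coeff Q = 1 \<and> b mod Q = b \<and> Q dvd b * b - D \<and>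
      2 * degree c + degree Q = m}"

lemma mod_eq_self_iff: "Q \<noteq> 0 \<Longrightarrow> b mod Q = b \<longleftrightarrow> b \<in> below (degree (Q :: 'f::{field_gcd,finite} poly))"
  using degree_mod_less[of Q b] by (metis (mono_tags, lifting) below_def mem_Collect_eq mod_0 mod_poly_less)

definition roots_mod :: "'f::{field_gcd,finite} poly \<Rightarrow> 'f poly \<Rightarrow> 'f poly set" where
  "roots_mod Q D = {b \<in> below (degree Q). Q dvd b * b - D}"

lemma triples_eq:
  fixes D :: "'f::{field_gcd,finite} poly"
  shows
  "triples m D = (\<Union>k\<le>m div 2. monics k \<times> (SIGMA Q:monics (m - 2 * k). roots_mod Q D))"
proof (intro equalityI subsetI)
  fix x :: "'f poly \<times> 'f poly \<times> 'f poly" assume x: "x \<in> triples m D"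
  obtain c Q b where xe: "x = (c, Q, b)" by (cases x)
  have Q: "Q \<noteq> 0" using x xe by (auto simp: triples_def)
  show "x \<in> (\<Union>k\<le>m div 2. monics k \<times> (SIGMA Q:monics (m - 2 * k). roots_mod Q D))"
    using x mod_eq_self_iff[OF Q, of b] unfolding xe
    by (intro UN_I[of "degree c"]) (auto simp: triples_def monics_def roots_mod_def)
next
  fix x :: "'f poly \<times> 'f poly \<times> 'f poly" assume "x \<in> (\<Union>k\<le>m div 2. monics k \<times> (SIGMA Q:monics (m - 2 * k). roots_mod Q D))"
  then obtain k c Q b where x: "x = (c, Q, b)" "k \<le> m div 2" "c \<in> monics k" "Q \<in> monics (m - 2 * k)" "b \<in> roots_mod Q D"
    by auto
  have Q: "Q \<noteq> 0" using x monics_nonzero by blast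
  show "x \<in> triples m D"
    using x mod_eq_self_iff[OF Q, of b] by (auto simp: triples_def monics_def roots_mod_def)
qed

lemma finite_roots_mod [simp]: "finite (roots_mod Q D)"
  by (simp add: roots_mod_def)

lemma finite_triples [simp]: "finite (triples m D)"
  unfolding triples_eq by (intro finite_UN_I finite_cartesian_product finite_SigmaI) simp_all

lemma card_triples:
  fixes D :: "'f::{field_gcd,finite} poly"
  shows "card (triples m D) =
    (\<Sum>k\<le>m div 2. CARD('f) ^ k * (\<Sum>Q\<in>monics (m - 2 * k). card (roots_mod Q D)))"
proof -
  have "card (triples m D) = (\<Sum>k\<le>m div 2. card ((monics k :: 'f poly set) \<times> (SIGMA Q:monics (m - 2 * k). roots_mod Q D)))"
    unfolding triples_eq by (subst card_UN_disjoint) (simp, simp, force simp: monics_def, rule refl)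
  then show ?thesis by (simp add: card_cartesian_product card_SigmaI card_monics)
qed

section \<open>Averages over the family \<open>D0 + M * E\<close>\<close>

context
  fixes M D0 :: "'f::{field_gcd,finite} poly"
  assumes M: "M \<noteq> 0" and nonres: "\<And>P x. irreducible P \<Longrightarrow> P dvd M \<Longrightarrow> \<not> P dvd x * x - D0"
begin

text \<open>For fixed \<open>b\<close> the condition on \<open>E\<close> is a single residue class
  modulo \<open>Q\<close>, so after exchanging the sums there is on average at most one root. If
  \<open>Q\<close> and \<open>M\<close> share a prime, a root would make \<open>D0\<close> a square
  modulo that prime, so there is none.\<close>

lemma sum_roots_mod:
  fixes Q :: "'f poly"
  assumes "Q \<noteq> 0" "degree Q \<le> e"
  shows "(\<Sum>E\<in>monics e. card (roots_mod Q (D0 + M * E))) \<le> (if coprime Q M then CARD('f) ^ e else 0)"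
proof -
  let ?B = "below (degree Q) :: 'f poly set"
  have "(\<Sum>E\<in>monics e. card (roots_mod Q (D0 + M * E))) =
      (\<Sum>E\<in>monics e. \<Sum>b\<in>{b \<in> ?B. Q dvd b * b - (D0 + M * E)}. 1)"
    by (simp add: roots_mod_def)
  also have "\<dots> = (\<Sum>b\<in>?B. \<Sum>E\<in>{E \<in> monics e. Q dvd b * b - (D0 + M * E)}. 1)"
    by (rule sum.swap_restrict) auto
  also have "\<dots> = (\<Sum>b\<in>?B. card {E \<in> monics e. Q dvd (b * b - D0) - M * E})"
    by (simp add: algebra_simps)
  also have "\<dots> \<le> (if coprime Q M then CARD('f) ^ e else 0)"
  proof (cases "coprime Q M")
    case True
    have "card {E \<in> monics e. Q dvd (b * b - D0) - M * E} \<le> CARD('f) ^ (e - degree Q)" for b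
    proof -
      obtain c' where "\<And>E. Q dvd (b * b - D0) - M * E \<longleftrightarrow> Q dvd E - c'"
        using coprime_class_eq[OF True] by blast
      then show ?thesis using card_monics_class_le[OF assms(1)] by simp
    qed
    then have "(\<Sum>b\<in>?B. card {E \<in> monics e. Q dvd (b * b - D0) - M * E}) \<le>
        (\<Sum>b\<in>?B. CARD('f) ^ (e - degree Q))" by (rule sum_mono)
    also have "\<dots> = CARD('f) ^ e"
      using assms(2) by (simp add: card_below flip: power_add)
    finally show ?thesis using True by simp
  next
    case False
    then obtain P where P: "prime P" "P dvd Q" "P dvd M"
      using prime_divisor_exists[of "gcd Q M"] assms(1)
      by (metis coprime_iff_gcd_eq_1 dvd_0_left gcd_eq_0_iff gcd_greatest_iff is_unit_gcd_iff)
    then have irr: "irreducible P" by (simp add: prime_elem_imp_irreducible prime_imp_prime_elem)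
    have "{E \<in> monics e. Q dvd (b * b - D0) - M * E} = {}" for b
    proof (rule ccontr)
      assume "{E \<in> monics e. Q dvd (b * b - D0) - M * E} \<noteq> {}"
      then obtain E where "P dvd (b * b - D0) - M * E" using P(2) dvd_trans by blast
      moreover have "P dvd M * E" using P(3) by simp
      ultimately have "P dvd ((b * b - D0) - M * E) + M * E" by (rule dvd_add)
      then show False using nonres[OF irr P(3)] by simp
    qed
    then show ?thesis using False by simp
  qed
  finally show ?thesis .
qed

text \<open>Only the \<open>Q\<close> coprime to \<open>M\<close> contribute, each with an average
  of at most one root, and \<open>q ^ k\<close> counts the monic \<open>c\<close> of degree
  \<open>k\<close>. The bound \<open>m \<le> e\<close> keeps \<open>degree Q \<le> e\<close>, as the
  equidistribution of \<open>E\<close> requires.\<close>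

lemma sum_card_triples:
  assumes "m \<le> e"
  shows "(\<Sum>E\<in>monics e. card (triples m (D0 + M * E))) \<le>
    CARD('f) ^ e * (\<Sum>k\<le>m div 2. CARD('f) ^ k * rough M (m - 2 * k))"
proof -
  let ?q = "CARD('f)"
  have "(\<Sum>E\<in>monics e. card (triples m (D0 + M * E))) =
      (\<Sum>k\<le>m div 2. ?q ^ k * (\<Sum>Q\<in>monics (m - 2 * k). \<Sum>E\<in>monics e. card (roots_mod Q (D0 + M * E))))"
    unfolding card_triples
    by (subst sum.swap) (simp add: sum_distrib_left[symmetric] sum.swap[of _ _ "monics e"])
  also have "\<dots> \<le> (\<Sum>k\<le>m div 2. ?q ^ k * (\<Sum>Q\<in>monics (m - 2 * k). if coprime Q M then ?q ^ e else 0))"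
    using assms by (intro sum_mono mult_left_mono sum_roots_mod) (auto simp: monics_nonzero, simp add: monics_def)
  also have "\<dots> = (\<Sum>k\<le>m div 2. ?q ^ k * (rough M (m - 2 * k) * ?q ^ e))"
    by (simp add: rough_def sum.If_cases Int_def)
  also have "\<dots> = ?q ^ e * (\<Sum>k\<le>m div 2. ?q ^ k * rough M (m - 2 * k))"
    by (simp add: sum_distrib_left mult_ac)
  finally show ?thesis .
qed

text \<open>A prime dividing both \<open>D0 + M * E\<close> and \<open>M\<close> would divide
  \<open>D0\<close>, making it congruent to the square \<open>0\<close>; the nonresidue condition
  excludes this. So a prime with square dividing \<open>D0 + M * E\<close> is coprime to
  \<open>M\<close> and has degree above \<open>n\<close>.\<close>

lemma not_squarefree_subset:
  assumes small: "\<And>s. lead_coeff s = 1 \<Longrightarrow> degree s \<le> n \<Longrightarrow> s dvd M"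
    and deg: "degree D0 < degree M + e"
  shows "{E \<in> monics e. \<not> squarefree (D0 + M * E)} \<subseteq>
    (\<Union>s\<in>{n<..(degree M + e) div 2}. \<Union>S\<in>{S \<in> monics s. coprime S M}. {E \<in> monics e. S ^ 2 dvd D0 + M * E})"
proof
  fix E assume "E \<in> {E \<in> monics e. \<not> squarefree (D0 + M * E)}"
  then have E: "E \<in> monics e" "\<not> squarefree (D0 + M * E)" by auto
  have dM: "degree (M * E) = degree M + e"
    using E(1) M monics_nonzero[OF E(1)] by (simp add: degree_mult_eq monics_def)
  then have d: "degree (D0 + M * E) = degree M + e"
    using deg degree_add_eq_right by metis
  then have nz: "D0 + M * E \<noteq> 0" using deg by (metis degree_0 not_less_zero)
  from E(2) nz obtain P where P: "prime P" "P ^ 2 dvd D0 + M * E"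
    using squarefree_factorial_semiring by blast
  have irr: "irreducible P" using P(1) by (simp add: prime_elem_imp_irreducible prime_imp_prime_elem)
  have lc: "lead_coeff P = 1"
  proof -
    \<comment> \<open>Prime elements are normalized, which for polynomials means monic; only then
      does the hypothesis on small monic divisors of \<open>M\<close> apply.\<close>
    have "unit_factor P = 1" using P(1) by (simp add: unit_factor_prime)
    then have "unit_factor (lead_coeff P) = 1" by (simp add: unit_factor_poly_def one_pCons)
    moreover have "lead_coeff P \<noteq> 0" using P(1) by auto
    ultimately show ?thesis
      by (metis dvd_field_iff is_unit_normalize mult_1 unit_factor_mult_normalize)
  qed
  have ndM: "\<not> P dvd M"
  proof
    assume PM: "P dvd M"
    have "P dvd D0 + M * E" using P(2) by (metis dvd_trans dvd_triv_left power2_eq_square)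
    with PM have "P dvd (D0 + M * E) - M * E" by (intro dvd_diff) auto
    then show False using nonres[OF irr PM, of 0] by simp
  qed
  then have "coprime P M" using P(1) prime_imp_coprime by blast
  moreover have "n < degree P" using small[OF lc] ndM by (meson not_less)
  moreover have "degree (P ^ 2) \<le> degree M + e"
    using P(2) nz d by (metis dvd_imp_degree_le)
  then have "degree P \<le> (degree M + e) div 2"
    using irr by (cases "P = 0") (auto simp: power2_eq_square degree_mult_eq)
  ultimately show "E \<in> (\<Union>s\<in>{n<..(degree M + e) div 2}. \<Union>S\<in>{S \<in> monics s. coprime S M}. {E \<in> monics e. S ^ 2 dvd D0 + M * E})"
    using E P(2) lc by (intro UN_I[of "degree P"] UN_I[of P]) (auto simp: monics_def)
qed

text \<open>There are at most \<open>q ^ s\<close> choices of \<open>S\<close>, and each square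
  \<open>S ^ 2\<close> confines \<open>E\<close> to one class modulo a polynomial of degree
  \<open>2 * s\<close>. Where \<open>2 * s\<close> exceeds \<open>e\<close>, the truncated exponent
  stands for at most one \<open>E\<close>.\<close>

lemma card_not_squarefree:
  assumes small: "\<And>s. lead_coeff s = 1 \<Longrightarrow> degree s \<le> n \<Longrightarrow> s dvd M"
    and deg: "degree D0 < degree M + e"
  shows "card {E \<in> monics e. \<not> squarefree (D0 + M * E)} \<le>
    (\<Sum>s\<in>{n<..(degree M + e) div 2}. CARD('f) ^ (s + (e - 2 * s)))"
proof -
  let ?q = "CARD('f)"
  let ?V = "\<lambda>S. {E \<in> monics e. S ^ 2 dvd D0 + M * E}"
  have V: "card (?V S) \<le> ?q ^ (e - 2 * s)" if S: "S \<in> monics s" "coprime S M" for S s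
  proof -
    have "coprime (S ^ 2) M" using S by simp
    then obtain c' where c': "\<And>E. S ^ 2 dvd -D0 - M * E \<longleftrightarrow> S ^ 2 dvd E - c'"
      using coprime_class_eq by blast
    have "S ^ 2 dvd D0 + M * E \<longleftrightarrow> S ^ 2 dvd -D0 - M * E" for E
      by (metis dvd_minus_iff minus_add_distrib diff_conv_add_uminus)
    with c' have "?V S = {E \<in> monics e. S ^ 2 dvd E - c'}" by simp
    moreover have "degree (S ^ 2) = 2 * s"
      using S monics_nonzero[OF S(1)] by (simp add: power2_eq_square degree_mult_eq monics_def)
    ultimately show ?thesis
      using card_monics_class_le[of "S ^ 2" e c'] monics_nonzero[OF S(1)] by simp
  qed
  have "card {E \<in> monics e. \<not> squarefree (D0 + M * E)} \<le>
    card (\<Union>s\<in>{n<..(degree M + e) div 2}. \<Union>S\<in>{S \<in> monics s. coprime S M}. ?V S)"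
    by (intro card_mono not_squarefree_subset assms) auto
  also have "\<dots> \<le> (\<Sum>s\<in>{n<..(degree M + e) div 2}. card (\<Union>S\<in>{S \<in> monics s. coprime S M}. ?V S))"
    by (intro card_UN_le) auto
  also have "\<dots> \<le> (\<Sum>s\<in>{n<..(degree M + e) div 2}. ?q ^ (s + (e - 2 * s)))"
  proof (rule sum_mono)
    fix s
    have "card (\<Union>S\<in>{S \<in> monics s. coprime S M}. ?V S) \<le> (\<Sum>S\<in>{S \<in> monics s. coprime S M}. card (?V S))"
      by (intro card_UN_le) auto
    also have "\<dots> \<le> (\<Sum>S\<in>{S \<in> monics s. coprime S M}. ?q ^ (e - 2 * s))"
      using V by (intro sum_mono) auto
    also have "\<dots> = rough M s * ?q ^ (e - 2 * s)" by (simp add: rough_def)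
    also have "\<dots> \<le> ?q ^ s * ?q ^ (e - 2 * s)" by (intro mult_right_mono rough_le) auto
    finally show "card (\<Union>S\<in>{S \<in> monics s. coprime S M}. ?V S) \<le> ?q ^ (s + (e - 2 * s))"
      by (simp add: power_add)
  qed
  finally show ?thesis .
qed

end


section \<open>Numerical estimates and the choice of \<open>D\<close>\<close>

lemma sum_powers_less:
  fixes q :: nat assumes "q \<ge> 3" shows "2 * (\<Sum>t<T. q ^ t) \<le> q ^ T"
proof (induction T)
  case (Suc T)
  have "2 * (\<Sum>t<Suc T. q ^ t) \<le> 3 * q ^ T" using Suc by simp
  also have "\<dots> \<le> q * q ^ T" using assms by (intro mult_right_mono) auto
  finally show ?case by simp
qed simp

lemma sum_powers_le:
  fixes q :: nat assumes "q \<ge> 3" shows "(\<Sum>t\<le>T. q ^ t) \<le> 2 * q ^ T"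
  using sum_powers_less[OF assms, of T] by (simp add: lessThan_Suc_atMost[symmetric])

lemma CARD_ge_3:
  assumes "(2::'f::{field_gcd,finite}) \<noteq> 0" shows "CARD('f) \<ge> 3"
proof -
  have "(2::'f) \<noteq> 1" using one_add_one[where 'a='f] by (metis add_cancel_right_right zero_neq_one)
  then have "card {0, 1, 2::'f} = 3" using assms by auto
  then show ?thesis by (metis card_mono finite_class.finite_UNIV subset_UNIV)
qed

text \<open>Exceptions with \<open>2 * s \<le> e\<close> number at most the sum of
  \<open>q ^ (e - s)\<close> over \<open>s > n\<close>, the others at most the sum of
  \<open>q ^ s\<close> up to half the degree. Together these are at most \<open>q ^ (e - 1)\<close>,
  a third of the family or less.\<close>

lemma half_squarefree:
  fixes M D0 :: "'f::{field_gcd,finite} poly"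
  assumes two: "(2::'f) \<noteq> 0" and M: "M \<noteq> 0"
    and nonres: "\<And>P x. irreducible P \<Longrightarrow> P dvd M \<Longrightarrow> \<not> P dvd x * x - D0"
    and small: "\<And>s. lead_coeff s = 1 \<Longrightarrow> degree s \<le> n \<Longrightarrow> s dvd M" and "n \<ge> 1"
    and e: "degree D0 < degree M + e" "degree M + 4 \<le> e"
  shows "2 * card {E \<in> monics e. squarefree (D0 + M * E)} \<ge> CARD('f) ^ e"
proof -
  let ?q = "CARD('f)" and ?m = "(degree M + e) div 2"
  have q: "?q \<ge> 3" using CARD_ge_3[OF two] .
  let ?N = "{E \<in> monics e. \<not> squarefree (D0 + M * E)}"
  let ?S = "{E \<in> monics e. squarefree (D0 + M * E)}"
  have "card ?N \<le> (\<Sum>s\<in>{n<..?m}. ?q ^ (s + (e - 2 * s)))"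
    by (rule card_not_squarefree[OF M nonres small e(1)])
  also have "\<dots> \<le> (\<Sum>s\<in>{n<..?m}. ?q ^ (e - s) + ?q ^ s)"
  proof (rule sum_mono)
    fix s assume "s \<in> {n<..?m}"
    show "?q ^ (s + (e - 2 * s)) \<le> ?q ^ (e - s) + ?q ^ s"
      by (cases "2 * s \<le> e") (auto simp: trans_le_add1 trans_le_add2)
  qed
  also have "\<dots> = (\<Sum>s\<in>{n<..?m}. ?q ^ (e - s)) + (\<Sum>s\<in>{n<..?m}. ?q ^ s)" by (rule sum.distrib)
  also have "\<dots> \<le> (\<Sum>t<e - n. ?q ^ t) + (\<Sum>t<Suc ?m. ?q ^ t)"
  proof (rule add_mono)
    have "(\<Sum>s\<in>{n<..?m}. ?q ^ (e - s)) = (\<Sum>t\<in>(\<lambda>s. e - s) ` {n<..?m}. ?q ^ t)"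
      using e by (subst sum.reindex) (auto simp: inj_on_def)
    also have "\<dots> \<le> (\<Sum>t<e - n. ?q ^ t)" using e by (intro sum_mono2) auto
    finally show "(\<Sum>s\<in>{n<..?m}. ?q ^ (e - s)) \<le> (\<Sum>t<e - n. ?q ^ t)" .
    show "(\<Sum>s\<in>{n<..?m}. ?q ^ s) \<le> (\<Sum>t<Suc ?m. ?q ^ t)" by (intro sum_mono2) auto
  qed
  finally have "2 * card ?N \<le> ?q ^ (e - n) + ?q ^ Suc ?m"
    using sum_powers_less[OF q, of "e - n"] sum_powers_less[OF q, of "Suc ?m"] by linarith
  \<comment> \<open>\<open>degree M + 4 \<le> e\<close> yields \<open>Suc ?m \<le> e - 1\<close>,
    and \<open>n \<ge> 1\<close> handles the other exponent.\<close>
  also have "\<dots> \<le> ?q ^ (e - 1) + ?q ^ (e - 1)"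
    using e \<open>n \<ge> 1\<close> q by (intro add_mono power_increasing) auto
  finally have "card ?N \<le> ?q ^ (e - 1)" by simp
  moreover have "3 * ?q ^ (e - 1) \<le> ?q * ?q ^ (e - 1)" using q by (intro mult_right_mono) auto
  moreover have "?q * ?q ^ (e - 1) = ?q ^ e" using e by (cases e) auto
  moreover have "card ?S + card ?N = ?q ^ e"
    by (subst card_Un_disjoint[symmetric]) (auto simp: card_monics[symmetric] intro!: arg_cong[of _ _ card])
  ultimately show ?thesis by linarith
qed

text \<open>The main term has density \<open>1 / (n + 1)\<close> and passes through two geometric
  sums, over \<open>k\<close> and over \<open>j\<close>, each costing a factor 2. The second term
  collects the degrees too small for \<open>rough_small\<close>: at most \<open>(e + 1)^2\<close>
  pairs \<open>(j, k)\<close>, each with \<open>k\<close> at most \<open>e div 2\<close>.\<close>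

lemma sum_rough_le:
  fixes M :: "'f::{field_gcd,finite} poly"
  assumes two: "(2::'f) \<noteq> 0" and M: "M \<noteq> 0"
    and small: "\<And>s. lead_coeff s = 1 \<Longrightarrow> degree s \<le> n \<Longrightarrow> s dvd M"
  defines "q \<equiv> real CARD('f)"
  shows "real (\<Sum>j\<le>e. \<Sum>k\<le>j div 2. CARD('f) ^ k * rough M (j - 2 * k)) \<le>
    4 * q ^ e / real (Suc n) + q ^ (degree M + n) * (real e + 1) ^ 2 * q ^ (e div 2)"
proof -
  let ?C = "q ^ (degree M + n)" and ?x = "1 / real (Suc n)"
  have q3: "CARD('f) \<ge> 3" using CARD_ge_3[OF two] .
  have q: "q \<ge> 1" using q3 by (simp add: q_def)
  have geo: "(\<Sum>t\<le>T. q ^ t) \<le> 2 * q ^ T" for T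
    using sum_powers_le[OF q3, of T] unfolding q_def of_nat_power[symmetric] of_nat_sum[symmetric]
    by (metis of_nat_le_iff of_nat_mult of_nat_numeral)
  \<comment> \<open>Adding the constant \<open>?C\<close> makes the density estimate valid in every
    degree.\<close>
  have r: "real (rough M d) \<le> ?x * q ^ d + ?C" for d
  proof (cases "degree M + n \<le> d")
    case True
    have "real (Suc n * rough M d) \<le> real (CARD('f) ^ d)"
      using rough_small[OF M small True] by (simp only: of_nat_le_iff)
    then have "real (rough M d) \<le> ?x * q ^ d" by (simp add: q_def field_simps)
    moreover have "?C \<ge> 0" using q by simp
    ultimately show ?thesis by linarith
  next
    case False
    have "real (rough M d) \<le> real (CARD('f) ^ d)" using rough_le[of M d] by (simp only: of_nat_le_iff)
    also have "\<dots> = q ^ d" by (simp add: q_def)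
    also have "\<dots> \<le> ?C" using q False by (intro power_increasing) auto
    moreover have "?x * q ^ d \<ge> 0" using q by simp
    ultimately show ?thesis by linarith
  qed
  have inner: "(\<Sum>k\<le>j div 2. q ^ k * real (rough M (j - 2 * k))) \<le> ?x * (2 * q ^ j) + ?C * (real e + 1) * q ^ (e div 2)"
    if j: "j \<le> e" for j
  proof -
    have "(\<Sum>k\<le>j div 2. q ^ k * real (rough M (j - 2 * k))) \<le> (\<Sum>k\<le>j div 2. ?x * q ^ (j - k) + ?C * q ^ (e div 2))"
    proof (rule sum_mono)
      fix k assume "k \<in> {..j div 2}"
      then have k: "2 * k \<le> j" by auto
      have "q ^ k * real (rough M (j - 2 * k)) \<le> q ^ k * (?x * q ^ (j - 2 * k) + ?C)"
        using q r by (intro mult_left_mono) auto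
      also have "\<dots> = ?x * q ^ (k + (j - 2 * k)) + ?C * q ^ k" by (simp add: power_add algebra_simps)
      also have "k + (j - 2 * k) = j - k" using k by simp
      also have "?C * q ^ k \<le> ?C * q ^ (e div 2)" using k j q by (intro mult_left_mono power_increasing) auto
      finally show "q ^ k * real (rough M (j - 2 * k)) \<le> ?x * q ^ (j - k) + ?C * q ^ (e div 2)" by simp
    qed
    also have "\<dots> = ?x * (\<Sum>k\<le>j div 2. q ^ (j - k)) + real (Suc (j div 2)) * (?C * q ^ (e div 2))"
      by (simp add: sum.distrib sum_distrib_left)
    also have "\<dots> \<le> ?x * (2 * q ^ j) + (real e + 1) * (?C * q ^ (e div 2))"
    proof (intro add_mono mult_left_mono mult_right_mono)
      have "(\<Sum>k\<le>j div 2. q ^ (j - k)) \<le> (\<Sum>k\<le>j. q ^ (j - k))" using q by (intro sum_mono2) auto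
      also have "\<dots> = (\<Sum>k\<le>j. q ^ k)"
        by (rule sum.reindex_bij_witness[of _ "\<lambda>k. j - k" "\<lambda>k. j - k"]) auto
      also have "\<dots> \<le> 2 * q ^ j" by (rule geo)
      finally show "(\<Sum>k\<le>j div 2. q ^ (j - k)) \<le> 2 * q ^ j" .
      have "j div 2 \<le> e" using j by simp
      then show "real (Suc (j div 2)) \<le> real e + 1" by simp
    qed (use q in auto)
    finally show ?thesis by (simp add: mult_ac)
  qed
  have "real (\<Sum>j\<le>e. \<Sum>k\<le>j div 2. CARD('f) ^ k * rough M (j - 2 * k)) =
      (\<Sum>j\<le>e. \<Sum>k\<le>j div 2. q ^ k * real (rough M (j - 2 * k)))"
    by (simp add: q_def)
  also have "\<dots> \<le> (\<Sum>j\<le>e. ?x * (2 * q ^ j) + ?C * (real e + 1) * q ^ (e div 2))"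
    using inner by (intro sum_mono) auto
  also have "\<dots> = ?x * 2 * (\<Sum>j\<le>e. q ^ j) + (real e + 1) * (?C * (real e + 1) * q ^ (e div 2))"
    by (simp add: sum.distrib sum_distrib_left mult.assoc add.commute)
  also have "\<dots> \<le> ?x * 2 * (2 * q ^ e) + (real e + 1) * (?C * (real e + 1) * q ^ (e div 2))"
    using geo by (intro add_right_mono mult_left_mono) auto
  also have "\<dots> = 4 * q ^ e / real (Suc n) + ?C * (real e + 1) ^ 2 * q ^ (e div 2)"
    by (simp add: power2_eq_square mult_ac)
  finally show ?thesis .
qed

text \<open>Absorbs the error term of \<open>sum_rough_le\<close>, whose exponential growth is only
  of half the rate.\<close>

lemma exp_beats_square:
  fixes C q :: real assumes "C > 0" "q \<ge> 2"
  shows "\<exists>e0. \<forall>e\<ge>e0. C * (real e + 1) ^ 2 * q ^ (e div 2) \<le> q ^ e"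
proof -
  have "((\<lambda>h::nat. (2 * real h + 2) ^ 2 / 2 ^ h) \<longlongrightarrow> 0) at_top" by real_asymp
  then have "eventually (\<lambda>h::nat. (2 * real h + 2) ^ 2 / 2 ^ h < 1 / C) at_top"
    using assms by (intro order_tendstoD) auto
  then obtain h0 where h0: "\<And>h. h \<ge> h0 \<Longrightarrow> (2 * real h + 2) ^ 2 / 2 ^ h < 1 / C"
    by (auto simp: eventually_at_top_linorder)
  have "C * (real e + 1) ^ 2 * q ^ (e div 2) \<le> q ^ e" if "e \<ge> 2 * h0" for e
  proof -
    let ?h = "e div 2"
    have "C * (2 * real ?h + 2) ^ 2 \<le> 2 ^ ?h"
      using h0[of ?h] that assms by (simp add: field_simps less_imp_le)
    moreover have "(real e + 1) ^ 2 \<le> (2 * real ?h + 2) ^ 2" by (intro power_mono) linarith+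
    then have "C * (real e + 1) ^ 2 \<le> C * (2 * real ?h + 2) ^ 2" using assms by (intro mult_left_mono) auto
    moreover have "(2::real) ^ ?h \<le> q ^ ?h" using assms by (intro power_mono) auto
    ultimately have "C * (real e + 1) ^ 2 \<le> q ^ ?h" by linarith
    then have "C * (real e + 1) ^ 2 * q ^ ?h \<le> q ^ ?h * q ^ ?h" using assms by (intro mult_right_mono) auto
    also have "\<dots> \<le> q ^ e" unfolding power_add[symmetric] using assms by (intro power_increasing) auto
    finally show ?thesis .
  qed
  then show ?thesis by blast
qed

text \<open>If every squarefree member of the family had too many ideals, then these members, at
  least half of all, would exceed the total count over the whole family.\<close>

theorem few_ideals_exists:
  fixes \<epsilon> :: real
  assumes two: "(2::'f::{field_gcd,finite}) \<noteq> 0" and "\<epsilon> > 0"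
  obtains D :: "'f::{field_gcd,finite} poly" and g m where "lead_coeff D = 1" "degree D = 2 * g + 1" "squarefree D" "g + 1 \<le> m"
    "real (\<Sum>j\<le>m. card (triples j D)) \<le> \<epsilon> * real (CARD('f) ^ m)"
proof -
  let ?q = "CARD('f)" and ?Q = "real CARD('f)"
  have q3: "?q \<ge> 3" using CARD_ge_3[OF two] .
  \<comment> \<open>The 10 is twice 5: the sum of rough counts is at most
    \<open>5 * q ^ e / (n + 1)\<close>, and restricting to squarefree members costs a factor
    2.\<close>
  obtain n where n: "n \<ge> 1" "10 / real (Suc n) \<le> \<epsilon>"
  proof -
    obtain n0 where "n0 > 0" "inverse (real n0) < \<epsilon> / 10"
      using reals_Archimedean[of "\<epsilon> / 10"] \<open>\<epsilon> > 0\<close> by (metis divide_pos_pos ex_inverse_of_nat_less zero_less_numeral)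
    then have "10 / real n0 \<le> \<epsilon>" by (simp add: field_simps)
    moreover have "10 / real (Suc n0) \<le> 10 / real n0" using \<open>n0 > 0\<close> by (simp add: field_simps)
    ultimately show thesis using that[of n0] \<open>n0 > 0\<close> by simp
  qed
  define S :: "'f poly set" where "S = (\<Union>k\<le>n. monics k)"
  define M where "M = \<Prod>S"
  have finS: "finite S" by (simp add: S_def)
  have M0: "M \<noteq> 0" using finS monics_nonzero by (auto simp: M_def S_def)
  have lM: "lead_coeff M = 1" unfolding M_def lead_coeff_prod by (rule prod.neutral) (auto simp: S_def monics_def)
  have small: "s dvd M" if "lead_coeff s = 1" "degree s \<le> n" for s
    unfolding M_def using that finS by (intro dvd_prodI) (auto simp: S_def monics_def)
  obtain D0 where nonres: "\<And>P x. irreducible P \<Longrightarrow> P dvd M \<Longrightarrow> \<not> P dvd x * x - D0"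
    using nonresidue_exists_dvd[OF M0 two] by blast
  \<comment> \<open>The factor \<open>Suc n\<close> brings the error below
    \<open>q ^ e / (n + 1)\<close>, which turns the 4 of the main term into 5.\<close>
  have "\<exists>e0. \<forall>e\<ge>e0. (real (Suc n) * ?Q ^ (degree M + n)) * (real e + 1) ^ 2 * ?Q ^ (e div 2) \<le> ?Q ^ e"
    using q3 by (intro exp_beats_square) auto
  then obtain e0 where e0: "\<And>e. e \<ge> e0 \<Longrightarrow> (real (Suc n) * ?Q ^ (degree M + n)) * (real e + 1) ^ 2 * ?Q ^ (e div 2) \<le> ?Q ^ e"
    by blast
  define e1 where "e1 = e0 + degree D0 + degree M + 4"
  \<comment> \<open>Adjusts the parity so that \<open>degree M + e\<close>, the degree of
    \<open>D\<close>, is odd.\<close>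
  define e where "e = (if odd (degree M + e1) then e1 else Suc e1)"
  have e: "odd (degree M + e)" "e \<ge> e0" "degree D0 < degree M + e" "degree M + 4 \<le> e"
    by (auto simp: e_def e1_def)
  let ?W = "\<Sum>j\<le>e. \<Sum>k\<le>j div 2. ?q ^ k * rough M (j - 2 * k)"
  have W: "real ?W \<le> 5 * ?Q ^ e / real (Suc n)"
    using sum_rough_le[OF two M0 small, of n e] e0[OF e(2)] by (simp add: field_simps)
  let ?G = "{E \<in> monics e. squarefree (D0 + M * E)}"
  let ?A = "\<lambda>E. \<Sum>j\<le>e. card (triples j (D0 + M * E))"
  have half: "2 * card ?G \<ge> ?q ^ e"
    by (rule half_squarefree[OF two M0 nonres small n(1) e(3,4)])
  have "(\<Sum>E\<in>?G. ?A E) \<le> (\<Sum>E\<in>monics e. ?A E)" by (intro sum_mono2) auto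
  also have "\<dots> = (\<Sum>j\<le>e. \<Sum>E\<in>monics e. card (triples j (D0 + M * E)))" by (rule sum.swap)
  also have "\<dots> \<le> (\<Sum>j\<le>e. ?q ^ e * (\<Sum>k\<le>j div 2. ?q ^ k * rough M (j - 2 * k)))"
    by (intro sum_mono sum_card_triples[OF M0 nonres]) auto
  also have "\<dots> = ?q ^ e * ?W" by (simp add: sum_distrib_left)
  finally have sumG: "(\<Sum>E\<in>?G. ?A E) \<le> ?q ^ e * ?W" .
  have "\<exists>E\<in>?G. real (?A E) \<le> \<epsilon> * real (?q ^ e)"
  proof (rule ccontr)
    assume "\<not> (\<exists>E\<in>?G. real (?A E) \<le> \<epsilon> * real (?q ^ e))"
    then have big: "E \<in> ?G \<Longrightarrow> \<epsilon> * ?Q ^ e < real (?A E)" for E by (simp add: not_le)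
    have "?q ^ e > 0" by simp
    with half have "card ?G > 0" by linarith
    then have "?G \<noteq> {}" by (metis card.empty less_irrefl)
    then have "(\<Sum>E\<in>?G. \<epsilon> * ?Q ^ e) < (\<Sum>E\<in>?G. real (?A E))"
      using big by (intro sum_strict_mono) auto
    also have "\<dots> = real (\<Sum>E\<in>?G. ?A E)" by simp
    also have "\<dots> \<le> real (?q ^ e * ?W)" using sumG by (simp only: of_nat_le_iff)
    also have "\<dots> = ?Q ^ e * real ?W" by (simp only: of_nat_mult of_nat_power)
    also have "\<dots> \<le> ?Q ^ e * (5 * ?Q ^ e / real (Suc n))" using W by (intro mult_left_mono) auto
    finally have "real (card ?G) * (\<epsilon> * ?Q ^ e) < ?Q ^ e * (5 * ?Q ^ e / real (Suc n))" by simp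
    moreover have "?Q ^ e \<le> 2 * real (card ?G)"
      using of_nat_mono[OF half, where 'a=real] by simp
    then have "?Q ^ e * (\<epsilon> * ?Q ^ e) \<le> 2 * real (card ?G) * (\<epsilon> * ?Q ^ e)"
      using \<open>\<epsilon> > 0\<close> by (intro mult_right_mono) auto
    ultimately have "?Q ^ e * (\<epsilon> * ?Q ^ e) < 2 * (?Q ^ e * (5 * ?Q ^ e / real (Suc n)))" by linarith
    then have "?Q ^ e * ?Q ^ e * \<epsilon> < ?Q ^ e * ?Q ^ e * (10 / real (Suc n))" by (simp add: mult_ac)
    then have "\<epsilon> < 10 / real (Suc n)" using q3 by (subst (asm) mult_less_cancel_left_pos) auto
    with n show False by simp
  qed
  then obtain E where E: "E \<in> monics e" "squarefree (D0 + M * E)" "real (?A E) \<le> \<epsilon> * real (?q ^ e)" by blast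
  have dM: "degree (M * E) = degree M + e"
    using E(1) M0 monics_nonzero[OF E(1)] by (simp add: degree_mult_eq monics_def)
  have d: "degree (D0 + M * E) = degree M + e" using dM e(3) degree_add_eq_right by metis
  have "lead_coeff (D0 + M * E) = lead_coeff (M * E)"
    using dM e(3) lead_coeff_add_le[of D0 "M * E"] by simp
  also have "\<dots> = 1" using lM E(1) by (metis (mono_tags, lifting) lead_coeff_mult mem_Collect_eq monics_def mult_1)
  finally have l: "lead_coeff (D0 + M * E) = 1" .
  show thesis
  proof (rule that[OF l _ E(2) _ E(3)])
    show "degree (D0 + M * E) = 2 * ((degree M + e) div 2) + 1" using d e(1) by presburger
    show "(degree M + e) div 2 + 1 \<le> e" using e(4) by linarith
  qed
qed

section \<open>Products of additive subgroups\<close>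

text \<open>Finite sums of elements of \<open>S\<close>. For products of elements of ideals this set
  is closed under negation, hence the generated additive group.\<close>

inductive_set aspan :: "'a::comm_ring_1 set \<Rightarrow> 'a set" for S where
  zero: "0 \<in> aspan S"
| add: "x \<in> S \<Longrightarrow> z \<in> aspan S \<Longrightarrow> x + z \<in> aspan S"

lemma aspan_base: "x \<in> S \<Longrightarrow> x \<in> aspan S"
  using aspan.add[OF _ aspan.zero] by force

lemma aspan_plus: "x \<in> aspan S \<Longrightarrow> z \<in> aspan S \<Longrightarrow> x + z \<in> aspan S"
  by (induction x rule: aspan.induct) (auto simp: add.assoc intro: aspan.add)

lemma aspan_induct_closed:
  assumes "x \<in> aspan S" "P 0" "\<And>x z. P x \<Longrightarrow> P z \<Longrightarrow> P (x + z)" "\<And>x. x \<in> S \<Longrightarrow> P x"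
  shows "P x"
  using assms(1) by induction (use assms in auto)

text \<open>Defined for arbitrary sets, so that commutativity and associativity hold without side
  conditions; folding over a multiset relies on this.\<close>

definition imul :: "'a::comm_ring_1 set \<Rightarrow> 'a set \<Rightarrow> 'a set" where
  "imul I J = aspan {x * z | x z. x \<in> I \<and> z \<in> J}"

lemma imulI: "x \<in> I \<Longrightarrow> z \<in> J \<Longrightarrow> x * z \<in> imul I J"
  unfolding imul_def by (rule aspan_base) blast

lemma imul_0: "0 \<in> imul I J"
  by (simp add: imul_def aspan.zero)

lemma imul_plus: "x \<in> imul I J \<Longrightarrow> z \<in> imul I J \<Longrightarrow> x + z \<in> imul I J"
  by (simp add: imul_def aspan_plus)

lemma imul_induct [consumes 1, case_names zero add mult]:
  assumes "x \<in> imul I J" "P 0" "\<And>x z. P x \<Longrightarrow> P z \<Longrightarrow> P (x + z)" "\<And>x z. x \<in> I \<Longrightarrow> z \<in> J \<Longrightarrow> P (x * z)"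
  shows "P x"
  using assms(1) unfolding imul_def by (rule aspan_induct_closed) (use assms in auto)

lemma imul_commute: "imul I J = imul J I"
proof -
  have "{x * z | x z. x \<in> I \<and> z \<in> J} = {x * z | x z. x \<in> J \<and> z \<in> I}"
    by (auto simp: mult.commute) (metis mult.commute)+
  then show ?thesis by (simp add: imul_def)
qed

lemma imul_assocI: "w \<in> imul J K \<Longrightarrow> x \<in> I \<Longrightarrow> x * w \<in> imul (imul I J) K"
proof (erule imul_induct)
  fix j k assume "x \<in> I" "j \<in> J" "k \<in> K"
  then show "x * (j * k) \<in> imul (imul I J) K"
    using imulI[OF imulI[of x I j J], of k K] by (simp add: mult.assoc)
qed (auto simp: imul_0 distrib_left imul_plus)

lemma imul_leI:
  assumes "0 \<in> T" "\<And>x z. x \<in> T \<Longrightarrow> z \<in> T \<Longrightarrow> x + z \<in> T" "\<And>x z. x \<in> I \<Longrightarrow> z \<in> J \<Longrightarrow> x * z \<in> T"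
  shows "imul I J \<subseteq> T"
proof
  fix x assume "x \<in> imul I J" then show "x \<in> T"
    by (rule imul_induct[of _ I J "\<lambda>x. x \<in> T"]) (use assms in auto)
qed

lemma imul_assoc_subset: "imul I (imul J K) \<subseteq> imul (imul I J) K"
  by (intro imul_leI) (auto intro: imul_0 imul_plus imul_assocI)

lemma imul_assoc: "imul (imul I J) K = imul I (imul J K)"
proof
  show "imul (imul I J) K \<subseteq> imul I (imul J K)"
    using imul_assoc_subset[of K J I] by (simp add: imul_commute)
qed (rule imul_assoc_subset)

lemma imul_left_commute: "imul I (imul J K) = imul J (imul I K)"
  by (metis imul_assoc imul_commute)

lemma imul_mono: "I \<subseteq> I' \<Longrightarrow> J \<subseteq> J' \<Longrightarrow> imul I J \<subseteq> imul I' J'"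
  by (intro imul_leI) (auto intro: imul_0 imul_plus imulI)

text \<open>An element of least degree divides all others by division with remainder; scaling makes
  it monic.\<close>

lemma poly_ideal_principal:
  fixes S :: "'f::field poly set"
  assumes add: "\<And>a b. a \<in> S \<Longrightarrow> b \<in> S \<Longrightarrow> a + b \<in> S" and mul: "\<And>a r. a \<in> S \<Longrightarrow> r * a \<in> S"
    and ne: "\<exists>a\<in>S. a \<noteq> 0"
  shows "\<exists>d. lead_coeff d = 1 \<and> (\<forall>a. a \<in> S \<longleftrightarrow> d dvd a)"
proof -
  obtain a where a: "a \<in> S" "a \<noteq> 0" "\<And>b. b \<in> S \<Longrightarrow> b \<noteq> 0 \<Longrightarrow> degree a \<le> degree b"
    using ne exists_least_iff[of "\<lambda>n. \<exists>a\<in>S. a \<noteq> 0 \<and> degree a = n"] by (metis leI)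
  have "a dvd b" if "b \<in> S" for b
  proof -
    have "b mod a = b + (- (b div a)) * a" by (simp add: minus_div_mult_eq_mod[symmetric])
    then have "b mod a \<in> S" using add mul a(1) that by metis
    then have "b mod a = 0" using a(3)[of "b mod a"] degree_mod_less[OF a(2), of b] by (meson not_less)
    then show ?thesis by (simp add: dvd_eq_mod_eq_0)
  qed
  then have S: "b \<in> S \<longleftrightarrow> a dvd b" for b
    using mul[OF a(1)] by (auto simp: dvd_def mult.commute)
  let ?d = "smult (inverse (lead_coeff a)) a"
  have "lead_coeff ?d = 1" using a(2) by simp
  moreover have "?d dvd b \<longleftrightarrow> a dvd b" for b using a(2) by (simp add: smult_dvd_iff)
  ultimately show ?thesis using S by metis
qed

section \<open>The ring \<open>\<bbbF>\<^sub>q[t][\<surd>D]\<close>\<close>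

text \<open>The ambient field only has to contain a copy of the polynomial ring and a square root
  \<open>y\<close> of \<open>D\<close>, so that ring, fraction field and places can all be subsets
  of one type. The number \<open>g\<close> is the genus.\<close>

locale hyperelliptic =
  fixes emb :: "'f::{field_gcd,finite} poly \<Rightarrow> 'o::field" and y :: 'o and D :: "'f poly" and g :: nat
  assumes emb_add: "emb (a + b) = emb a + emb b"
    and emb_mult: "emb (a * b) = emb a * emb b"
    and emb_1 [simp]: "emb 1 = 1"
    and emb_eq_0D: "emb a = 0 \<Longrightarrow> a = 0"
    and y_squared: "y * y = emb D"
    and D_monic: "lead_coeff D = 1"
    and D_degree: "degree D = 2 * g + 1"
    and D_squarefree: "squarefree D"
    and two_nonzero: "(2::'f) \<noteq> 0"
begin

lemma emb_0 [simp]: "emb 0 = 0"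
  using emb_add[of 0 0] by (metis add.right_neutral add_left_cancel)

lemma emb_minus: "emb (- a) = - emb a"
  using emb_add[of a "- a"] by (simp add: eq_neg_iff_add_eq_0 add.commute)

lemma emb_diff: "emb (a - b) = emb a - emb b"
  using emb_add[of a "- b"] by (simp add: emb_minus)

lemma emb_eq_0_iff [simp]: "emb a = 0 \<longleftrightarrow> a = 0"
  using emb_eq_0D by auto

lemma emb_eq_iff [simp]: "emb a = emb b \<longleftrightarrow> a = b"
  using emb_eq_0_iff[of "a - b"] by (simp add: emb_diff)

lemmas emb_simps = emb_add emb_mult emb_minus emb_diff

definition el :: "'f poly \<Rightarrow> 'f poly \<Rightarrow> 'o" where
  "el a b = emb a + emb b * y"

lemma el_add: "el a b + el c d = el (a + c) (b + d)"
  by (simp add: el_def emb_simps algebra_simps)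

lemma el_diff: "el a b - el c d = el (a - c) (b - d)"
  by (simp add: el_def emb_simps algebra_simps)

lemma el_minus: "- el a b = el (- a) (- b)"
  by (simp add: el_def emb_simps)

lemma el_mult: "el a b * el c d = el (a * c + D * b * d) (a * d + b * c)"
proof -
  have "el a b * el c d = emb a * emb c + emb b * emb d * (y * y) + (emb a * emb d + emb b * emb c) * y"
    by (simp add: el_def algebra_simps)
  then show ?thesis by (simp add: y_squared el_def emb_simps algebra_simps)
qed

lemma el_0 [simp]: "el 0 0 = 0"
  by (simp add: el_def)

lemma el_emb: "el a 0 = emb a"
  by (simp add: el_def)

lemma emb_mult_el: "emb c * el a b = el (c * a) (c * b)"
  by (simp add: el_def emb_simps algebra_simps)

lemma degree_square: "degree (a * a :: 'f poly) = 2 * degree a"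
  by (cases "a = 0") (auto simp: degree_mult_eq)

lemma D_nonzero: "D \<noteq> 0"
  using D_degree by auto

lemma degree_D_square: "b \<noteq> 0 \<Longrightarrow> degree (D * b * b) = 2 * degree b + 2 * g + 1"
  using D_nonzero by (simp add: degree_mult_eq D_degree)

text \<open>
  As \<open>deg D\<close> is odd, the leading terms of \<open>a\<^sup>2\<close> and \<open>D b\<^sup>2\<close> never cancel.
\<close>

lemma degree_norm_less_iff:
  assumes "a \<noteq> 0 \<or> b \<noteq> 0"
  shows "degree (a * a - D * b * b) < s \<longleftrightarrow> a \<in> below ((s + 1) div 2) \<and> b \<in> below ((s - 2 * g) div 2) \<and> s > 0"
proof -
  consider "a = 0" "b \<noteq> 0" | "a \<noteq> 0" "b = 0" | "a \<noteq> 0" "b \<noteq> 0" using assms by blast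
  then show ?thesis
  proof cases
    case 1
    then show ?thesis by (auto simp: degree_D_square below_def)
  next
    case 2
    then show ?thesis by (auto simp: degree_square below_def)
  next
    case 3
    have "degree (a * a) \<noteq> degree (D * b * b)"
      using 3 by (simp add: degree_square degree_D_square) presburger
    then have "degree (a * a - D * b * b) = max (degree (a * a)) (degree (D * b * b))"
      using degree_add_eq_left[of "- (D * b * b)" "a * a"] degree_add_eq_right[of "a * a" "- (D * b * b)"]
      by (cases "degree (a * a) < degree (D * b * b)") (auto simp: max_def)
    then show ?thesis using 3
      by (auto simp: degree_square degree_D_square below_def)
  qed
qed

lemma norm_nonzero: "a \<noteq> 0 \<or> b \<noteq> 0 \<Longrightarrow> a * a - D * b * b \<noteq> 0"
proof
  assume ab: "a \<noteq> 0 \<or> b \<noteq> 0" and "a * a - D * b * b = 0"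
  then have eq: "a * a = D * b * b" by simp
  show False
  proof (cases "b = 0")
    case False
    then have "2 * degree a = 2 * degree b + 2 * g + 1"
      using arg_cong[OF eq, of degree] by (simp add: degree_square degree_D_square)
    then show False by presburger
  qed (use ab eq in auto)
qed

text \<open>Multiplying by the conjugate gives a vanishing norm, which the parity of degrees
  excludes. So \<open>1\<close> and \<open>y\<close> are linearly independent over the polynomials
  and coordinates are unique.\<close>

lemma el_eq_0_iff [simp]: "el a b = 0 \<longleftrightarrow> a = 0 \<and> b = 0"
proof
  assume "el a b = 0"
  then have "el a b * el a (- b) = 0" by simp
  then have "emb (a * a - D * b * b) = 0" by (simp add: el_mult el_emb algebra_simps)
  then show "a = 0 \<and> b = 0" using norm_nonzero[of a b] by auto
qed auto

lemma el_eq_iff [simp]: "el a b = el c d \<longleftrightarrow> a = c \<and> b = d"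
  using el_eq_0_iff[of "a - c" "b - d"] by (simp add: el_diff[symmetric])

definition RD :: "'o set" where "RD = {el a b | a b. True}"

definition c0 :: "'o \<Rightarrow> 'f poly" where "c0 x = (THE a. \<exists>b. x = el a b)"
definition c1 :: "'o \<Rightarrow> 'f poly" where "c1 x = (THE b. \<exists>a. x = el a b)"

lemma c0_el [simp]: "c0 (el a b) = a" and c1_el [simp]: "c1 (el a b) = b"
  by (auto simp: c0_def c1_def)

lemma el_in_RD [simp]: "el a b \<in> RD" and emb_in_RD [simp]: "emb a \<in> RD"
  using el_emb[of a] by (auto simp: RD_def) metis

lemma RD_cases: assumes "x \<in> RD" obtains a b where "x = el a b"
  using assms by (auto simp: RD_def)

lemma RD_add: "x \<in> RD \<Longrightarrow> z \<in> RD \<Longrightarrow> x + z \<in> RD"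
  and RD_mult: "x \<in> RD \<Longrightarrow> z \<in> RD \<Longrightarrow> x * z \<in> RD"
  and RD_diff: "x \<in> RD \<Longrightarrow> z \<in> RD \<Longrightarrow> x - z \<in> RD"
  and RD_minus: "x \<in> RD \<Longrightarrow> - x \<in> RD"
  by (auto elim!: RD_cases simp: el_add el_mult el_diff el_minus)

lemma RD_1 [simp]: "1 \<in> RD" and RD_0 [simp]: "0 \<in> RD"
  using emb_in_RD[of 1] emb_in_RD[of 0] by simp_all

definition cj :: "'o \<Rightarrow> 'o" where "cj x = el (c0 x) (- c1 x)"

lemma cj_el [simp]: "cj (el a b) = el a (- b)"
  by (simp add: cj_def)

lemma cj_in_RD [simp]: "cj x \<in> RD"
  by (simp add: cj_def)

lemma cj_cj: "x \<in> RD \<Longrightarrow> cj (cj x) = x"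
  by (auto elim!: RD_cases)

lemma cj_add: "x \<in> RD \<Longrightarrow> z \<in> RD \<Longrightarrow> cj (x + z) = cj x + cj z"
  and cj_mult: "x \<in> RD \<Longrightarrow> z \<in> RD \<Longrightarrow> cj (x * z) = cj x * cj z"
  by (auto elim!: RD_cases simp: el_add el_mult)

lemma cj_0 [simp]: "cj 0 = 0"
  using cj_el[of 0 0] by simp

definition nm :: "'o \<Rightarrow> 'f poly" where "nm x = c0 x * c0 x - D * c1 x * c1 x"

lemma nm_el: "nm (el a b) = a * a - D * b * b"
  by (simp add: nm_def)

lemma mult_cj: "x \<in> RD \<Longrightarrow> x * cj x = emb (nm x)"
  by (auto elim!: RD_cases simp: el_mult nm_el el_emb algebra_simps)

lemma nm_mult: assumes "x \<in> RD" "z \<in> RD" shows "nm (x * z) = nm x * nm z"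
proof -
  have "emb (nm (x * z)) = (x * cj x) * (z * cj z)"
    using assms by (simp add: mult_cj[symmetric] RD_mult cj_mult mult_ac)
  then show ?thesis using assms by (simp add: mult_cj flip: emb_mult)
qed

lemma nm_eq_0_iff: "x \<in> RD \<Longrightarrow> nm x = 0 \<longleftrightarrow> x = 0"
  by (erule RD_cases) (use norm_nonzero in \<open>force simp: nm_el\<close>)

text \<open>The pole order of \<open>x\<close> at the infinite place, which by
  \<open>ideg_prin\<close> is also the degree of the principal ideal of \<open>x\<close>.\<close>

definition dg :: "'o \<Rightarrow> nat" where "dg x = degree (nm x)"

lemma dg_mult: "x \<in> RD \<Longrightarrow> z \<in> RD \<Longrightarrow> x \<noteq> 0 \<Longrightarrow> z \<noteq> 0 \<Longrightarrow> dg (x * z) = dg x + dg z"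
  by (simp add: dg_def nm_mult degree_mult_eq nm_eq_0_iff)

lemma dg_emb: "dg (emb a) = 2 * degree a"
  by (simp add: dg_def degree_square nm_el flip: el_emb)

text \<open>\<open>LS s\<close> consists of the elements whose pole order at infinity is less than \<open>s\<close>.\<close>

definition LS :: "nat \<Rightarrow> 'o set" where
  "LS s = {x \<in> RD. x = 0 \<or> dg x < s}"

lemma el_in_LS_iff: "el a b \<in> LS s \<longleftrightarrow> a \<in> below ((s + 1) div 2) \<and> b \<in> below ((s - 2 * g) div 2)"
proof (cases "a = 0 \<and> b = 0")
  case False
  then show ?thesis using degree_norm_less_iff[of a b s]
    by (cases "s = 0") (auto simp: LS_def dg_def nm_el)
qed (auto simp: LS_def below_def)

lemma LS_eq: "LS s = (\<lambda>(a, b). el a b) ` (below ((s + 1) div 2) \<times> below ((s - 2 * g) div 2))"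
proof (intro equalityI subsetI)
  fix x assume x: "x \<in> LS s"
  then obtain a b where "x = el a b" by (auto simp: LS_def elim: RD_cases)
  with x show "x \<in> (\<lambda>(a, b). el a b) ` (below ((s + 1) div 2) \<times> below ((s - 2 * g) div 2))"
    by (auto simp: el_in_LS_iff)
qed (auto simp: el_in_LS_iff)

lemma finite_LS [simp]: "finite (LS s)"
  by (simp add: LS_eq)

text \<open>The case of Riemann-Roch for multiples of the infinite place: from
  \<open>s = 2 * g\<close> on, the two coordinates offer
  \<open>(s + 1) div 2 + (s - 2 * g) div 2 = s - g\<close> free coefficients.\<close>

lemma card_LS: "s \<ge> 2 * g \<Longrightarrow> card (LS s) = CARD('f) ^ (s - g)"
proof -
  assume s: "s \<ge> 2 * g"
  have "(s + 1) div 2 + (s - 2 * g) div 2 = s - g"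
  proof -
    obtain t where "s = 2 * g + t" using s le_Suc_ex by blast
    then show ?thesis by simp
  qed
  moreover have inj: "inj_on (\<lambda>(a, b). el a b) A" for A by (intro inj_onI) auto
  have "card (LS s) = CARD('f) ^ ((s + 1) div 2) * CARD('f) ^ ((s - 2 * g) div 2)"
    unfolding LS_eq card_image[OF inj] card_cartesian_product by (simp add: card_below)
  ultimately show ?thesis by (simp flip: power_add)
qed

lemma LS_cases: assumes "x \<in> LS s"
  obtains a b where "x = el a b" "a \<in> below ((s + 1) div 2)" "b \<in> below ((s - 2 * g) div 2)"
  using assms that unfolding LS_eq by auto

lemma LS_add: assumes "x \<in> LS s" "z \<in> LS s" shows "x + z \<in> LS s"
proof -
  from assms obtain a b c d where "x = el a b" "z = el c d" "el a b \<in> LS s" "el c d \<in> LS s"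
    by (metis LS_cases)
  then show ?thesis by (simp only: el_add el_in_LS_iff) (blast intro: below_add)
qed

lemma LS_diff: assumes "x \<in> LS s" "z \<in> LS s" shows "x - z \<in> LS s"
proof -
  from assms obtain a b c d where "x = el a b" "z = el c d" "el a b \<in> LS s" "el c d \<in> LS s"
    by (metis LS_cases)
  then show ?thesis by (simp only: el_diff el_in_LS_iff) (blast intro: below_diff)
qed

lemma LS_mono: "s \<le> s' \<Longrightarrow> LS s \<subseteq> LS s'"
  by (auto simp: LS_def)

section \<open>Ideals\<close>

text \<open>The zero ideal is excluded, so that ideals form a monoid with cancellation.\<close>

definition ideal :: "'o set \<Rightarrow> bool" where
  "ideal I \<longleftrightarrow> I \<subseteq> RD \<and> (\<exists>x\<in>I. x \<noteq> 0) \<and> (\<forall>x\<in>I. \<forall>z\<in>I. x + z \<in> I) \<and> (\<forall>x\<in>I. \<forall>r\<in>RD. r * x \<in> I)"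

lemma idealD:
  assumes "ideal I"
  shows ideal_subset: "I \<subseteq> RD" and ideal_nonzero: "\<exists>x\<in>I. x \<noteq> 0"
    and ideal_add: "x \<in> I \<Longrightarrow> z \<in> I \<Longrightarrow> x + z \<in> I" and ideal_mult: "x \<in> I \<Longrightarrow> r \<in> RD \<Longrightarrow> r * x \<in> I"
  using assms by (auto simp: ideal_def)

lemma ideal_0: "ideal I \<Longrightarrow> 0 \<in> I"
  using ideal_nonzero ideal_mult[of I _ 0] by force

lemma ideal_minus: "ideal I \<Longrightarrow> x \<in> I \<Longrightarrow> - x \<in> I"
  using ideal_mult[of I x "- 1"] RD_minus[OF RD_1] by simp

lemma ideal_diff: "ideal I \<Longrightarrow> x \<in> I \<Longrightarrow> z \<in> I \<Longrightarrow> x - z \<in> I"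
  using ideal_add[of I x "- z"] ideal_minus by simp

lemma ideal_RD: "ideal RD"
  using RD_1 by (auto simp: ideal_def RD_add RD_mult intro!: bexI[of _ 1])

lemma ideal_eq_RD_iff: "ideal I \<Longrightarrow> I = RD \<longleftrightarrow> 1 \<in> I"
  using ideal_subset[of I] ideal_mult[of I 1] by auto

text \<open>The lattice with polynomial basis \<open>c Q\<close> and \<open>c (b + y)\<close>: a
  Hermite normal form with respect to the coordinates \<open>1\<close> and \<open>y\<close>.\<close>

definition hnf :: "'f poly \<Rightarrow> 'f poly \<Rightarrow> 'f poly \<Rightarrow> 'o set" where
  "hnf c Q b = {el (c * (Q * u + v * b)) (c * v) | u v. True}"

lemma el_in_hnf: "el (c * (Q * u + v * b)) (c * v) \<in> hnf c Q b"
  by (auto simp: hnf_def)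

lemma el_in_hnf_iff: "el a e \<in> hnf c Q b \<longleftrightarrow> (\<exists>u v. a = c * (Q * u + v * b) \<and> e = c * v)"
  by (auto simp: hnf_def)

text \<open>The lattice is stable under \<open>y\<close>, because
  \<open>y (b + y) = b (b + y) - (b * b - D)\<close> and the last term is a multiple of
  \<open>Q\<close>.\<close>

lemma ideal_hnf:
  assumes "c \<noteq> 0" "Q \<noteq> 0" "Q dvd b * b - D"
  shows "ideal (hnf c Q b)"
proof -
  obtain Q' where Q': "b * b - D = Q * Q'" using assms(3) by blast
  then have D: "D = b * b - Q * Q'" by (simp add: algebra_simps)
  have "\<exists>x\<in>hnf c Q b. x \<noteq> 0"
    using el_in_hnf[of c Q 1 0 b] assms by (intro bexI[of _ "el (c * Q) 0"]) auto
  moreover have "el (c * (Q * u + v * b)) (c * v) + el (c * (Q * u' + v' * b)) (c * v') \<in> hnf c Q b" for u v u' v'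
    using el_in_hnf[of c Q "u + u'" "v + v'" b] by (simp add: el_add algebra_simps)
  moreover have "el r s * el (c * (Q * u + v * b)) (c * v) \<in> hnf c Q b" for u v r s
  proof -
    let ?v = "r * v + s * (Q * u + v * b)"
    have "el r s * el (c * (Q * u + v * b)) (c * v) =
      el (c * (Q * (r * u - s * u * b - s * v * Q') + ?v * b)) (c * ?v)"
      unfolding el_mult by (simp add: D algebra_simps)
    then show ?thesis using el_in_hnf by metis
  qed
  ultimately show ?thesis unfolding ideal_def hnf_def
    by (auto elim!: RD_cases)
qed

text \<open>The polynomials in \<open>I\<close> form a principal ideal \<open>(p)\<close>, the
  second coordinates of elements of \<open>I\<close> another one, \<open>(c)\<close>. Multiplication
  by \<open>y\<close> moves the first coordinate into second place, so \<open>c\<close> divides all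
  first coordinates too. This gives \<open>p = c Q\<close> and an element \<open>c (b0 + y)\<close>,
  where \<open>b0\<close> may be reduced modulo \<open>Q\<close>.\<close>

lemma hnf_exists:
  assumes "ideal I"
  shows "\<exists>c Q b. lead_coeff c = 1 \<and> lead_coeff Q = 1 \<and> b mod Q = b \<and> Q dvd b * b - D \<and> I = hnf c Q b"
proof -
  note I = idealD[OF assms]
  let ?J0 = "{u. el u 0 \<in> I}" and ?J1 = "{v. \<exists>u. el u v \<in> I}"
  have mulI: "el (r * u) (r * v) \<in> I" if "el u v \<in> I" for u v r
    using I(4)[OF that emb_in_RD[of r]] by (simp add: emb_mult_el)
  obtain x where x: "x \<in> I" "x \<noteq> 0" using I by auto
  then have xO: "x \<in> RD" using I(1) by blast
  have "cj x * x \<in> I" using x I(4) by simp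
  then have nx: "emb (nm x) \<in> I" using mult_cj[OF xO] by (simp add: mult.commute)
  have nx0: "nm x \<noteq> 0" using x xO by (simp add: nm_eq_0_iff)
  have J0: "\<exists>a\<in>?J0. a \<noteq> 0" using nx nx0 by (auto simp: el_emb)
  have J0_add: "a + b \<in> ?J0" if "a \<in> ?J0" "b \<in> ?J0" for a b
    using that I(3)[of "el a 0" "el b 0"] by (simp add: el_add)
  have J0_mult: "r * a \<in> ?J0" if "a \<in> ?J0" for a r
    using that mulI[of a 0 r] by simp
  obtain p where p: "lead_coeff p = 1" "\<And>a. a \<in> ?J0 \<longleftrightarrow> p dvd a"
    using poly_ideal_principal[OF J0_add J0_mult J0] by blast
  have "el 0 1 * emb (nm x) \<in> I" using nx I(4) by simp
  then have "el 0 (nm x) \<in> I" by (simp add: el_def mult.commute)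
  with nx0 have J1: "\<exists>a\<in>?J1. a \<noteq> 0" by blast
  have J1_add: "a + b \<in> ?J1" if "a \<in> ?J1" "b \<in> ?J1" for a b
  proof -
    obtain u v where "el u a \<in> I" "el v b \<in> I" using \<open>a \<in> ?J1\<close> \<open>b \<in> ?J1\<close> by blast
    then have "el (u + v) (a + b) \<in> I" using I(3)[of "el u a" "el v b"] by (simp add: el_add)
    then show ?thesis by blast
  qed
  have J1_mult: "r * a \<in> ?J1" if "a \<in> ?J1" for a r
    using that mulI by blast
  obtain c where c: "lead_coeff c = 1" "\<And>a. a \<in> ?J1 \<longleftrightarrow> c dvd a"
    using poly_ideal_principal[OF J1_add J1_mult J1] by blast
  have pc: "p \<in> ?J0" "c \<in> ?J1" using p c by simp_all
  then obtain \<beta>0 where \<beta>0: "el \<beta>0 c \<in> I" by blast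
  have ymul: "el (D * v) u \<in> I" if "el u v \<in> I" for u v
    using I(4)[OF that, of "el 0 1"] by (simp add: el_mult)
  have cdiv: "c dvd u" if "el u v \<in> I" for u v
    using ymul[OF that] c(2) by blast
  obtain Q where Q: "p = c * Q" using cdiv[of p 0] pc by (auto elim: dvdE)
  have c0: "c \<noteq> 0" using c by auto
  have lQ: "lead_coeff Q = 1" using p(1) c(1) Q by (simp add: lead_coeff_mult)
  obtain b0 where b0: "\<beta>0 = c * b0" using cdiv[OF \<beta>0] by (auto elim: dvdE)
  define b where "b = b0 mod Q"
  have b0b: "b0 = Q * (b0 div Q) + b" by (simp add: b_def)
  have w: "el (c * b) c \<in> I"
  proof -
    have "el (p * (b0 div Q)) 0 \<in> I" using p(2)[of "p * (b0 div Q)"] by simp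
    then have "el \<beta>0 c - el (p * (b0 div Q)) 0 \<in> I" using \<beta>0 ideal_diff[OF assms] by blast
    moreover have "\<beta>0 - p * (b0 div Q) = c * b"
      unfolding b0 Q using arg_cong[OF b0b, of "\<lambda>z. c * z"] by (simp add: algebra_simps)
    ultimately show ?thesis by (simp add: el_diff)
  qed
  \<comment> \<open>Subtracting \<open>y\<close> times \<open>c (b + y)\<close> from
    \<open>b\<close> times it leaves the polynomial \<open>c (b * b - D)\<close> of
    \<open>I\<close>, which \<open>p = c Q\<close> must divide.\<close>
  have "el (D * c) (c * b) \<in> I" using ymul[OF w] .
  then have "el (b * (c * b)) (b * c) - el (D * c) (c * b) \<in> I" using mulI[OF w, of b] ideal_diff[OF assms] by blast
  then have "el (c * (b * b - D)) 0 \<in> I" by (simp add: el_diff algebra_simps)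
  then have "p dvd c * (b * b - D)" using p(2) by blast
  then have Qd: "Q dvd b * b - D" using c0 Q by simp
  have "I = hnf c Q b"
  proof (intro equalityI subsetI)
    fix x assume x: "x \<in> I"
    then obtain u v where uv: "x = el u v" using I(1) RD_cases by blast
    have "c dvd v" using x uv c(2)[of v] by blast
    then obtain v' where v': "v = c * v'" ..
    have "el u v - el (v' * (c * b)) (v' * c) \<in> I" using x uv mulI[OF w, of v'] ideal_diff[OF assms] by blast
    then have "el (u - v' * (c * b)) 0 \<in> I" by (simp add: el_diff v' mult.commute)
    then have "c * Q dvd u - v' * (c * b)" using p(2) Q by blast
    then obtain u' where "u - v' * (c * b) = c * Q * u'" ..
    then have "u = c * (Q * u' + v' * b)" by (simp add: algebra_simps)
    then show "x \<in> hnf c Q b" using uv v' el_in_hnf by simp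
  next
    fix x assume "x \<in> hnf c Q b"
    then obtain u v where x: "x = el (c * (Q * u + v * b)) (c * v)" by (auto simp: hnf_def)
    have "el (p * u) 0 \<in> I" using p(2)[of "p * u"] by simp
    then have "el (p * u) 0 + el (v * (c * b)) (v * c) \<in> I" using mulI[OF w, of v] I(3) by blast
    then show "x \<in> I" by (simp add: x el_add Q algebra_simps)
  qed
  moreover have "b mod Q = b" by (simp add: b_def)
  ultimately show ?thesis using c(1) lQ Qd by blast
qed

text \<open>All three data can be read off the lattice: \<open>c\<close> generates the second
  coordinates, \<open>c Q\<close> the polynomials contained in it, and \<open>b\<close> is
  determined modulo \<open>Q\<close>.\<close>

lemma hnf_inject:
  assumes "lead_coeff c = 1" "lead_coeff Q = 1" "b mod Q = b"
    "lead_coeff c' = 1" "lead_coeff Q' = 1" "b' mod Q' = b'" and eq: "hnf c Q b = hnf c' Q' b'"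
  shows "c = c' \<and> Q = Q' \<and> b = b'"
proof -
  have c0: "c \<noteq> 0" "c' \<noteq> 0" using assms by auto
  have 1: "el (c * b) c \<in> hnf c' Q' b'" using el_in_hnf[of c Q 0 1 b] eq by simp
  have 2: "el (c' * b') c' \<in> hnf c Q b" using el_in_hnf[of c' Q' 0 1 b'] eq by simp
  have "c' dvd c" "c dvd c'" using 1 2 unfolding el_in_hnf_iff by (blast intro: dvdI)+
  then have c: "c = c'" using assms by (intro monic_dvd_antisym) auto
  have "el (c * Q) 0 \<in> hnf c' Q' b'" using el_in_hnf[of c Q 1 0 b] eq by simp
  then have "Q' dvd Q" using c c0 by (auto simp: hnf_def)
  moreover have "el (c' * Q') 0 \<in> hnf c Q b" using el_in_hnf[of c' Q' 1 0 b'] eq by simp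
  then have "Q dvd Q'" using c c0 by (auto simp: hnf_def)
  ultimately have Q: "Q = Q'" using assms by (intro monic_dvd_antisym) auto
  obtain u where "b = Q * u + b'" using 1 c c0 Q by (auto simp: hnf_def)
  then have "b mod Q = b' mod Q" by simp
  then show ?thesis using assms c Q by simp
qed

text \<open>Degree of the norm \<open>c * c * Q\<close>; by \<open>ideal_reps\<close> the index of
  \<open>I\<close> in \<open>RD\<close> is \<open>q\<close> to this power.\<close>

definition ideg :: "'o set \<Rightarrow> nat" where
  "ideg I = (THE m. \<exists>(c, Q, b)\<in>triples m D. I = hnf c Q b)"

lemma triples_hnf_inject:
  assumes "(c, Q, b) \<in> triples m D" "(c', Q', b') \<in> triples m' D" "hnf c Q b = hnf c' Q' b'"
  shows "c = c' \<and> Q = Q' \<and> b = b'"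
  using assms(1,2) hnf_inject[OF _ _ _ _ _ _ assms(3)] by (simp add: triples_def)

lemma ideg_hnf: assumes "(c, Q, b) \<in> triples m D" shows "ideg (hnf c Q b) = m"
  unfolding ideg_def
proof (rule the_equality)
  show "\<exists>(c', Q', b')\<in>triples m D. hnf c Q b = hnf c' Q' b'" using assms by blast
next
  fix m' assume "\<exists>(c', Q', b')\<in>triples m' D. hnf c Q b = hnf c' Q' b'"
  then obtain c' Q' b' where *: "(c', Q', b') \<in> triples m' D" "hnf c Q b = hnf c' Q' b'" by blast
  from triples_hnf_inject[OF assms *] * assms show "m' = m" by (simp add: triples_def)
qed

lemma ideal_hnf_triples: "(c, Q, b) \<in> triples m D \<Longrightarrow> ideal (hnf c Q b)"
  by (intro ideal_hnf) (auto simp: triples_def)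

lemma ideal_triplesE:
  assumes "ideal I" obtains c Q b where "(c, Q, b) \<in> triples (ideg I) D" "I = hnf c Q b"
proof -
  obtain c Q b where *: "lead_coeff c = 1" "lead_coeff Q = 1" "b mod Q = b" "Q dvd b * b - D" "I = hnf c Q b"
    using hnf_exists[OF assms] by blast
  then have "(c, Q, b) \<in> triples (2 * degree c + degree Q) D" by (simp add: triples_def)
  moreover from ideg_hnf[OF this] have "ideg I = 2 * degree c + degree Q" using * by simp
  ultimately show thesis using that * by simp
qed

definition ideals :: "nat \<Rightarrow> 'o set set" where
  "ideals m = {I. ideal I \<and> ideg I = m}"

lemma ideals_eq: "ideals m = (\<lambda>(c, Q, b). hnf c Q b) ` triples m D"
proof (intro equalityI subsetI)
  fix I assume "I \<in> ideals m"
  then have I: "ideal I" "ideg I = m" by (auto simp: ideals_def)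
  obtain c Q b where "(c, Q, b) \<in> triples (ideg I) D" "I = hnf c Q b" using ideal_triplesE[OF I(1)] .
  then show "I \<in> (\<lambda>(c, Q, b). hnf c Q b) ` triples m D" using I(2) by force
qed (auto simp: ideals_def ideg_hnf ideal_hnf_triples)

lemma finite_ideals [simp]: "finite (ideals m)"
  by (simp add: ideals_eq)

lemma card_ideals: "card (ideals m) = card (triples m D)"
  unfolding ideals_eq
proof (rule card_image, rule inj_onI)
  fix s t assume *: "s \<in> triples m D" "t \<in> triples m D"
    "(case s of (c, Q, b) \<Rightarrow> hnf c Q b) = (case t of (c, Q, b) \<Rightarrow> hnf c Q b)"
  obtain c Q b c' Q' b' where st: "s = (c, Q, b)" "t = (c', Q', b')" by (metis prod.exhaust)
  show "s = t" using triples_hnf_inject[of c Q b m c' Q' b' m] * unfolding st by simp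
qed

end

context hyperelliptic begin

section \<open>The monoid of ideals\<close>

definition prin :: "'o \<Rightarrow> 'o set" where "prin w = (\<lambda>x. w * x) ` RD"

lemma ideal_scale:
  assumes "ideal I" "w \<noteq> 0" "(\<lambda>x. w * x) ` I \<subseteq> RD"
  shows "ideal ((\<lambda>x. w * x) ` I)"
  unfolding ideal_def
proof (intro conjI ballI)
  show "\<exists>x\<in>(*) w ` I. x \<noteq> 0" using ideal_nonzero[OF assms(1)] assms(2) by auto
next
  fix x z assume "x \<in> (*) w ` I" "z \<in> (*) w ` I"
  then obtain a b where "x = w * a" "z = w * b" "a \<in> I" "b \<in> I" by blast
  then have "x + z = w * (a + b)" "a + b \<in> I" using ideal_add[OF assms(1)] by (auto simp: distrib_left)
  then show "x + z \<in> (*) w ` I" by blast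
next
  fix x r assume "x \<in> (*) w ` I" "r \<in> RD"
  then obtain a where a: "x = w * a" "a \<in> I" by blast
  then have "r * x = w * (r * a)" by (simp add: mult_ac)
  then show "r * x \<in> (*) w ` I" using ideal_mult[OF assms(1) a(2) \<open>r \<in> RD\<close>] by blast
qed (use assms in auto)

lemma ideal_prin: "w \<in> RD \<Longrightarrow> w \<noteq> 0 \<Longrightarrow> ideal (prin w)"
  unfolding prin_def by (intro ideal_scale ideal_RD) (auto simp: RD_mult)

lemma imul_prin: assumes "ideal I" shows "imul (prin w) I = (\<lambda>x. w * x) ` I"
proof
  show "imul (prin w) I \<subseteq> (*) w ` I"
  proof (rule imul_leI)
    show "0 \<in> (*) w ` I" using ideal_0[OF assms] by force
  next
    fix x z assume "x \<in> (*) w ` I" "z \<in> (*) w ` I"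
    then obtain a b where "x = w * a" "z = w * b" "a \<in> I" "b \<in> I" by blast
    then have "x + z = w * (a + b)" "a + b \<in> I" using ideal_add[OF assms] by (auto simp: distrib_left)
    then show "x + z \<in> (*) w ` I" by blast
  next
    fix x z assume "x \<in> prin w" "z \<in> I"
    then obtain r where r: "x = w * r" "r \<in> RD" by (auto simp: prin_def)
    then have "x * z = w * (r * z)" by (simp add: mult_ac)
    then show "x * z \<in> (*) w ` I" using ideal_mult[OF assms \<open>z \<in> I\<close> r(2)] by blast
  qed
  show "(*) w ` I \<subseteq> imul (prin w) I"
  proof
    fix x assume "x \<in> (*) w ` I"
    then obtain a where "x = w * a" "a \<in> I" by blast
    moreover have "w \<in> prin w" using RD_1 by (force simp: prin_def)
    ultimately show "x \<in> imul (prin w) I" by (auto intro: imulI)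
  qed
qed

lemma prin_1: "prin 1 = RD"
  by (simp add: prin_def)

lemma imul_RD: "ideal I \<Longrightarrow> imul RD I = I"
  using imul_prin[of I 1] by (simp add: prin_1)

lemma imul_RD': "ideal I \<Longrightarrow> imul I RD = I"
  using imul_RD imul_commute by metis

lemma imul_subset: assumes "ideal I" "ideal J" shows "imul I J \<subseteq> J"
  using imul_mono[OF ideal_subset[OF assms(1)] order_refl, of J] imul_RD[OF assms(2)] by simp

lemma ideal_imul: assumes "ideal I" "ideal J" shows "ideal (imul I J)"
  unfolding ideal_def
proof (intro conjI ballI)
  show "imul I J \<subseteq> RD" using imul_subset[OF assms] ideal_subset[OF assms(2)] by blast
  obtain x z where "x \<in> I" "z \<in> J" "x \<noteq> 0" "z \<noteq> 0" using assms by (meson ideal_nonzero)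
  then show "\<exists>x\<in>imul I J. x \<noteq> 0" by (intro bexI[of _ "x * z"] imulI) auto
next
  fix x r assume "x \<in> imul I J" "r \<in> RD"
  then show "r * x \<in> imul I J"
  proof (induction rule: imul_induct)
    case (mult x z) then show ?case
      using imulI[of "r * x" I z J] ideal_mult[OF assms(1)] by (simp add: mult.assoc)
  qed (auto simp: imul_0 distrib_left imul_plus)
qed (rule imul_plus)

lemma imul_prin_prin: "w \<in> RD \<Longrightarrow> z \<in> RD \<Longrightarrow> z \<noteq> 0 \<Longrightarrow> imul (prin w) (prin z) = prin (w * z)"
  using imul_prin[OF ideal_prin] by (simp add: prin_def image_image mult.assoc)

lemma ideal_cj: assumes "ideal I" shows "ideal (cj ` I)"
  unfolding ideal_def
proof (intro conjI ballI)
  have sub: "x \<in> I \<Longrightarrow> x \<in> RD" for x using ideal_subset[OF assms] by blast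
  obtain x where x: "x \<in> I" "x \<noteq> 0" using ideal_nonzero[OF assms] by blast
  then have "cj x \<noteq> 0" using cj_cj[OF sub[OF x(1)]] by auto
  then show "\<exists>x\<in>cj ` I. x \<noteq> 0" using x by blast
  fix x assume "x \<in> cj ` I"
  then obtain a where a: "x = cj a" "a \<in> I" by blast
  show "r * x \<in> cj ` I" if "r \<in> RD" for r
  proof -
    have "r * x = cj (cj r * a)" using a sub that by (simp add: cj_mult cj_cj)
    then show ?thesis using ideal_mult[OF assms a(2), of "cj r"] by simp
  qed
  show "x + z \<in> cj ` I" if "z \<in> cj ` I" for z
  proof -
    from that obtain b where b: "z = cj b" "b \<in> I" by (rule imageE)
    have "x + z = cj (a + b)" using a b sub by (simp add: cj_add)
    then show ?thesis using ideal_add[OF assms a(2) b(2)] by simp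
  qed
qed auto

lemma cj_imul_subset: assumes "I \<subseteq> RD" "J \<subseteq> RD" shows "cj ` imul I J \<subseteq> imul (cj ` I) (cj ` J)"
proof
  fix w assume "w \<in> cj ` imul I J"
  then obtain x where x: "w = cj x" "x \<in> imul I J" by blast
  from x(2) have "x \<in> RD \<and> cj x \<in> imul (cj ` I) (cj ` J)"
  proof (induction rule: imul_induct)
    case (mult x z)
    then have "x \<in> RD" "z \<in> RD" using assms by auto
    then show ?case using mult by (auto simp: cj_mult RD_mult intro!: imulI)
  qed (auto simp: imul_0 cj_add imul_plus RD_add)
  then show "w \<in> imul (cj ` I) (cj ` J)" using x by simp
qed

lemma cj_cj_image: "I \<subseteq> RD \<Longrightarrow> cj ` cj ` I = I"
  by (force simp: image_image image_iff cj_cj)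

lemma cj_imul: assumes "ideal I" "ideal J" shows "cj ` imul I J = imul (cj ` I) (cj ` J)"
proof
  have s: "I \<subseteq> RD" "J \<subseteq> RD" using assms ideal_subset by auto
  show "cj ` imul I J \<subseteq> imul (cj ` I) (cj ` J)" by (rule cj_imul_subset[OF s])
  have "cj ` imul (cj ` I) (cj ` J) \<subseteq> imul (cj ` cj ` I) (cj ` cj ` J)"
    by (rule cj_imul_subset) auto
  then have "cj ` imul (cj ` I) (cj ` J) \<subseteq> imul I J" by (simp add: cj_cj_image[OF s(1)] cj_cj_image[OF s(2)])
  then have "cj ` cj ` imul (cj ` I) (cj ` J) \<subseteq> cj ` imul I J" by (rule image_mono)
  then show "imul (cj ` I) (cj ` J) \<subseteq> cj ` imul I J"
    using cj_cj_image[OF ideal_subset[OF ideal_imul[OF ideal_cj[OF assms(1)] ideal_cj[OF assms(2)]]]] by simp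
qed

text \<open>
  A common prime factor of \<open>Q\<close>, \<open>2b\<close> and \<open>(b\<^sup>2 - D) / Q\<close> would divide \<open>D\<close> twice.
\<close>

lemma triple_bezout:
  assumes "b * b - D = Q * Q'"
  obtains \<alpha> \<beta> \<gamma> where "\<alpha> * Q + \<beta> * (2 * b) + \<gamma> * Q' = 1"
proof -
  have unit: "is_unit (gcd (gcd Q (2 * b)) Q')"
  proof (rule ccontr)
    assume nu: "\<not> is_unit (gcd (gcd Q (2 * b)) Q')"
    have "gcd (gcd Q (2 * b)) Q' \<noteq> 0"
    proof
      assume "gcd (gcd Q (2 * b)) Q' = 0"
      then have Q: "Q = 0" "b * 2 = 0" by (simp_all add: mult.commute)
      have "(2 :: 'f poly) = [:2:]" by (simp add: numeral_poly)
      then have "(2 :: 'f poly) \<noteq> 0" using two_nonzero by (metis pCons_eq_0_iff)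
      then have "b = 0" using Q(2) by simp
      then show False using assms Q D_nonzero by simp
    qed
    then obtain P where P: "prime P" "P dvd gcd (gcd Q (2 * b)) Q'"
      using prime_divisor_exists nu by blast
    then have d: "P dvd Q" "P dvd 2 * b" "P dvd Q'" by auto
    have "is_unit (2 :: 'f poly)"
      using two_nonzero by (simp add: is_unit_poly_iff numeral_poly dvd_field_iff)
    then have "\<not> P dvd 2" using P(1) by (meson dvd_trans not_prime_unit)
    then have "P dvd b" using d(2) P(1) by (simp add: prime_dvd_mult_iff)
    then have "P * P dvd b * b" "P * P dvd Q * Q'" using d by (auto intro: mult_dvd_mono)
    then have "P * P dvd b * b - Q * Q'" by (rule dvd_diff)
    then have "P ^ 2 dvd D" using assms by (simp add: power2_eq_square algebra_simps)
    then have "is_unit P" using D_squarefree by (simp add: squarefree_def)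
    then show False using P(1) by (simp add: not_prime_unit)
  qed
  obtain u v where uv: "u * gcd Q (2 * b) + v * Q' = gcd (gcd Q (2 * b)) Q'"
    using bezout_coefficients_fst_snd by metis
  obtain s t where st: "s * Q + t * (2 * b) = gcd Q (2 * b)"
    using bezout_coefficients_fst_snd by metis
  have "gcd (gcd Q (2 * b)) Q' = 1" using unit by (simp add: is_unit_gcd_iff)
  then have "(u * s) * Q + (u * t) * (2 * b) + v * Q' = 1"
    using uv unfolding st[symmetric] by (simp add: algebra_simps)
  then show thesis using that by blast
qed

text \<open>Put \<open>Q' = (b * b - D) / Q\<close>. Products of generators and their conjugates
  give \<open>c * c * Q\<close> times each of \<open>Q\<close>, \<open>2 * b\<close> and
  \<open>Q'\<close>. These three are coprime because \<open>D\<close> is squarefree, so the norm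
  itself lies in the product.\<close>

lemma imul_cj_hnf:
  assumes "(c, Q, b) \<in> triples m D"
  shows "imul (hnf c Q b) (cj ` hnf c Q b) = prin (emb (c * c * Q))"
proof
  let ?I = "hnf c Q b" and ?n = "emb (c * c * Q)"
  have I: "ideal ?I" using assms by (rule ideal_hnf_triples)
  obtain Q' where Q': "b * b - D = Q * Q'" using assms by (auto simp: triples_def)
  then have D: "D = b * b - Q * Q'" by (simp add: algebra_simps)
  have nz: "?n \<noteq> 0" using assms by (auto simp: triples_def)
  have ip: "ideal (prin ?n)" using nz by (intro ideal_prin) auto
  show "imul ?I (cj ` ?I) \<subseteq> prin ?n"
  proof (rule imul_leI)
    fix x z assume "x \<in> ?I" "z \<in> cj ` ?I"
    then obtain z' where z': "z = cj z'" "z' \<in> ?I" by blast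
    obtain u v where x: "x = el (c * (Q * u + v * b)) (c * v)" using \<open>x \<in> ?I\<close> unfolding hnf_def by blast
    obtain u' v' where "z' = el (c * (Q * u' + v' * b)) (c * v')" using z'(2) unfolding hnf_def by blast
    then have z: "z = el (c * (Q * u' + v' * b)) (- (c * v'))" using z'(1) by simp
    have "x * z = ?n * el (Q * u * u' + u * v' * b + v * b * u' + v * v' * Q') (v * u' - u * v')"
      unfolding x z el_mult emb_mult_el by (simp add: D algebra_simps)
    then show "x * z \<in> prin ?n" by (auto simp: prin_def)
  qed (use ideal_0[OF ip] ideal_add[OF ip] in auto)
  let ?J = "imul ?I (cj ` ?I)"
  have J: "ideal ?J" by (intro ideal_imul ideal_cj I)
  obtain \<alpha> \<beta> \<gamma> where abc: "\<alpha> * Q + \<beta> * (2 * b) + \<gamma> * Q' = 1" using triple_bezout[OF Q'] .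
  have e1: "el (c * Q) 0 \<in> ?I" using el_in_hnf[of c Q 1 0 b] by simp
  have e2: "el (c * b) c \<in> ?I" using el_in_hnf[of c Q 0 1 b] by simp
  have f1: "el (c * Q) 0 \<in> cj ` ?I" using imageI[OF e1, of cj] by simp
  have f2: "el (c * b) (- c) \<in> cj ` ?I" using imageI[OF e2, of cj] by simp
  have "el (c * Q) 0 * el (c * Q) 0 \<in> ?J" by (intro imulI e1 f1)
  then have g1: "?n * emb Q \<in> ?J" by (simp add: el_emb emb_mult mult_ac)
  have "el (c * b) c * el (c * Q) 0 + el (c * Q) 0 * el (c * b) (- c) \<in> ?J" by (intro imul_plus imulI e1 e2 f1 f2)
  also have "el (c * b) c * el (c * Q) 0 + el (c * Q) 0 * el (c * b) (- c) = ?n * emb (2 * b)"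
    unfolding el_mult el_add by (simp add: el_emb flip: emb_mult)
  finally have g2: "?n * emb (2 * b) \<in> ?J" .
  have "el (c * b) c * el (c * b) (- c) \<in> ?J" by (intro imulI e2 f2)
  also have "el (c * b) c * el (c * b) (- c) = ?n * emb Q'"
  proof -
    have "c * b * (c * b) + D * c * - c = c * c * Q * Q'" "c * b * - c + c * (c * b) = 0"
      by (simp_all add: D algebra_simps)
    then show ?thesis unfolding el_mult by (simp only: el_emb emb_mult)
  qed
  finally have g3: "?n * emb Q' \<in> ?J" .
  have "emb \<alpha> * (?n * emb Q) + emb \<beta> * (?n * emb (2 * b)) + emb \<gamma> * (?n * emb Q') \<in> ?J"
    by (intro ideal_add[OF J] ideal_mult[OF J] g1 g2 g3) auto
  also have "emb \<alpha> * (?n * emb Q) + emb \<beta> * (?n * emb (2 * b)) + emb \<gamma> * (?n * emb Q') =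
     ?n * emb (\<alpha> * Q + \<beta> * (2 * b) + \<gamma> * Q')" by (simp add: emb_add emb_mult algebra_simps)
  finally have "?n \<in> ?J" by (simp add: abc)
  from ideal_mult[OF J this] show "prin ?n \<subseteq> ?J"
    unfolding prin_def by (metis (no_types, lifting) image_subsetI mult.commute)
qed

text \<open>The conjugate ideal is an inverse of \<open>I\<close> up to a scalar. Multiplicativity
  of the degree, cancellation and division of ideals all rest on this.\<close>

lemma ideal_norm_exists:
  assumes "ideal I"
  shows "\<exists>n. n \<noteq> 0 \<and> imul I (cj ` I) = prin (emb n) \<and> degree n = ideg I"
proof -
  obtain c Q b where t: "(c, Q, b) \<in> triples (ideg I) D" "I = hnf c Q b" using ideal_triplesE[OF assms] .
  then have nz: "c \<noteq> 0" "Q \<noteq> 0" by (auto simp: triples_def)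
  show ?thesis
  proof (intro exI conjI)
    show "c * c * Q \<noteq> 0" using nz by simp
    show "imul I (cj ` I) = prin (emb (c * c * Q))" using imul_cj_hnf[OF t(1)] t(2) by simp
    show "degree (c * c * Q) = ideg I" using t(1) nz by (simp add: triples_def degree_mult_eq)
  qed
qed

lemma prin_emb_inject: assumes "prin (emb n) = prin (emb n')" "n \<noteq> 0" "n' \<noteq> 0" shows "degree n = degree n'"
proof -
  have *: "degree b \<le> degree a" if "prin (emb a) = prin (emb b)" "a \<noteq> 0" for a b
  proof -
    have "emb a \<in> prin (emb a)" using RD_1 by (force simp: prin_def)
    then have "emb a \<in> prin (emb b)" using that by simp
    then obtain u v where "emb a = emb b * el u v" by (auto simp: prin_def elim!: RD_cases)
    then have "el a 0 = el (b * u) (b * v)" by (simp add: emb_mult_el el_emb)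
    then have "a = b * u" by simp
    then show ?thesis using that(2) by (metis dvd_imp_degree_le dvd_triv_left)
  qed
  show ?thesis using *[of n n'] *[of n' n] assms by simp
qed

lemma ideg_eqI: "ideal I \<Longrightarrow> n \<noteq> 0 \<Longrightarrow> imul I (cj ` I) = prin (emb n) \<Longrightarrow> ideg I = degree n"
  by (metis ideal_norm_exists prin_emb_inject)

text \<open>\<open>I J\<close> times its conjugate regroups into the product of the two principal
  norm ideals.\<close>

lemma ideg_imul: assumes "ideal I" "ideal J" shows "ideg (imul I J) = ideg I + ideg J"
proof -
  obtain n where n: "n \<noteq> 0" "imul I (cj ` I) = prin (emb n)" "degree n = ideg I" using ideal_norm_exists[OF assms(1)] by blast
  obtain k where k: "k \<noteq> 0" "imul J (cj ` J) = prin (emb k)" "degree k = ideg J" using ideal_norm_exists[OF assms(2)] by blast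
  have "imul (imul I J) (cj ` imul I J) = imul (imul I (cj ` I)) (imul J (cj ` J))"
    unfolding cj_imul[OF assms] by (simp only: imul_assoc imul_left_commute[of J])
  also have "\<dots> = prin (emb (n * k))" using n k by (simp add: imul_prin_prin emb_mult)
  finally have "ideg (imul I J) = degree (n * k)" using n k ideal_imul[OF assms] by (intro ideg_eqI) auto
  then show ?thesis using n k by (simp add: degree_mult_eq)
qed

lemma imul_rotate: "imul (imul I J) K = imul J (imul I K)"
  by (simp only: imul_assoc imul_left_commute[of I])

text \<open>Multiplication by the conjugate of \<open>I\<close> replaces \<open>I\<close> by a
  scalar, which cancels elementwise.\<close>

lemma imul_cancel: assumes "ideal I" "ideal J" "ideal K" "imul I J = imul I K" shows "J = K"
proof -
  obtain n where n: "n \<noteq> 0" "imul I (cj ` I) = prin (emb n)" using ideal_norm_exists[OF assms(1)] by blast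
  have "imul (cj ` I) (imul I J) = imul (cj ` I) (imul I K)" using assms by simp
  then have "imul (prin (emb n)) J = imul (prin (emb n)) K"
    unfolding n(2)[symmetric] imul_rotate .
  then have "(*) (emb n) ` J = (*) (emb n) ` K" using assms by (simp add: imul_prin)
  moreover have "inj ((*) (emb n))" using n(1) by (auto simp: inj_on_def)
  ultimately show ?thesis by (simp add: inj_image_eq_iff)
qed

text \<open>To contain is to divide: the quotient is \<open>I\<close> times the conjugate of
  \<open>J\<close>, divided by the norm \<open>n\<close> of \<open>J\<close>. It is integral since
  \<open>I \<subseteq> J\<close> places that product inside the principal ideal of
  \<open>n\<close>.\<close>

lemma ideal_divides:
  assumes "ideal I" "ideal J" "I \<subseteq> J"
  obtains K where "ideal K" "imul J K = I"
proof -
  obtain n where n: "n \<noteq> 0" "imul J (cj ` J) = prin (emb n)" using ideal_norm_exists[OF assms(2)] by blast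
  let ?M = "imul I (cj ` J)" and ?K = "(*) (inverse (emb n)) ` imul I (cj ` J)"
  have M: "ideal ?M" by (rule ideal_imul[OF assms(1) ideal_cj[OF assms(2)]])
  have inv: "emb n * (inverse (emb n) * x) = x" "inverse (emb n) * (emb n * x) = x" for x
  proof -
    have "emb n \<noteq> 0" using n(1) by simp
    then have "emb n * inverse (emb n) = 1" "inverse (emb n) * emb n = 1" by (rule right_inverse, rule left_inverse)
    then show "emb n * (inverse (emb n) * x) = x" "inverse (emb n) * (emb n * x) = x"
      by (simp_all only: mult.assoc[symmetric] mult_1)
  qed
  have "?M \<subseteq> prin (emb n)" using imul_mono[OF assms(3) order_refl, of "cj ` J"] n by simp
  then have "?K \<subseteq> (*) (inverse (emb n)) ` prin (emb n)" by (rule image_mono)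
  then have "?K \<subseteq> RD" by (simp add: prin_def image_image inv)
  then have K: "ideal ?K" using n(1) by (intro ideal_scale M) auto
  have MK: "?M = imul (prin (emb n)) ?K" by (simp add: imul_prin[OF K] image_image inv)
  have "imul (prin (emb n)) (imul J ?K) = imul J (imul (prin (emb n)) ?K)" by (rule imul_left_commute)
  also have "\<dots> = imul J ?M" by (rule arg_cong[OF MK[symmetric]])
  also have "\<dots> = imul (prin (emb n)) I"
  proof -
    have "imul (prin (emb n)) I = imul J (imul (cj ` J) I)" unfolding n(2)[symmetric] by (rule imul_assoc)
    also have "imul (cj ` J) I = ?M" by (rule imul_commute)
    finally show ?thesis by (rule sym)
  qed
  finally have "imul J ?K = I"
    using n(1) by (rule_tac imul_cancel[OF ideal_prin[of "emb n"] ideal_imul[OF assms(2) K] assms(1)]) simp_all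
  then show thesis using that K by blast
qed

lemma cj_prin: "w \<in> RD \<Longrightarrow> cj ` prin w = prin (cj w)"
proof -
  assume w: "w \<in> RD"
  have "cj ` RD = RD"
  proof
    show "RD \<subseteq> cj ` RD" using cj_cj by (metis cj_in_RD image_eqI subsetI)
  qed auto
  moreover have "cj ` prin w = (*) (cj w) ` cj ` RD"
    unfolding prin_def image_image by (intro image_cong refl) (simp add: cj_mult w)
  ultimately show ?thesis by (simp add: prin_def)
qed

lemma ideg_prin: assumes "w \<in> RD" "w \<noteq> 0" shows "ideg (prin w) = dg w"
proof -
  have "cj w \<noteq> 0" using assms cj_cj[of w] by auto
  then have "imul (prin w) (cj ` prin w) = prin (emb (nm w))"
    using assms by (simp add: cj_prin imul_prin_prin mult_cj)
  then show ?thesis using assms by (simp add: ideg_eqI ideal_prin nm_eq_0_iff dg_def)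
qed

lemma prin_subset_iff: "ideal I \<Longrightarrow> prin w \<subseteq> I \<longleftrightarrow> w \<in> I"
  using RD_1 ideal_mult[of I w] by (force simp: prin_def mult.commute)

lemma ideg_le_dg: assumes "ideal I" "z \<in> I" "z \<noteq> 0" shows "ideg I \<le> dg z"
proof -
  have z: "z \<in> RD" using assms ideal_subset by blast
  obtain K where "ideal K" "imul I K = prin z"
    using ideal_divides[OF ideal_prin[OF z assms(3)] assms(1)] assms by (auto simp: prin_subset_iff)
  then show ?thesis using ideg_imul[OF assms(1)] ideg_prin[OF z assms(3)] by (metis le_add1)
qed

lemma ideg_0_iff: assumes "ideal I" shows "ideg I = 0 \<longleftrightarrow> I = RD"
proof
  assume 0: "ideg I = 0"
  obtain c Q b where t: "(c, Q, b) \<in> triples (ideg I) D" "I = hnf c Q b" using ideal_triplesE[OF assms] .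
  then have "degree c = 0" "degree Q = 0" "lead_coeff c = 1" "lead_coeff Q = 1" using 0 by (auto simp: triples_def)
  then have "c = 1" "Q = 1" by (metis degree_0_id one_pCons)+
  then have "1 \<in> I" using el_in_hnf[of c Q 1 0 b] t(2) by (simp add: el_emb)
  then show "I = RD" using ideal_eq_RD_iff[OF assms] by simp
next
  assume "I = RD"
  then have "ideg I = dg 1" using ideg_prin[of 1] prin_1 by simp
  then show "ideg I = 0" using dg_emb[of 1] by simp
qed

end

context hyperelliptic begin

section \<open>Counting elements of ideals\<close>

lemma below_dvd_eq_0: "p \<in> below (degree c) \<Longrightarrow> c dvd p \<Longrightarrow> p = (0 :: 'f poly)"
  using dvd_imp_degree_le[of c p] unfolding below_def by (metis (mono_tags, lifting) linorder_not_less mem_Collect_eq)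

text \<open>A box of remainders represents \<open>RD\<close> modulo \<open>I\<close>: second
  coordinates reduced modulo \<open>c\<close>, then first coordinates modulo \<open>c * Q\<close>.
  Its size is \<open>q\<close> to the power \<open>2 * degree c + degree Q\<close>.\<close>

lemma ideal_reps:
  assumes "ideal I"
  shows "\<exists>R. R \<subseteq> RD \<and> finite R \<and> card R = CARD('f) ^ ideg I \<and> (\<forall>x\<in>RD. \<exists>r\<in>R. x - r \<in> I) \<and>
    (\<forall>r\<in>R. \<forall>r'\<in>R. r - r' \<in> I \<longrightarrow> r = r')"
proof -
  obtain c Q b where t: "(c, Q, b) \<in> triples (ideg I) D" "I = hnf c Q b" using ideal_triplesE[OF assms] .
  then have nz: "c \<noteq> 0" "c * Q \<noteq> 0" and d: "2 * degree c + degree Q = ideg I" by (auto simp: triples_def)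
  let ?f = "\<lambda>(a, e). el a e" and ?S = "below (degree (c * Q)) \<times> below (degree c)"
  have inj: "inj_on ?f ?S" by (intro inj_onI) auto
  have "card (?f ` ?S) = CARD('f) ^ degree (c * Q) * CARD('f) ^ degree c"
    unfolding card_image[OF inj] card_cartesian_product by (simp add: card_below)
  also have "degree (c * Q) + degree c = ideg I" using nz by (simp add: degree_mult_eq d[symmetric])
  then have "CARD('f) ^ degree (c * Q) * CARD('f) ^ degree c = CARD('f) ^ ideg I"
    by (simp flip: power_add)
  finally have card: "card (?f ` ?S) = CARD('f) ^ ideg I" .
  have ex: "\<exists>r\<in>?f ` ?S. x - r \<in> I" if "x \<in> RD" for x
  proof -
    from that obtain a e where x: "x = el a e" by (rule RD_cases)
    define w where "w = a - c * (e div c) * b"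
    have ae: "e = c * (e div c) + e mod c" "w = c * Q * (w div (c * Q)) + w mod (c * Q)" by simp_all
    have "x - el (w mod (c * Q)) (e mod c) = el (a - w mod (c * Q)) (e - e mod c)" by (simp add: x el_diff)
    moreover have "e - e mod c = c * (e div c)" using ae(1) by (metis add_diff_cancel_right')
    moreover have "a - w mod (c * Q) = c * (Q * (w div (c * Q)) + (e div c) * b)"
    proof -
      have "a = w + c * (e div c) * b" by (simp add: w_def)
      moreover have "w - w mod (c * Q) = c * Q * (w div (c * Q))" using ae(2) by (metis add_diff_cancel_right')
      ultimately show ?thesis by (simp add: algebra_simps)
    qed
    ultimately have "x - el (w mod (c * Q)) (e mod c) \<in> I" using el_in_hnf t(2) by simp
    moreover have "w mod (c * Q) \<in> below (degree (c * Q))" "e mod c \<in> below (degree c)"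
      using degree_mod_less[OF nz(2), of w] degree_mod_less[OF nz(1), of e] by (auto simp: below_def)
    ultimately show ?thesis by force
  qed
  have uniq: "r = r'" if "r \<in> ?f ` ?S" "r' \<in> ?f ` ?S" "r - r' \<in> I" for r r'
  proof -
    from that(1) obtain a e where r1: "r = el a e" "a \<in> below (degree (c * Q))" "e \<in> below (degree c)" by auto
    from that(2) obtain a' e' where r2: "r' = el a' e'" "a' \<in> below (degree (c * Q))" "e' \<in> below (degree c)" by auto
    note r = r1(1) r2(1) and m = r1(2) r2(2) r1(3) r2(3)
    have "el (a - a') (e - e') \<in> hnf c Q b" using that(3) r t(2) by (simp add: el_diff)
    then obtain u v where uv: "a - a' = c * (Q * u + v * b)" "e - e' = c * v" unfolding el_in_hnf_iff by blast
    then have "e - e' = 0" using below_dvd_eq_0[OF below_diff[OF m(3,4)]] by simp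
    moreover from this have "v = 0" using uv(2) nz by simp
    then have "c * Q dvd a - a'" using uv(1) by simp
    then have "a - a' = 0" using below_dvd_eq_0[OF below_diff[OF m(1,2)]] by blast
    ultimately show ?thesis using r by simp
  qed
  show ?thesis
  proof (intro exI[of _ "?f ` ?S"] conjI ballI impI)
    show "?f ` ?S \<subseteq> RD" by auto
    show "finite (?f ` ?S)" by simp
  qed (fact card ex uniq)+
qed

text \<open>Once \<open>LS s\<close> contains the finitely many representatives, it is the disjoint
  union of their translates of \<open>I \<inter> LS s\<close>.\<close>

lemma card_LS_Int_ideal:
  assumes "ideal I"
  shows "\<exists>s0. \<forall>s\<ge>s0. card (LS s) = CARD('f) ^ ideg I * card (I \<inter> LS s)"
proof -
  obtain R where R: "R \<subseteq> RD" "finite R" "card R = CARD('f) ^ ideg I" "\<And>x. x \<in> RD \<Longrightarrow> \<exists>r\<in>R. x - r \<in> I"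
    "\<And>r r'. r \<in> R \<Longrightarrow> r' \<in> R \<Longrightarrow> r - r' \<in> I \<Longrightarrow> r = r'"
    using ideal_reps[OF assms] by blast
  have RLS: "R \<subseteq> LS s" if s: "s \<ge> Suc (\<Sum>r\<in>R. dg r)" for s
  proof
    fix r assume r: "r \<in> R"
    then have "dg r \<le> (\<Sum>r\<in>R. dg r)" using R(2) by (intro member_le_sum) auto
    then show "r \<in> LS s" using r R(1) s by (auto simp: LS_def)
  qed
  have "card (LS s) = CARD('f) ^ ideg I * card (I \<inter> LS s)" if s: "s \<ge> Suc (\<Sum>r\<in>R. dg r)" for s
  proof -
    let ?f = "\<lambda>(r, z). r + z"
    have inj: "inj_on ?f (R \<times> (I \<inter> LS s))"
    proof (rule inj_onI)
      fix p p' assume p: "p \<in> R \<times> (I \<inter> LS s)" "p' \<in> R \<times> (I \<inter> LS s)" "?f p = ?f p'"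
      obtain r z r' z' where pp: "p = (r, z)" "p' = (r', z')" by fastforce
      then have "r - r' = z' - z" using p(3) by (simp add: algebra_simps)
      then have "r - r' \<in> I" using p pp ideal_diff[OF assms] by simp
      then have "r = r'" using R(5) p pp by blast
      then show "p = p'" using p(3) pp by simp
    qed
    have "?f ` (R \<times> (I \<inter> LS s)) = LS s"
    proof (intro equalityI subsetI)
      fix x assume "x \<in> ?f ` (R \<times> (I \<inter> LS s))"
      then show "x \<in> LS s" using RLS[OF s] LS_add by auto
    next
      fix x assume x: "x \<in> LS s"
      then obtain r where r: "r \<in> R" "x - r \<in> I" using R(4) by (auto simp: LS_def)
      moreover have "x - r \<in> LS s" using x r RLS[OF s] LS_diff by blast
      ultimately have "x = ?f (r, x - r)" "(r, x - r) \<in> R \<times> (I \<inter> LS s)" by auto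
      then show "x \<in> ?f ` (R \<times> (I \<inter> LS s))" by (rule image_eqI)
    qed
    then have "card (LS s) = card (R \<times> (I \<inter> LS s))" using card_image[OF inj] by simp
    then show ?thesis by (simp add: card_cartesian_product R(3))
  qed
  then show ?thesis by blast
qed

lemma below_Suc_iff: "p \<in> below (Suc n) \<Longrightarrow> p \<in> below n \<longleftrightarrow> Polynomial.coeff p n = (0::'f)"
  by (auto simp: below_def coeff_eq_0 less_Suc_eq)

text \<open>The leading coefficient at pole order \<open>s\<close>. Even orders arise from the first
  coordinate, odd orders from \<open>2 * g + 1\<close> on from the second; the odd orders below that
  are the gaps of the infinite place and get the value 0.\<close>

definition lco :: "nat \<Rightarrow> 'o \<Rightarrow> 'f" where
  "lco s x = (if even s then Polynomial.coeff (c0 x) (s div 2)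
     else if 2 * g + 1 \<le> s then Polynomial.coeff (c1 x) ((s - 2 * g - 1) div 2) else 0)"

lemma LS_Suc_iff:
  assumes "x \<in> LS (Suc s)" shows "x \<in> LS s \<longleftrightarrow> lco s x = 0"
proof -
  obtain a b where x: "x = el a b" using assms by (auto elim: LS_cases)
  then have m: "a \<in> below ((Suc s + 1) div 2)" "b \<in> below ((Suc s - 2 * g) div 2)"
    using assms el_in_LS_iff by blast+
  consider k where "s = 2 * k" "k < g" | k where "s = 2 * (g + k)"
    | k where "s = 2 * (g + k) + 1" | k where "s = 2 * k + 1" "k < g"
    by (metis evenE oddE le_Suc_ex not_less)
  then show ?thesis
  proof cases
    case (1 k)
    then show ?thesis using m below_Suc_iff[of a k] by (simp add: x el_in_LS_iff lco_def)
  next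
    case (2 k)
    then show ?thesis using m below_Suc_iff[of a "g + k"] by (simp add: x el_in_LS_iff lco_def Suc_diff_le)
  next
    case (3 k)
    then show ?thesis using m below_Suc_iff[of b k] by (simp add: x el_in_LS_iff lco_def)
  next
    case (4 k)
    then show ?thesis using m by (simp add: x el_in_LS_iff lco_def)
  qed
qed

lemma lco_linear:
  assumes "x \<in> RD" "z \<in> RD" shows "lco s (emb [:k:] * x + z) = k * lco s x + lco s z"
proof -
  obtain a b c d where "x = el a b" "z = el c d" using assms by (metis RD_cases)
  then show ?thesis by (simp add: lco_def emb_mult_el el_add)
qed

definition att :: "'o set \<Rightarrow> nat \<Rightarrow> bool" where
  "att I s \<longleftrightarrow> (\<exists>x\<in>I. x \<noteq> 0 \<and> dg x = s)"

text \<open>If order \<open>s\<close> is attained by \<open>x0\<close>, a constant multiple of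
  \<open>x0\<close> removes the coefficient at order \<open>s\<close> from any element, so the
  dimension grows by one; otherwise nothing is added.\<close>

lemma card_Int_LS_Suc:
  assumes "ideal I"
  shows "card (I \<inter> LS (Suc s)) = (if att I s then CARD('f) else 1) * card (I \<inter> LS s)"
proof (cases "att I s")
  case True
  then obtain x0 where x0: "x0 \<in> I" "x0 \<noteq> 0" "dg x0 = s" by (auto simp: att_def)
  have R: "x \<in> I \<Longrightarrow> x \<in> RD" for x using ideal_subset[OF assms] by blast
  have x0L: "x0 \<in> LS (Suc s)" "x0 \<notin> LS s" using x0 R by (auto simp: LS_def)
  have nz: "lco s x0 \<noteq> 0" using LS_Suc_iff x0L by blast
  have sub: "LS s \<subseteq> LS (Suc s)" by (rule LS_mono) simp
  have kL: "emb [:k:] * x0 \<in> LS (Suc s)" for k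
  proof (cases "k = 0")
    case False
    then have "dg (emb [:k:] * x0) = s" using x0 R[OF x0(1)] by (simp add: dg_mult dg_emb)
    then show ?thesis using R[OF x0(1)] by (simp add: LS_def RD_mult)
  qed (simp add: LS_def)
  have kI: "emb [:k:] * x0 \<in> I" for k using ideal_mult[OF assms x0(1)] by simp
  have lk: "lco s (emb [:k:] * x0 + z) = k * lco s x0" if "z \<in> I \<inter> LS s" for k z
    using that lco_linear[OF R[OF x0(1)] R] LS_Suc_iff[of z s] sub by auto
  let ?f = "\<lambda>(k, z). emb [:k:] * x0 + z"
  have inj: "inj_on ?f (UNIV \<times> (I \<inter> LS s))"
  proof (rule inj_onI)
    fix p p' assume p: "p \<in> UNIV \<times> (I \<inter> LS s)" "p' \<in> UNIV \<times> (I \<inter> LS s)" "?f p = ?f p'"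
    obtain r z r' z' where pp: "p = (r, z)" "p' = (r', z')" by fastforce
    have "r * lco s x0 = r' * lco s x0" using p lk[of z r] lk[of z' r'] unfolding pp by auto
    then have "r = r'" using nz by simp
    then show "p = p'" using p(3) pp by simp
  qed
  have "?f ` (UNIV \<times> (I \<inter> LS s)) = I \<inter> LS (Suc s)"
  proof (intro equalityI subsetI)
    fix x assume "x \<in> ?f ` (UNIV \<times> (I \<inter> LS s))"
    then obtain k z where "x = emb [:k:] * x0 + z" "z \<in> I" "z \<in> LS s" by auto
    then show "x \<in> I \<inter> LS (Suc s)" using ideal_add[OF assms kI] LS_add[OF kL] sub by blast
  next
    fix x assume x: "x \<in> I \<inter> LS (Suc s)"
    let ?k = "lco s x / lco s x0"
    let ?z = "x - emb [:?k:] * x0"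
    have zI: "?z \<in> I" "?z \<in> LS (Suc s)" using x kI kL ideal_diff[OF assms] LS_diff by auto
    have "lco s x = ?k * lco s x0 + lco s ?z"
      using lco_linear[OF R[OF x0(1)] R[OF zI(1)], of s ?k] by simp
    then have "lco s ?z = 0" using nz by simp
    then have "?z \<in> LS s" using LS_Suc_iff zI by blast
    then have "x = ?f (?k, ?z)" "(?k, ?z) \<in> UNIV \<times> (I \<inter> LS s)" using zI by auto
    then show "x \<in> ?f ` (UNIV \<times> (I \<inter> LS s))" by (rule image_eqI)
  qed
  then have "card (I \<inter> LS (Suc s)) = card ((UNIV :: 'f set) \<times> (I \<inter> LS s))" using card_image[OF inj] by simp
  then show ?thesis using True by (simp add: card_cartesian_product)
next
  case False
  then have "I \<inter> LS (Suc s) = I \<inter> LS s" by (auto simp: LS_def att_def less_Suc_eq)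
  then show ?thesis using False by simp
qed

lemma card_Int_LS:
  assumes "ideal I"
  shows "card (I \<inter> LS s) = CARD('f) ^ card {t. t < s \<and> att I t}"
proof (induction s)
  case 0
  have "I \<inter> LS 0 = {0}" using ideal_0[OF assms] by (auto simp: LS_def)
  then show ?case by simp
next
  case (Suc s)
  have "{t. t < Suc s \<and> att I t} = (if att I s then insert s {t. t < s \<and> att I t} else {t. t < s \<and> att I t})"
    by (auto simp: less_Suc_eq)
  then show ?case using Suc card_Int_LS_Suc[OF assms, of s] by simp
qed

lemma CARD_ge_2: "CARD('f) \<ge> 3"
  using CARD_ge_3[OF two_nonzero] .

text \<open>\<open>LS s\<close> has dimension \<open>s - g\<close>, and
  \<open>I \<inter> LS s\<close> has codimension \<open>ideg I\<close> in it for large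
  \<open>s\<close>. So \<open>s - g - ideg I\<close> orders below \<open>s\<close> are attained, and
  the others are gaps.\<close>

lemma card_not_att_eventually:
  assumes "ideal I"
  shows "\<exists>s0. \<forall>s\<ge>s0. card {t. t < s \<and> \<not> att I t} = ideg I + g"
proof -
  obtain s0 where s0: "\<And>s. s \<ge> s0 \<Longrightarrow> card (LS s) = CARD('f) ^ ideg I * card (I \<inter> LS s)"
    using card_LS_Int_ideal[OF assms] by blast
  have "card {t. t < s \<and> \<not> att I t} = ideg I + g" if "s \<ge> s0 + 2 * g" for s
  proof -
    have "CARD('f) ^ (s - g) = CARD('f) ^ (ideg I + card {t. t < s \<and> att I t})"
      using s0[of s] card_LS[of s] card_Int_LS[OF assms] that by (simp add: power_add)
    then have 1: "s - g = ideg I + card {t. t < s \<and> att I t}"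
      using CARD_ge_2 by (simp add: power_inject_exp)
    have "card {t. t < s \<and> att I t} + card {t. t < s \<and> \<not> att I t} = card ({t. t < s \<and> att I t} \<union> {t. t < s \<and> \<not> att I t})"
      by (subst card_Un_disjoint) auto
    also have "{t. t < s \<and> att I t} \<union> {t. t < s \<and> \<not> att I t} = {..<s}" by auto
    finally show ?thesis using 1 that by simp
  qed
  then show ?thesis by blast
qed

lemma att_add_2: assumes "ideal I" "att I t" shows "att I (t + 2)"
proof -
  obtain x where x: "x \<in> I" "x \<noteq> 0" "dg x = t" using assms(2) by (auto simp: att_def)
  then have "x \<in> RD" using ideal_subset[OF assms(1)] by blast
  then have "dg (emb [:0, 1:] * x) = t + 2" using x by (simp add: dg_mult dg_emb)
  moreover have "emb [:0, 1:] * x \<in> I" using x ideal_mult[OF assms(1)] by simp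
  ultimately show ?thesis using x by (auto simp: att_def intro!: bexI[of _ "emb [:0, 1:] * x"])
qed

text \<open>
  By multiplication with \<open>t\<close> the gaps of each parity form an initial segment; there are only \<open>g\<close>
  gaps beyond \<open>ideg I\<close>, so none is larger than \<open>ideg I + 2g - 1\<close>.
\<close>

lemma att_large:
  assumes "ideal I" "t \<ge> ideg I + 2 * g" shows "att I t"
proof (rule ccontr)
  assume na: "\<not> att I t"
  obtain s0 where s0: "\<And>s. s \<ge> s0 \<Longrightarrow> card {t. t < s \<and> \<not> att I t} = ideg I + g"
    using card_not_att_eventually[OF assms(1)] by blast
  have nk: "\<not> att I (t - 2 * k)" if "k \<le> g" for k
    using that
  proof (induction k)
    case (Suc k)
    have "2 * Suc k \<le> t" using Suc.prems assms(2) by simp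
    then have "t - 2 * k = (t - 2 * Suc k) + 2" by simp
    then show ?case using Suc att_add_2[OF assms(1), of "t - 2 * Suc k"] by auto
  qed (use na in simp)
  have small: "\<not> att I t'" if "t' < ideg I" for t'
    using that ideg_le_dg[OF assms(1)] by (auto simp: att_def) (metis leD)
  let ?A = "{..<ideg I}" and ?B = "(\<lambda>k. t - 2 * k) ` {..g}" and ?s = "max s0 (Suc t)"
  have "card (?A \<union> ?B) = card ?A + card ?B"
    by (rule card_Un_disjoint) (use assms(2) in auto)
  also have "card ?B = Suc g" using assms(2) by (subst card_image) (auto simp: inj_on_def)
  finally have "card (?A \<union> ?B) = ideg I + g + 1" by simp
  moreover have "?A \<union> ?B \<subseteq> {t'. t' < ?s \<and> \<not> att I t'}"
    using nk small assms(2) by (auto simp: less_max_iff_disj)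
  then have "card (?A \<union> ?B) \<le> card {t'. t' < ?s \<and> \<not> att I t'}" by (intro card_mono) auto
  ultimately show False using s0[of ?s] by simp
qed

lemma card_not_att:
  assumes "ideal I"
  shows "card {t. t < s \<and> \<not> att I t} \<le> ideg I + g"
    and "s \<ge> ideg I + 2 * g \<Longrightarrow> card {t. t < s \<and> \<not> att I t} = ideg I + g"
proof -
  obtain s0 where s0: "\<And>s. s \<ge> s0 \<Longrightarrow> card {t. t < s \<and> \<not> att I t} = ideg I + g"
    using card_not_att_eventually[OF assms] by blast
  have "card {t. t < s \<and> \<not> att I t} \<le> card {t. t < max s s0 \<and> \<not> att I t}" by (intro card_mono) auto
  then show "card {t. t < s \<and> \<not> att I t} \<le> ideg I + g" using s0[of "max s s0"] by simp
  assume s: "s \<ge> ideg I + 2 * g"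
  have "{t. t < s \<and> \<not> att I t} = {t. t < max s s0 \<and> \<not> att I t}"
    using s att_large[OF assms] by (auto simp: less_max_iff_disj) (meson dual_order.trans not_less)
  then show "card {t. t < s \<and> \<not> att I t} = ideg I + g" using s0[of "max s s0"] by simp
qed

lemma card_att_less: "card {t. t < s \<and> att I t} = s - card {t. t < s \<and> \<not> att I t}"
proof -
  have "card {t. t < s \<and> att I t} + card {t. t < s \<and> \<not> att I t} = card ({t. t < s \<and> att I t} \<union> {t. t < s \<and> \<not> att I t})"
    by (subst card_Un_disjoint) auto
  also have "{t. t < s \<and> att I t} \<union> {t. t < s \<and> \<not> att I t} = {..<s}" by auto
  finally show ?thesis by simp
qed

text \<open>Riemann's inequality: below any \<open>s\<close> there are at most
  \<open>ideg I + g\<close> gaps. For large \<open>s\<close> all gaps lie below \<open>s\<close>,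
  and \<open>card_Int_LS_eq\<close> has equality.\<close>

lemma card_Int_LS_ge: assumes "ideal I" shows "card (I \<inter> LS s) \<ge> CARD('f) ^ (s - (ideg I + g))"
  unfolding card_Int_LS[OF assms] card_att_less
  using card_not_att(1)[OF assms, of s] CARD_ge_2 by (intro power_increasing diff_le_mono2) simp_all

lemma card_Int_LS_eq:
  assumes "ideal I" "s \<ge> ideg I + 2 * g" shows "card (I \<inter> LS s) = CARD('f) ^ (s - (ideg I + g))"
  unfolding card_Int_LS[OF assms(1)] card_att_less card_not_att(2)[OF assms] ..

definition lev :: "'o set \<Rightarrow> nat \<Rightarrow> 'o set" where
  "lev I s = {x \<in> I. x \<noteq> 0 \<and> dg x = s}"

lemma lev_eq: assumes "ideal I" shows "lev I s = (I \<inter> LS (Suc s)) - (I \<inter> LS s)"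
proof -
  have "x \<in> I \<Longrightarrow> x \<in> RD" for x using ideal_subset[OF assms] by blast
  then show ?thesis unfolding lev_def LS_def by fastforce
qed

lemma finite_lev: "ideal I \<Longrightarrow> finite (lev I s)"
  by (simp add: lev_eq)

lemma card_lev:
  assumes "ideal I" "s \<ge> ideg I + 2 * g"
  shows "card (lev I s) = (CARD('f) - 1) * CARD('f) ^ (s - (ideg I + g))"
proof -
  have "I \<inter> LS s \<subseteq> I \<inter> LS (Suc s)" using LS_mono[of s "Suc s"] by auto
  then have "card (lev I s) = card (I \<inter> LS (Suc s)) - card (I \<inter> LS s)"
    unfolding lev_eq[OF assms(1)] by (intro card_Diff_subset) auto
  also have "\<dots> = CARD('f) * CARD('f) ^ (s - (ideg I + g)) - CARD('f) ^ (s - (ideg I + g))"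
    using assms by (simp add: card_Int_LS_eq Suc_diff_le)
  finally show ?thesis by (simp add: diff_mult_distrib)
qed

section \<open>Duality between complementary ideals\<close>

lemma idealsD: "I \<in> ideals i \<Longrightarrow> ideal I" "I \<in> ideals i \<Longrightarrow> ideg I = i"
  by (auto simp: ideals_def)

text \<open>For \<open>z\<close> in \<open>I\<close> of degree \<open>i + j\<close> the
  complementary ideal \<open>J\<close> with \<open>I J = (z)\<close> has degree \<open>j\<close>;
  hence the symmetry in \<open>i\<close> and \<open>j\<close>.\<close>

definition pairs :: "nat \<Rightarrow> nat \<Rightarrow> ('o set \<times> 'o) set" where
  "pairs i j = (SIGMA I:ideals i. lev I (i + j))"

lemma finite_pairs: "finite (pairs i j)"
  unfolding pairs_def by (intro finite_SigmaI finite_ideals finite_lev idealsD)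

text \<open>The ideal \<open>J\<close> with \<open>I J = (z)\<close> determines \<open>I\<close>.\<close>

lemma card_pairs_le: "card (pairs i j) \<le> card (pairs j i)"
proof -
  define F where "F = (\<lambda>(I, z). (SOME J. ideal J \<and> imul I J = prin z, z))"
  have F: "\<exists>J. F (I, z) = (J, z) \<and> ideal J \<and> imul I J = prin z \<and> J \<in> ideals j \<and> z \<in> J"
    if "(I, z) \<in> pairs i j" for I z
  proof -
    have I: "ideal I" "ideg I = i" "z \<in> I" "z \<noteq> 0" "dg z = i + j"
      using that by (auto simp: pairs_def ideals_def lev_def)
    then have z: "z \<in> RD" using ideal_subset by blast
    obtain J where "ideal J" "imul I J = prin z"
      using ideal_divides[OF ideal_prin[OF z I(4)] I(1)] I by (auto simp: prin_subset_iff)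
    define J' where "J' = (SOME J. ideal J \<and> imul I J = prin z)"
    have J': "ideal J' \<and> imul I J' = prin z"
      unfolding J'_def by (rule someI[of _ J]) (use \<open>ideal J\<close> \<open>imul I J = prin z\<close> in simp)
    then have "ideg J' = j" using ideg_imul[OF I(1), of J'] ideg_prin[OF z I(4)] I by simp
    moreover have "prin z \<subseteq> J'" using imul_subset[OF I(1), of J'] J' by simp
    then have "z \<in> J'" using J' prin_subset_iff by blast
    ultimately show ?thesis using J' by (auto simp: F_def J'_def[symmetric] ideals_def)
  qed
  have "inj_on F (pairs i j)"
  proof (rule inj_onI)
    fix p p' assume p: "p \<in> pairs i j" "p' \<in> pairs i j" "F p = F p'"
    obtain I z I' z' where pp: "p = (I, z)" "p' = (I', z')" by fastforce
    obtain J where J: "F (I, z) = (J, z)" "ideal J" "imul I J = prin z" using F p pp by blast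
    obtain J' where J': "F (I', z') = (J', z')" "imul I' J' = prin z'" using F p pp by blast
    have "z = z'" "J' = J" using J J' p pp by auto
    then have "imul J I = imul J I'" using J J' by (simp add: imul_commute)
    moreover have "ideal I" "ideal I'" using p pp by (auto simp: pairs_def ideals_def)
    ultimately have "I = I'" using imul_cancel J by blast
    then show "p = p'" using pp \<open>z = z'\<close> by simp
  qed
  moreover have "F ` pairs i j \<subseteq> pairs j i"
  proof (rule image_subsetI)
    fix p assume p: "p \<in> pairs i j"
    obtain I z where pp: "p = (I, z)" by fastforce
    obtain J where "F p = (J, z)" "J \<in> ideals j" "z \<in> J" using F p pp by blast
    moreover have "z \<noteq> 0" "dg z = i + j" using p pp by (auto simp: pairs_def lev_def)
    ultimately show "F p \<in> pairs j i" by (auto simp: pairs_def lev_def add.commute)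
  qed
  ultimately show ?thesis using finite_pairs by (metis card_image card_mono)
qed

lemma card_pairs_commute: "card (pairs i j) = card (pairs j i)"
  using card_pairs_le[of i j] card_pairs_le[of j i] by simp

lemma card_pairs:
  assumes "j \<ge> 2 * g"
  shows "card (pairs i j) = card (ideals i) * ((CARD('f) - 1) * CARD('f) ^ (j - g))"
proof -
  have "card (pairs i j) = (\<Sum>I\<in>ideals i. card (lev I (i + j)))"
    unfolding pairs_def by (intro card_SigmaI ballI finite_ideals finite_lev idealsD)
  also have "\<dots> = (\<Sum>I\<in>ideals i. (CARD('f) - 1) * CARD('f) ^ (j - g))"
    using assms by (intro sum.cong) (auto simp: ideals_def card_lev)
  finally show ?thesis by simp
qed

definition rho :: real where
  "rho = real (card (ideals (2 * g))) / real CARD('f) ^ (2 * g)"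

text \<open>Pairs of degrees \<open>m\<close> and \<open>2 * g\<close> are counted from both sides;
  each degree is at least \<open>2 * g\<close>, so the number of \<open>z\<close> per ideal is known
  exactly on either side.\<close>

lemma card_ideals_large:
  assumes "m \<ge> 2 * g" shows "real (card (ideals m)) = rho * real CARD('f) ^ m"
proof -
  let ?q = "real CARD('f)"
  have "card (ideals m) * ((CARD('f) - 1) * CARD('f) ^ (2 * g - g)) = card (pairs m (2 * g))"
    by (rule card_pairs[symmetric]) simp
  also have "\<dots> = card (pairs (2 * g) m)" by (rule card_pairs_commute)
  also have "\<dots> = card (ideals (2 * g)) * ((CARD('f) - 1) * CARD('f) ^ (m - g))"
    by (rule card_pairs) (rule assms)
  finally have "(CARD('f) - 1) * (card (ideals m) * CARD('f) ^ g) =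
      (CARD('f) - 1) * (card (ideals (2 * g)) * CARD('f) ^ (m - g))"
    by (simp add: mult.left_commute)
  then have "card (ideals m) * CARD('f) ^ g = card (ideals (2 * g)) * CARD('f) ^ (m - g)"
    using CARD_ge_2 by (subst (asm) mult_cancel1) auto
  then have "real (card (ideals m) * CARD('f) ^ g) = real (card (ideals (2 * g)) * CARD('f) ^ (m - g))"
    by (simp only:)
  then have e: "real (card (ideals m)) * ?q ^ g = real (card (ideals (2 * g))) * ?q ^ (m - g)" by simp
  have "?q ^ g * ?q ^ (m - g) = ?q ^ m" using assms by (simp flip: power_add)
  moreover have "?q ^ (2 * g) = ?q ^ g * ?q ^ g" by (simp add: mult_2 power_add)
  moreover have "?q ^ g > 0" by simp
  ultimately show ?thesis using e by (simp add: rho_def field_simps)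
qed

text \<open>The principal ideal of \<open>t ^ g\<close> has degree \<open>2 * g\<close>.\<close>

lemma rho_pos: "rho > 0"
proof -
  have "prin (emb (monom 1 g)) \<in> ideals (2 * g)"
    by (simp add: ideals_def ideal_prin ideg_prin dg_emb degree_monom_eq)
  then have "card (ideals (2 * g)) > 0" by (auto simp: card_gt_0_iff)
  then show ?thesis by (simp add: rho_def)
qed

text \<open>Nonzero elements of pole order at most \<open>2 * g + m\<close> in ideals of degree
  \<open>2 * g\<close> are counted twice. Riemann's inequality gives at least
  \<open>q ^ (m + 1 - g) - 1\<close> of them per ideal; duality turns their total number into a
  multiple of the number of ideals of degree at most \<open>m\<close>.\<close>

lemma rho_bound:
  assumes "m \<ge> g + 1"
  shows "rho * real CARD('f) ^ m \<le> 2 * real (\<Sum>j\<le>m. card (ideals j))"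
proof -
  let ?q = "CARD('f)" and ?i = "2 * g" and ?T = "\<Sum>j\<le>m. card (ideals j)"
  have "card (ideals ?i) * (?q ^ (m + 1 - g) - 1) = (\<Sum>I\<in>ideals ?i. ?q ^ (m + 1 - g) - 1)" by simp
  also have "\<dots> \<le> (\<Sum>I\<in>ideals ?i. \<Sum>j\<le>m. card (lev I (?i + j)))"
  proof (rule sum_mono)
    fix I assume "I \<in> ideals ?i"
    then have I: "ideal I" "ideg I = ?i" by (auto simp: ideals_def)
    \<comment> \<open>Nonzero elements of \<open>I\<close> have pole order at least
      \<open>ideg I = 2 * g\<close>, so writing it as \<open>2 * g + j\<close> loses
      nothing.\<close>
    have "(I \<inter> LS (?i + m + 1)) - {0} \<subseteq> (\<Union>j\<le>m. lev I (?i + j))"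
    proof
      fix x assume x: "x \<in> (I \<inter> LS (?i + m + 1)) - {0}"
      then have "?i \<le> dg x" "dg x < ?i + m + 1" using ideg_le_dg[OF I(1), of x] I(2) by (auto simp: LS_def)
      then show "x \<in> (\<Union>j\<le>m. lev I (?i + j))"
        using x by (intro UN_I[of "dg x - ?i"]) (auto simp: lev_def)
    qed
    then have "card ((I \<inter> LS (?i + m + 1)) - {0}) \<le> card (\<Union>j\<le>m. lev I (?i + j))"
      using I by (intro card_mono) (auto simp: finite_lev)
    also have "\<dots> \<le> (\<Sum>j\<le>m. card (lev I (?i + j)))" by (intro card_UN_le) auto
    finally have "card (I \<inter> LS (?i + m + 1)) - 1 \<le> (\<Sum>j\<le>m. card (lev I (?i + j)))"
      using ideal_0[OF I(1)] by (simp add: LS_def card_Diff_singleton)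
    moreover have "?q ^ (m + 1 - g) \<le> card (I \<inter> LS (?i + m + 1))"
      using card_Int_LS_ge[OF I(1), of "?i + m + 1"] I(2) by simp
    ultimately show "?q ^ (m + 1 - g) - 1 \<le> (\<Sum>j\<le>m. card (lev I (?i + j)))" by linarith
  qed
  also have "\<dots> = (\<Sum>j\<le>m. card (pairs ?i j))"
    unfolding pairs_def by (subst sum.swap) (intro sum.cong refl card_SigmaI[symmetric] ballI finite_ideals finite_lev idealsD)
  also have "\<dots> = (\<Sum>j\<le>m. card (ideals j) * ((?q - 1) * ?q ^ g))"
    by (rule sum.cong) (simp_all add: card_pairs_commute[of ?i] card_pairs)
  also have "\<dots> = ?T * ((?q - 1) * ?q ^ g)" by (rule sum_distrib_right[symmetric])
  finally have main: "card (ideals ?i) * (?q ^ (m + 1 - g) - 1) \<le> ?T * ((?q - 1) * ?q ^ g)" .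
  obtain k where k: "m = g + k" "k \<ge> 1" using assms le_Suc_ex[of g m] by auto
  have q3: "?q \<ge> 3" by (rule CARD_ge_2)
  \<comment> \<open>The 2 in the bound pays for dropping the \<open>- 1\<close>, that is, for
    leaving out the zero element.\<close>
  have "1 * 3 \<le> ?q ^ k * ?q" using q3 by (intro mult_mono) auto
  then have "3 \<le> ?q * ?q ^ k" by (simp add: mult.commute)
  moreover have "w \<le> 2 * (w - 1)" if "3 \<le> w" for w :: nat using that by simp
  ultimately have "?q * ?q ^ k \<le> 2 * (?q ^ (k + 1) - 1)" by simp
  then have "card (ideals ?i) * (?q * ?q ^ k) \<le> card (ideals ?i) * (2 * (?q ^ (k + 1) - 1))" by (rule mult_left_mono) simp
  also have "\<dots> \<le> 2 * (?T * ((?q - 1) * ?q ^ g))" using main k by simp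
  also have "\<dots> \<le> ?q * (2 * ?T * ?q ^ g)" by (simp add: mult_ac)
  finally have "card (ideals ?i) * ?q ^ k \<le> 2 * ?T * ?q ^ g" using q3 by simp
  then have "real (card (ideals ?i) * ?q ^ k) \<le> real (2 * ?T * ?q ^ g)" by (simp only: of_nat_le_iff)
  then have r: "real (card (ideals ?i)) * real ?q ^ k \<le> 2 * real ?T * real ?q ^ g" by simp
  have "rho * real ?q ^ m = real (card (ideals ?i)) * real ?q ^ k / real ?q ^ g"
  proof -
    have "real ?q ^ (2 * g) = real ?q ^ g * real ?q ^ g" by (simp add: mult_2 power_add)
    then show ?thesis unfolding rho_def k(1) by (simp add: power_add)
  qed
  also have "\<dots> \<le> 2 * real ?T" using r by (simp add: field_simps)
  finally show ?thesis .
qed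

end

section \<open>Valuation rings in a subfield of a type\<close>

definition field_ring :: "'a::field set \<Rightarrow> 'a ring" where
  "field_ring C = \<lparr>carrier = C, monoid.mult = (*), one = 1, ring.zero = 0, add = (+)\<rparr>"

lemma field_ring_simps [simp]:
  "carrier (field_ring C) = C" "x \<otimes>\<^bsub>field_ring C\<^esub> z = x * z" "x \<oplus>\<^bsub>field_ring C\<^esub> z = x + z"
  "\<one>\<^bsub>field_ring C\<^esub> = 1" "\<zero>\<^bsub>field_ring C\<^esub> = 0"
  by (simp_all add: field_ring_def)

locale subfield_of_type =
  fixes C :: "'a::field set"
  assumes zero_C [simp]: "0 \<in> C" and one_C [simp]: "1 \<in> C"
    and add_C: "x \<in> C \<Longrightarrow> z \<in> C \<Longrightarrow> x + z \<in> C" and mult_C: "x \<in> C \<Longrightarrow> z \<in> C \<Longrightarrow> x * z \<in> C"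
    and minus_C: "x \<in> C \<Longrightarrow> - x \<in> C" and inverse_C: "x \<in> C \<Longrightarrow> inverse x \<in> C"
begin

lemma field_field_ring: "field (field_ring C)"
proof -
  have "abelian_group (field_ring C)"
    using minus_C by (intro abelian_groupI) (auto simp: add_C add.assoc add.commute intro!: bexI[of _ "- x" for x])
  moreover have "comm_monoid (field_ring C)"
    by (intro comm_monoidI) (auto simp: mult_C mult.assoc mult.commute)
  ultimately have "cring (field_ring C)"
    by (intro cringI) (auto simp: distrib_right)
  moreover have "Units (field_ring C) = carrier (field_ring C) - {\<zero>\<^bsub>field_ring C\<^esub>}"
  proof
    show "carrier (field_ring C) - {\<zero>\<^bsub>field_ring C\<^esub>} \<subseteq> Units (field_ring C)"
      using inverse_C by (auto simp: Units_def intro!: bexI[of _ "inverse x" for x])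
  qed (auto simp: Units_def)
  ultimately show ?thesis by (rule cring.cring_fieldI)
qed

interpretation K: field "field_ring C"
  by (rule field_field_ring)

lemma inv_field_ring: assumes "z \<in> C" "z \<noteq> 0" shows "inv\<^bsub>field_ring C\<^esub> z = inverse z"
  using assms inverse_C by (intro K.comm_inv_char) auto

lemma a_inv_field_ring: assumes "z \<in> C" shows "\<ominus>\<^bsub>field_ring C\<^esub> z = - z"
  using assms minus_C by (intro K.minus_equality) auto

text \<open>Membership in \<open>places\<close> for a subfield of a type, expressed in the
  arithmetic of that type; \<open>places_iff\<close> links the two.\<close>

definition is_place :: "'a set \<Rightarrow> 'a set \<Rightarrow> bool" where
  "is_place k V \<longleftrightarrow> V \<subseteq> C \<and> k \<subseteq> V \<and> V \<noteq> C \<and> 1 \<in> V \<and> - 1 \<in> V \<and> (\<forall>x\<in>V. \<forall>z\<in>V. x + z \<in> V) \<and>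
    (\<forall>x\<in>V. \<forall>z\<in>V. x * z \<in> V) \<and> (\<forall>z\<in>C. z \<noteq> 0 \<longrightarrow> z \<in> V \<or> inverse z \<in> V)"

lemma is_placeD:
  assumes "is_place k V"
  shows place_subset: "V \<subseteq> C" and place_const: "k \<subseteq> V" and place_proper: "V \<noteq> C" and place_1: "1 \<in> V"
    and place_minus_1: "- 1 \<in> V"
    and place_add: "x \<in> V \<Longrightarrow> z \<in> V \<Longrightarrow> x + z \<in> V" and place_mult: "x \<in> V \<Longrightarrow> z \<in> V \<Longrightarrow> x * z \<in> V"
    and place_inverse: "z \<in> C \<Longrightarrow> z \<noteq> 0 \<Longrightarrow> z \<in> V \<or> inverse z \<in> V"
  using assms by (simp_all add: is_place_def)

lemma place_minus: "is_place k V \<Longrightarrow> x \<in> V \<Longrightarrow> - x \<in> V"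
  using place_mult[of k V "- 1" x] place_minus_1[of k V] by simp

lemma place_0: "is_place k V \<Longrightarrow> 0 \<in> V"
  using place_add[of k V 1 "- 1"] place_1[of k V] place_minus_1[of k V] by simp

lemma places_iff: "V \<in> places (field_ring C) k \<longleftrightarrow> is_place k V"
proof
  assume V: "V \<in> places (field_ring C) k"
  then have s: "subring V (field_ring C)" and kV: "k \<subseteq> V" "V \<noteq> C"
    and i: "\<And>z. z \<in> C - {0} \<Longrightarrow> z \<in> V \<or> inv\<^bsub>field_ring C\<^esub> z \<in> V" by (auto simp: places_def)
  have "- 1 \<in> V" using subringE(5)[OF s, of 1] subringE(3)[OF s] a_inv_field_ring[of 1] by simp
  then show "is_place k V"
    using subringE(1,3,6,7)[OF s] kV i inv_field_ring unfolding is_place_def by auto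
next
  assume V: "is_place k V"
  have "subring V (field_ring C)"
    using is_placeD[OF V] place_minus[OF V] a_inv_field_ring
    by (intro K.subringI) auto
  then show "V \<in> places (field_ring C) k"
    using is_placeD[OF V] inv_field_ring by (auto simp: places_def)
qed

definition mx :: "'a set \<Rightarrow> 'a set" where
  "mx V = {z \<in> V. z = 0 \<or> inverse z \<notin> V}"

lemma place_ideal_eq: assumes "is_place k V" shows "place_ideal (field_ring C) V = mx V"
proof -
  have "z \<in> Units (field_ring C\<lparr>carrier := V\<rparr>) \<longleftrightarrow> z \<in> V \<and> z \<noteq> 0 \<and> inverse z \<in> V" for z
  proof
    assume z: "z \<in> Units (field_ring C\<lparr>carrier := V\<rparr>)"
    then obtain w where w: "z \<in> V" "w \<in> V" "w * z = 1" by (auto simp: Units_def)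
    then have "z \<noteq> 0" by auto
    moreover from w(3) this have "inverse z = w" by (metis inverse_unique mult.commute)
    ultimately show "z \<in> V \<and> z \<noteq> 0 \<and> inverse z \<in> V" using w by simp
  next
    assume "z \<in> V \<and> z \<noteq> 0 \<and> inverse z \<in> V"
    then show "z \<in> Units (field_ring C\<lparr>carrier := V\<rparr>)"
      by (auto simp: Units_def intro!: bexI[of _ "inverse z"])
  qed
  then show ?thesis by (auto simp: place_ideal_def mx_def)
qed

lemma mx_subset: "mx V \<subseteq> V"
  by (auto simp: mx_def)

lemma mx_mult: assumes V: "is_place k V" and "a \<in> mx V" "r \<in> V" shows "r * a \<in> mx V"
proof -
  have a: "a \<in> V" using assms(2) by (simp add: mx_def)
  have "r * a = 0 \<or> inverse (r * a) \<notin> V"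
  proof (rule ccontr)
    assume "\<not> (r * a = 0 \<or> inverse (r * a) \<notin> V)"
    then have nz: "r \<noteq> 0" "a \<noteq> 0" and i: "inverse (r * a) \<in> V" by auto
    have "r * inverse (r * a) = inverse a" using nz by (simp add: field_simps)
    then have "inverse a \<in> V" using place_mult[OF V assms(3) i] by metis
    then show False using assms(2) nz by (simp add: mx_def)
  qed
  then show ?thesis using place_mult[OF V assms(3) a] by (simp only: mx_def mem_Collect_eq simp_thms)
qed

text \<open>In a valuation ring one of \<open>a / b\<close> and \<open>b / a\<close> is integral, so
  the sum is an integral multiple of one of the summands.\<close>

lemma mx_add: assumes V: "is_place k V" and "a \<in> mx V" "b \<in> mx V" shows "a + b \<in> mx V"
proof (cases "a = 0 \<or> b = 0")
  case False
  have ab: "a \<in> V" "b \<in> V" "a \<in> C" "b \<in> C" using assms place_subset[OF V] by (auto simp: mx_def)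
  have *: "x + z \<in> mx V" if "x / z \<in> V" "z \<in> mx V" "z \<noteq> 0" for x z
  proof -
    have "x + z = (x / z + 1) * z" using that(3) by (simp add: field_simps)
    then show ?thesis using mx_mult[OF V that(2) place_add[OF V that(1) place_1[OF V]]] by simp
  qed
  have "a / b \<in> C" "a / b \<noteq> 0" using ab False mult_C inverse_C by (auto simp: divide_inverse)
  then have "a / b \<in> V \<or> b / a \<in> V" using place_inverse[OF V, of "a / b"] by simp
  then show ?thesis using *[of a b] *[of b a] False assms by (auto simp: add.commute)
qed (use assms in auto)

lemma mx_minus: "is_place k V \<Longrightarrow> a \<in> mx V \<Longrightarrow> - a \<in> mx V"
  using mx_mult[of k V a "- 1"] place_minus_1[of k V] by simp

lemma mx_diff: "is_place k V \<Longrightarrow> a \<in> mx V \<Longrightarrow> b \<in> mx V \<Longrightarrow> a - b \<in> mx V"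
  using mx_add[of k V a "- b"] mx_minus by simp

lemma one_not_mx: "is_place k V \<Longrightarrow> 1 \<notin> mx V"
  using place_1[of k V] by (simp add: mx_def)

lemma mx_zero: "is_place k V \<Longrightarrow> 0 \<in> mx V"
  by (simp add: mx_def place_0)

lemma place_norm_eq:
  assumes V: "is_place k V" and R: "R \<subseteq> V" "\<And>x. x \<in> V \<Longrightarrow> \<exists>r\<in>R. x - r \<in> mx V"
    "\<And>r r'. r \<in> R \<Longrightarrow> r' \<in> R \<Longrightarrow> r - r' \<in> mx V \<Longrightarrow> r = r'"
  shows "place_norm (field_ring C) V = card R"
proof -
  let ?c = "\<lambda>a. (\<lambda>h. h + a) ` mx V"
  have "(\<Union>h\<in>mx V. {h + a}) = ?c a" for a by auto
  then have c: "carrier (residue_field (field_ring C) V) = ?c ` V"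
    unfolding residue_field_def FactRing_def A_RCOSETS_def' a_r_coset_def' place_ideal_eq[OF V] by simp blast
  have eq_iff: "?c x = ?c z \<longleftrightarrow> x - z \<in> mx V" for x z
  proof
    assume "?c x = ?c z"
    moreover have "0 + x \<in> ?c x" using mx_zero[OF V] by (intro imageI)
    ultimately obtain h where "h \<in> mx V" "0 + x = h + z" by blast
    then show "x - z \<in> mx V" by simp
  next
    have *: "?c x \<subseteq> ?c z" if "x - z \<in> mx V" for x z
    proof
      fix w assume "w \<in> ?c x"
      then obtain h where "h \<in> mx V" "w = h + x" by blast
      then have "w = (h + (x - z)) + z" "h + (x - z) \<in> mx V" using mx_add[OF V] that by auto
      then show "w \<in> ?c z" by blast
    qed
    assume "x - z \<in> mx V"
    moreover from this have "z - x \<in> mx V" using mx_minus[OF V] by fastforce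
    ultimately show "?c x = ?c z" using *[of x z] *[of z x] by blast
  qed
  have "?c ` V = ?c ` R"
  proof
    show "?c ` V \<subseteq> ?c ` R" using R(2) eq_iff by blast
  qed (use R(1) in blast)
  moreover have "inj_on ?c R" by (rule inj_onI) (use eq_iff R(3) in blast)
  ultimately show ?thesis unfolding place_norm_def c by (simp add: card_image)
qed

text \<open>Valuation rings are integrally closed: for \<open>z\<close> outside \<open>V\<close>,
  dividing the equation by \<open>z\<close> writes \<open>z\<close> as
  \<open>a + b * inverse z\<close>, an element of \<open>V\<close>.\<close>

lemma place_quadratic:
  assumes V: "is_place k V" and "z \<in> C" "a \<in> V" "b \<in> V" "z * z = a * z + b"
  shows "z \<in> V"
proof (cases "z = 0")
  case False
  show ?thesis
  proof (rule ccontr)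
    assume "z \<notin> V"
    then have i: "inverse z \<in> V" using place_inverse[OF V assms(2) False] by blast
    have "z * inverse z = 1" using False by simp
    then have "z = (z * z) * inverse z" by (simp only: mult.assoc mult_1_right)
    also have "\<dots> = a * (z * inverse z) + b * inverse z" unfolding assms(5) by (simp only: distrib_right mult.assoc)
    also have "\<dots> = a + b * inverse z" using False by simp
    finally have "z = a + b * inverse z" .
    moreover have "a + b * inverse z \<in> V" by (rule place_add[OF V assms(3) place_mult[OF V assms(4) i]])
    ultimately show False using \<open>z \<notin> V\<close> by metis
  qed
qed (use place_0[OF V] in simp)

end

section \<open>The places of \<open>\<bbbF>\<^sub>q(t, \<surd>D)\<close>\<close>

context hyperelliptic begin

text \<open>Polynomial denominators already give the whole fraction field, since
  \<open>cj x / emb (nm x)\<close> is the inverse of \<open>x\<close>.\<close>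

definition KK :: "'o set" where "KK = {x / emb s | x s. x \<in> RD \<and> s \<noteq> 0}"

definition kk :: "'o set" where "kk = range (\<lambda>a. emb [:a:])"

lemma KKI: "x \<in> RD \<Longrightarrow> s \<noteq> 0 \<Longrightarrow> x / emb s \<in> KK"
  by (auto simp: KK_def)

lemma KK_cases: assumes "z \<in> KK" obtains x s where "z = x / emb s" "x \<in> RD" "s \<noteq> 0"
  using assms by (auto simp: KK_def)

lemma RD_subset_KK: "RD \<subseteq> KK"
  using KKI[of _ 1] by auto

lemma cj_nonzero: "x \<in> RD \<Longrightarrow> x \<noteq> 0 \<Longrightarrow> cj x \<noteq> 0"
  using cj_cj[of x] by auto

lemma inverse_RD: assumes "x \<in> RD" "x \<noteq> 0" shows "inverse x = cj x / emb (nm x)"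
proof -
  have "emb (nm x) \<noteq> 0" using assms by (simp add: nm_eq_0_iff)
  then show ?thesis using mult_cj[OF assms(1)] assms(2) by (simp add: field_simps)
qed

lemma quotient_KK: assumes "x \<in> RD" "z \<in> RD" shows "x / z \<in> KK"
proof (cases "z = 0")
  case False
  have "x / z = x * inverse z" by (rule divide_inverse)
  also have "\<dots> = (x * cj z) / emb (nm z)" using inverse_RD[OF assms(2) False] by simp
  also have "\<dots> \<in> KK" using assms False by (intro KKI RD_mult) (auto simp: nm_eq_0_iff)
  finally show ?thesis .
qed (use RD_subset_KK in auto)

sublocale K: subfield_of_type KK
proof
  show "0 \<in> KK" "1 \<in> KK" using RD_subset_KK by auto
next
  fix x z assume "x \<in> KK" "z \<in> KK"
  then obtain a s b r where *: "x = a / emb s" "a \<in> RD" "s \<noteq> 0" "z = b / emb r" "b \<in> RD" "r \<noteq> 0"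
    by (auto elim!: KK_cases)
  have "x + z = (a * emb r + b * emb s) / emb (s * r)" using * by (simp add: emb_mult field_simps)
  then show "x + z \<in> KK" using * KKI[of "a * emb r + b * emb s" "s * r"] by (simp add: RD_add RD_mult)
  have "x * z = (a * b) / emb (s * r)" using * by (simp add: emb_mult)
  also have "\<dots> \<in> KK" using * by (intro KKI RD_mult) auto
  finally show "x * z \<in> KK" .
next
  fix x assume "x \<in> KK"
  then obtain a s where *: "x = a / emb s" "a \<in> RD" "s \<noteq> 0" by (auto elim!: KK_cases)
  have "- x = (- a) / emb s" using * by simp
  then show "- x \<in> KK" using * KKI[of "- a" s] by (simp add: RD_minus)
  have "inverse x = emb s / a" using * by simp
  then show "inverse x \<in> KK" using * quotient_KK[of "emb s" a] by simp
qed

abbreviation "is_pl \<equiv> K.is_place kk"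
abbreviation "mx \<equiv> K.mx"

section \<open>Prime ideals and localizations\<close>

definition prime_ideal :: "'o set \<Rightarrow> bool" where
  "prime_ideal p \<longleftrightarrow> ideal p \<and> p \<noteq> RD \<and> (\<forall>a\<in>RD. \<forall>b\<in>RD. a * b \<in> p \<longrightarrow> a \<in> p \<or> b \<in> p)"

lemma prime_idealD:
  assumes "prime_ideal p"
  shows prime_ideal_ideal: "ideal p" and prime_ideal_not_1: "1 \<notin> p"
    and prime_ideal_prime: "a \<in> RD \<Longrightarrow> b \<in> RD \<Longrightarrow> a * b \<in> p \<Longrightarrow> a \<in> p \<or> b \<in> p"
  using assms ideal_eq_RD_iff unfolding prime_ideal_def by blast+

lemma prime_ideal_imul:
  assumes "prime_ideal p" "ideal I" "ideal J" "imul I J \<subseteq> p" shows "I \<subseteq> p \<or> J \<subseteq> p"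
proof (rule ccontr)
  assume "\<not> (I \<subseteq> p \<or> J \<subseteq> p)"
  then obtain a b where "a \<in> I" "a \<notin> p" "b \<in> J" "b \<notin> p" by blast
  moreover have "a * b \<in> p" using assms(4) imulI[of a I b J] calculation by blast
  ultimately show False using prime_ideal_prime[OF assms(1)] ideal_subset assms by blast
qed

lemma imul_eq_right: assumes "ideal I" "ideal J" "imul I J = I" shows "J = RD"
  using imul_cancel[of I J RD] imul_RD'[of I] assms ideal_RD by simp

text \<open>Write \<open>p = I J\<close>; primality puts \<open>I\<close> or \<open>J\<close> into
  \<open>p\<close>. In the second case \<open>J = p L\<close>, and cancelling \<open>p\<close> from
  \<open>p = p (I L)\<close> shows that \<open>I L\<close> is the unit ideal.\<close>

lemma prime_ideal_maximal:
  assumes "prime_ideal p" "ideal I" "p \<subseteq> I" shows "I = p \<or> I = RD"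
proof -
  note p = prime_ideal_ideal[OF assms(1)]
  obtain J where J: "ideal J" "imul I J = p" using ideal_divides[OF p assms(2,3)] by blast
  then have "I \<subseteq> p \<or> J \<subseteq> p" using prime_ideal_imul[OF assms(1,2) J(1)] by simp
  then show ?thesis
  proof
    assume "J \<subseteq> p"
    then obtain L where L: "ideal L" "imul p L = J" using ideal_divides[OF J(1) p] by blast
    have "imul p (imul I L) = imul I (imul p L)" by (rule imul_left_commute)
    also have "\<dots> = p" using L J by simp
    finally have "imul I L = RD" using imul_eq_right[OF p ideal_imul[OF assms(2) L(1)]] by simp
    then have "RD \<subseteq> I" using imul_subset[OF L(1) assms(2)] by (simp add: imul_commute)
    then show ?thesis using ideal_subset[OF assms(2)] by blast
  qed (use assms in blast)
qed

definition isum :: "'o set \<Rightarrow> 'o \<Rightarrow> 'o set" where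
  "isum I s = {x + s * r | x r. x \<in> I \<and> r \<in> RD}"

lemma ideal_isum: assumes "ideal I" "s \<in> RD" shows "ideal (isum I s)" "I \<subseteq> isum I s" "s \<in> isum I s"
proof -
  show sub: "I \<subseteq> isum I s" using RD_0 unfolding isum_def by force
  show "s \<in> isum I s" using ideal_0[OF assms(1)] RD_1 unfolding isum_def by force
  show "ideal (isum I s)" unfolding ideal_def
  proof (intro conjI ballI)
    show "isum I s \<subseteq> RD" using ideal_subset[OF assms(1)] assms(2) by (auto simp: isum_def intro!: RD_add RD_mult)
    show "\<exists>x\<in>isum I s. x \<noteq> 0" using ideal_nonzero[OF assms(1)] sub by blast
  next
    fix x z assume "x \<in> isum I s" "z \<in> isum I s"
    then obtain a r b t where *: "x = a + s * r" "z = b + s * t" "a \<in> I" "b \<in> I" "r \<in> RD" "t \<in> RD"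
      by (auto simp: isum_def)
    then have "x + z = (a + b) + s * (r + t)" by (simp add: algebra_simps)
    then show "x + z \<in> isum I s" using * ideal_add[OF assms(1)] RD_add unfolding isum_def by blast
  next
    fix x w assume "x \<in> isum I s" "w \<in> RD"
    then obtain a r where *: "x = a + s * r" "a \<in> I" "r \<in> RD" by (auto simp: isum_def)
    then have "w * x = w * a + s * (w * r)" by (simp add: algebra_simps)
    then show "w * x \<in> isum I s" using * \<open>w \<in> RD\<close> ideal_mult[OF assms(1)] RD_mult unfolding isum_def by blast
  qed
qed

lemma prime_ideal_inverse:
  assumes "prime_ideal p" "s \<in> RD" "s \<notin> p" obtains s' where "s' \<in> RD" "s * s' - 1 \<in> p"
proof -
  note p = prime_ideal_ideal[OF assms(1)]
  have "isum p s = RD" using prime_ideal_maximal[OF assms(1) ideal_isum(1,2)[OF p assms(2)]]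
      ideal_isum(3)[OF p assms(2)] assms(3) by blast
  then have "1 \<in> isum p s" by simp
  then obtain x r where x: "1 = x + s * r" "x \<in> p" "r \<in> RD" by (auto simp: isum_def)
  then have "s * r - 1 = - x" by (simp add: algebra_simps)
  then show thesis using that[of r] x ideal_minus[OF p] by simp
qed

definition loc :: "'o set \<Rightarrow> 'o set" where
  "loc p = {a / s | a s. a \<in> RD \<and> s \<in> RD \<and> s \<notin> p}"

lemma locI: "a \<in> RD \<Longrightarrow> s \<in> RD \<Longrightarrow> s \<notin> p \<Longrightarrow> a / s \<in> loc p"
  by (auto simp: loc_def)

lemma loc_cases: assumes "z \<in> loc p" obtains a s where "z = a / s" "a \<in> RD" "s \<in> RD" "s \<notin> p"
  using assms by (auto simp: loc_def)

text \<open>Invertibility of the ideal \<open>(a, b)\<close> makes the localization a valuation ring.\<close>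

lemma loc_valuation:
  assumes p: "prime_ideal p" and ab: "a \<in> RD" "b \<in> RD" "a \<noteq> 0" "b \<noteq> 0"
  shows "a / b \<in> loc p \<or> b / a \<in> loc p"
proof -
  note pI = prime_ideal_ideal[OF p]
  let ?J = "isum (prin b) a"
  have J: "ideal ?J" "prin b \<subseteq> ?J" "a \<in> ?J" using ideal_isum[OF ideal_prin[OF ab(2,4)] ab(1)] by auto
  have bJ: "b \<in> ?J" using J(2) prin_subset_iff[OF J(1)] by simp
  obtain L where L: "ideal L" "imul ?J L = prin b" using ideal_divides[OF ideal_prin[OF ab(2,4)] J(1,2)] by blast
  have bp: "0 \<in> (*) b ` p" "\<And>x z. x \<in> (*) b ` p \<Longrightarrow> z \<in> (*) b ` p \<Longrightarrow> x + z \<in> (*) b ` p"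
    using ideal_0[OF pI] ideal_add[OF pI] by (auto simp flip: distrib_left)
  have "\<exists>k\<in>L. a * k \<notin> (*) b ` p \<or> b * k \<notin> (*) b ` p"
  proof (rule ccontr)
    assume "\<not> (\<exists>k\<in>L. a * k \<notin> (*) b ` p \<or> b * k \<notin> (*) b ` p)"
    then have all: "\<And>k. k \<in> L \<Longrightarrow> a * k \<in> (*) b ` p \<and> b * k \<in> (*) b ` p" by blast
    have "imul ?J L \<subseteq> (*) b ` p"
    proof (rule imul_leI[OF bp])
      fix x k assume "x \<in> ?J" "k \<in> L"
      then obtain r t where x: "x = b * r + a * t" "r \<in> RD" "t \<in> RD" by (auto simp: isum_def prin_def)
      have "x * k = b * (r * k) + a * (t * k)" by (simp add: x algebra_simps)
      moreover have "r * k \<in> L" "t * k \<in> L" using ideal_mult[OF L(1) \<open>k \<in> L\<close>] x by auto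
      ultimately show "x * k \<in> (*) b ` p" using all bp(2) by simp
    qed
    moreover have "b \<in> prin b" using RD_1 by (force simp: prin_def)
    ultimately have "b \<in> (*) b ` p" using L(2) by blast
    then have "1 \<in> p" using ab(4) by auto
    then show False using prime_ideal_not_1[OF p] by simp
  qed
  then obtain k where k: "k \<in> L" "a * k \<notin> (*) b ` p \<or> b * k \<notin> (*) b ` p" by blast
  have kR: "k \<in> RD" using k(1) ideal_subset[OF L(1)] by blast
  have "a * k \<in> prin b" using imulI[OF J(3) k(1)] L(2) by simp
  then obtain c where c: "a * k = b * c" "c \<in> RD" by (auto simp: prin_def)
  have ck: "c \<notin> p \<or> k \<notin> p" using k(2) c(1) by auto
  then have "k \<noteq> 0" using c ab ideal_0[OF pI] by auto
  have "c \<noteq> 0" using c(1) ab(3) \<open>k \<noteq> 0\<close> by auto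
  have "a / b = c / k" "b / a = k / c" using c(1) ab \<open>k \<noteq> 0\<close> \<open>c \<noteq> 0\<close> by (simp_all add: field_simps)
  then show ?thesis using ck locI[of c k p] locI[of k c p] c kR by auto
qed

lemma RD_subset_loc: assumes "prime_ideal p" shows "RD \<subseteq> loc p"
  using locI[of _ 1 p] prime_ideal_not_1[OF assms] by force

lemma mx_loc_iff: assumes p: "prime_ideal p" and "a \<in> RD" "s \<in> RD" "s \<notin> p" shows "a / s \<in> mx (loc p) \<longleftrightarrow> a \<in> p"
proof -
  note pI = prime_ideal_ideal[OF p]
  have s0: "s \<noteq> 0" using assms(4) ideal_0[OF pI] by auto
  show ?thesis
  proof (cases "a = 0")
    case True
    then show ?thesis using ideal_0[OF pI] locI[OF assms(2-4)] by (simp add: K.mx_def)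
  next
    case False
    have "inverse (a / s) \<in> loc p \<longleftrightarrow> a \<notin> p"
    proof
      assume "inverse (a / s) \<in> loc p"
      then obtain c r where cr: "s / a = c / r" "c \<in> RD" "r \<in> RD" "r \<notin> p" by (auto elim!: loc_cases)
      then have "r \<noteq> 0" using ideal_0[OF pI] by auto
      then have e: "s * r = c * a" using cr(1) False by (simp add: field_simps)
      show "a \<notin> p"
      proof
        assume "a \<in> p"
        then have "s * r \<in> p" using e ideal_mult[OF pI _ cr(2)] by simp
        then show False using prime_ideal_prime[OF p assms(3) cr(3)] assms(4) cr(4) by blast
      qed
    next
      assume "a \<notin> p"
      then show "inverse (a / s) \<in> loc p" using locI[OF assms(3,2)] by simp
    qed
    then show ?thesis using False s0 locI[OF assms(2-4)] by (simp add: K.mx_def)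
  qed
qed

lemma mx_loc_Int: assumes "prime_ideal p" shows "mx (loc p) \<inter> RD = p"
  using mx_loc_iff[OF assms _ RD_1 prime_ideal_not_1[OF assms]] ideal_subset[OF prime_ideal_ideal[OF assms]] by auto

lemma kk_subset_RD: "kk \<subseteq> RD"
  by (auto simp: kk_def)

lemma is_place_loc: assumes p: "prime_ideal p" shows "is_pl (loc p)"
  unfolding K.is_place_def
proof (intro conjI ballI impI)
  note pI = prime_ideal_ideal[OF p]
  show "loc p \<subseteq> KK" using quotient_KK by (auto elim!: loc_cases)
  show "kk \<subseteq> loc p" using kk_subset_RD RD_subset_loc[OF p] by blast
  show "1 \<in> loc p" "- 1 \<in> loc p" using RD_subset_loc[OF p] RD_minus[OF RD_1] by auto
  show "loc p \<noteq> KK"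
  proof
    assume e: "loc p = KK"
    obtain x where x: "x \<in> p" "x \<noteq> 0" using ideal_nonzero[OF pI] by blast
    then have "x \<in> mx (loc p)" using mx_loc_Int[OF p] by blast
    moreover have "x \<in> KK" using x ideal_subset[OF pI] RD_subset_KK by blast
    then have "inverse x \<in> loc p" unfolding e by (rule K.inverse_C)
    ultimately show False using x by (simp add: K.mx_def)
  qed
next
  note pI = prime_ideal_ideal[OF p]
  fix x z assume "x \<in> loc p" "z \<in> loc p"
  then obtain a s b r where *: "x = a / s" "a \<in> RD" "s \<in> RD" "s \<notin> p" "z = b / r" "b \<in> RD" "r \<in> RD" "r \<notin> p"
    by (metis loc_cases)
  have nz: "s \<noteq> 0" "r \<noteq> 0" using * ideal_0[OF pI] by auto
  have sr: "s * r \<in> RD" "s * r \<notin> p" using * prime_ideal_prime[OF p] RD_mult by auto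
  have "x + z = (a * r + b * s) / (s * r)" using * nz by (simp add: field_simps)
  then show "x + z \<in> loc p" using * sr locI[of "a * r + b * s" "s * r" p] by (simp add: RD_add RD_mult)
  have "x * z = (a * b) / (s * r)" using * by simp
  then show "x * z \<in> loc p" using * sr locI[of "a * b" "s * r" p] by (simp add: RD_mult)
next
  fix z assume z: "z \<in> KK" "z \<noteq> 0"
  then obtain x s where "z = x / emb s" "x \<in> RD" "s \<noteq> 0" by (auto elim: KK_cases)
  then show "z \<in> loc p \<or> inverse z \<in> loc p" using loc_valuation[OF p, of x "emb s"] z by auto
qed

text \<open>Denominators outside \<open>p\<close> are invertible modulo \<open>p\<close>, so
  representatives of \<open>RD\<close> modulo \<open>p\<close> also represent the residue field of
  the localization.\<close>

lemma place_norm_loc: assumes p: "prime_ideal p" shows "place_norm (field_ring KK) (loc p) = CARD('f) ^ ideg p"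
proof -
  note pI = prime_ideal_ideal[OF p]
  obtain R where R: "R \<subseteq> RD" "finite R" "card R = CARD('f) ^ ideg p" "\<And>x. x \<in> RD \<Longrightarrow> \<exists>r\<in>R. x - r \<in> p"
    "\<And>r r'. r \<in> R \<Longrightarrow> r' \<in> R \<Longrightarrow> r - r' \<in> p \<Longrightarrow> r = r'"
    using ideal_reps[OF pI] by blast
  have "place_norm (field_ring KK) (loc p) = card R"
  proof (rule K.place_norm_eq[OF is_place_loc[OF p]])
    show "R \<subseteq> loc p" using R(1) RD_subset_loc[OF p] by blast
  next
    fix x assume "x \<in> loc p"
    then obtain a s where x: "x = a / s" "a \<in> RD" "s \<in> RD" "s \<notin> p" by (rule loc_cases)
    have s0: "s \<noteq> 0" using x ideal_0[OF pI] by auto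
    obtain s' where s': "s' \<in> RD" "s * s' - 1 \<in> p" using prime_ideal_inverse[OF p x(3,4)] .
    obtain r where r: "r \<in> R" "a * s' - r \<in> p" using R(4)[OF RD_mult[OF x(2) s'(1)]] by blast
    have rR: "r \<in> RD" using r R by blast
    have "a - r * s = s * (a * s' - r) - a * (s * s' - 1)" by (simp add: algebra_simps)
    then have "a - r * s \<in> p" using ideal_diff[OF pI ideal_mult[OF pI r(2) x(3)] ideal_mult[OF pI s'(2) x(2)]] by simp
    then have "(a - r * s) / s \<in> mx (loc p)" using mx_loc_iff[OF p _ x(3,4), of "a - r * s"] ideal_subset[OF pI] by blast
    moreover have "(a - r * s) / s = x - r" using s0 x by (simp add: field_simps)
    ultimately show "\<exists>r\<in>R. x - r \<in> mx (loc p)" using r by auto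
  next
    fix r r' assume rr: "r \<in> R" "r' \<in> R" "r - r' \<in> mx (loc p)"
    then have "r - r' \<in> RD" using R(1) RD_diff by blast
    then have "r - r' \<in> p" using rr(3) mx_loc_Int[OF p] by blast
    then show "r = r'" using R(5) rr by blast
  qed
  then show ?thesis using R(3) by simp
qed

lemma emb_eq_poly: "emb a \<in> V" if "is_pl V" "emb [:0, 1:] \<in> V"
proof (induction a)
  case (pCons c a)
  have "pCons c a = [:c:] + [:0, 1:] * a" by simp
  then have "emb (pCons c a) = emb [:c:] + emb [:0, 1:] * emb a" by (metis emb_add emb_mult)
  moreover have "emb [:c:] \<in> V" using K.place_const[OF that(1)] by (auto simp: kk_def)
  ultimately show ?case using K.place_add[OF that(1)] K.place_mult[OF that(1) that(2) pCons(2)] by simp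
qed (use K.place_0[OF that(1)] in simp)

text \<open>\<open>V\<close> contains \<open>RD\<close> by integral closedness, and its centre
  \<open>mx V \<inter> RD\<close> is nonzero, as otherwise every fraction would lie in
  \<open>V\<close>. The localization at the centre is a valuation ring inside \<open>V\<close>. An
  element of \<open>V\<close> outside it would be \<open>s / a\<close> with \<open>a\<close> in the
  centre and \<open>s\<close> not, contradicting \<open>s = (s / a) * a\<close>.\<close>

lemma finite_place_is_loc:
  assumes V: "is_pl V" and t: "emb [:0, 1:] \<in> V"
  obtains p where "prime_ideal p" "V = loc p"
proof -
  have emb: "emb a \<in> V" for a by (rule emb_eq_poly[OF V t])
  have "el 0 1 * el 0 1 = 0 * el 0 1 + emb D" by (simp add: el_mult el_emb)
  then have yV: "el 0 1 \<in> V"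
    using RD_subset_KK by (intro K.place_quadratic[OF V _ K.place_0[OF V] emb]) auto
  have RV: "x \<in> V" if x: "x \<in> RD" for x
  proof -
    from x obtain a b where "x = el a b" by (rule RD_cases)
    then have "x = emb a + emb b * el 0 1" by (simp add: el_def)
    then show ?thesis using K.place_add[OF V emb K.place_mult[OF V emb yV]] by simp
  qed
  let ?p = "mx V \<inter> RD"
  have "\<exists>x\<in>?p. x \<noteq> 0"
  proof (rule ccontr)
    assume none: "\<not> (\<exists>x\<in>?p. x \<noteq> 0)"
    have "z \<in> V" if "z \<in> KK" for z
    proof -
      from that obtain x s where z: "z = x / emb s" "x \<in> RD" "s \<noteq> 0" by (rule KK_cases)
      have "emb s \<noteq> 0" using z(3) by simp
      then have "emb s \<notin> mx V" using none emb_in_RD by blast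
      then have "inverse (emb s) \<in> V" using emb[of s] z(3) by (simp add: K.mx_def)
      then show ?thesis using K.place_mult[OF V RV[OF z(2)]] z(1) by (simp add: divide_inverse)
    qed
    then show False using K.place_subset[OF V] K.place_proper[OF V] by blast
  qed
  then have pI: "ideal ?p"
    using K.mx_add[OF V] K.mx_mult[OF V] RV by (auto simp: ideal_def RD_add RD_mult)
  have inv: "inverse s \<in> V" if "s \<in> RD" "s \<notin> ?p" for s
    using that RV[OF that(1)] by (auto simp: K.mx_def)
  have p: "prime_ideal ?p" unfolding prime_ideal_def
  proof (intro conjI ballI impI)
    show "?p \<noteq> RD" using K.one_not_mx[OF V] RD_1 by blast
    fix a b assume ab: "a \<in> RD" "b \<in> RD" "a * b \<in> ?p"
    show "a \<in> ?p \<or> b \<in> ?p"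
    proof (rule disjCI)
      assume b: "b \<notin> ?p"
      then have "b \<noteq> 0" using ideal_0[OF pI] by auto
      have "inverse b * (a * b) \<in> mx V" using K.mx_mult[OF V _ inv[OF ab(2) b]] ab(3) by blast
      moreover have "inverse b * (a * b) = a" using \<open>b \<noteq> 0\<close> by (simp add: field_simps)
      ultimately show "a \<in> ?p" using ab(1) by simp
    qed
  qed (rule pI)
  have "loc ?p \<subseteq> V"
  proof
    fix z assume "z \<in> loc ?p"
    then obtain a s where z: "z = a / s" "a \<in> RD" "s \<in> RD" "s \<notin> ?p" by (rule loc_cases)
    then show "z \<in> V" using K.place_mult[OF V RV[OF z(2)] inv[OF z(3,4)]] by (simp add: divide_inverse)
  qed
  moreover have "V \<subseteq> loc ?p"
  proof
    fix v assume v: "v \<in> V"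
    show "v \<in> loc ?p"
    proof (rule ccontr)
      assume nv: "v \<notin> loc ?p"
      then have v0: "v \<noteq> 0" using RD_subset_loc[OF p] RD_0 by blast
      then have "inverse v \<in> loc ?p"
        using K.place_inverse[OF is_place_loc[OF p]] v nv K.place_subset[OF V] by blast
      then obtain a s where as: "inverse v = a / s" "a \<in> RD" "s \<in> RD" "s \<notin> ?p" by (rule loc_cases)
      have a0: "a \<noteq> 0" using as(1) v0 by auto
      have v_eq: "v = s / a" using as(1) by (metis inverse_divide inverse_inverse_eq)
      have "a \<in> ?p" using nv locI[OF as(3,2), of ?p] v_eq by blast
      then have "v * a \<in> mx V" using K.mx_mult[OF V _ v] by blast
      then show False using v_eq a0 as by simp
    qed
  qed
  ultimately show thesis using that[OF p] by blast
qed

lemma loc_inject: assumes "prime_ideal p" "prime_ideal p'" "loc p = loc p'" shows "p = p'"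
  using mx_loc_Int[OF assms(1)] mx_loc_Int[OF assms(2)] assms(3) by metis

lemma emb_in_loc: "prime_ideal p \<Longrightarrow> emb a \<in> loc p"
  using RD_subset_loc emb_in_RD by blast

section \<open>The infinite place\<close>

definition Vinf :: "'o set" where
  "Vinf = {x / emb s | x s. s \<noteq> 0 \<and> x \<in> LS (2 * degree s + 1)}"

lemma LS_mult:
  assumes "x \<in> LS (Suc a)" "z \<in> LS (Suc b)" shows "x * z \<in> LS (Suc (a + b))"
proof -
  have "x \<in> RD" "z \<in> RD" "x = 0 \<or> dg x \<le> a" "z = 0 \<or> dg z \<le> b" using assms by (auto simp: LS_def)
  then show ?thesis using dg_mult[of x z] RD_mult by (cases "x = 0 \<or> z = 0") (auto simp: LS_def)
qed

lemma LS_cancel: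
  assumes "x \<in> RD" "z \<in> RD" "z \<noteq> 0" "x * z \<in> LS (Suc (a + dg z))" shows "x \<in> LS (Suc a)"
  using assms dg_mult[of x z] by (cases "x = 0") (auto simp: LS_def)

lemma emb_in_LS: "emb s \<in> LS (Suc (2 * degree s))"
  by (simp add: LS_def dg_emb)

lemma Vinf_cases: assumes "z \<in> Vinf" obtains x s where "z = x / emb s" "s \<noteq> 0" "x \<in> LS (Suc (2 * degree s))"
  using assms by (auto simp: Vinf_def)

lemma VinfI: "s \<noteq> 0 \<Longrightarrow> x \<in> LS (Suc (2 * degree s)) \<Longrightarrow> x / emb s \<in> Vinf"
  by (auto simp: Vinf_def)

text \<open>Membership does not depend on the chosen fraction: cross-multiplication compares pole
  orders, and \<open>emb s\<close> has order \<open>2 * degree s\<close>.\<close>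

lemma in_Vinf_iff:
  assumes "x \<in> RD" "s \<noteq> 0" shows "x / emb s \<in> Vinf \<longleftrightarrow> x \<in> LS (Suc (2 * degree s))"
proof
  assume "x / emb s \<in> Vinf"
  then obtain a r where *: "x / emb s = a / emb r" "r \<noteq> 0" "a \<in> LS (Suc (2 * degree r))" by (rule Vinf_cases)
  then have "x * emb r = a * emb s" using assms by (simp add: field_simps)
  also have "\<dots> \<in> LS (Suc (2 * degree r + 2 * degree s))" by (intro LS_mult * emb_in_LS)
  finally show "x \<in> LS (Suc (2 * degree s))"
    using assms *(2) by (intro LS_cancel[of x "emb r"]) (auto simp: dg_emb add.commute)
qed (use assms VinfI in auto)

lemma quotient_in_Vinf:
  assumes "x \<in> RD" "z \<in> RD" "z \<noteq> 0" "x \<in> LS (Suc (dg z))" shows "x / z \<in> Vinf"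
proof -
  have "x / z = (x * cj z) / emb (nm z)"
    using inverse_RD[OF assms(2,3)] by (simp add: divide_inverse)
  moreover have "dg (cj z) = dg z" using assms(2) by (auto simp: dg_def nm_el elim!: RD_cases)
  then have "cj z \<in> LS (Suc (dg z))" by (simp add: LS_def)
  then have "x * cj z \<in> LS (Suc (2 * degree (nm z)))"
    using LS_mult[OF assms(4)] by (simp add: dg_def mult_2)
  ultimately show ?thesis using VinfI[of "nm z" "x * cj z"] assms by (simp add: nm_eq_0_iff)
qed

lemma is_place_Vinf: "is_pl Vinf"
  unfolding K.is_place_def
proof (intro conjI ballI impI)
  show "Vinf \<subseteq> KK" using KKI by (auto elim!: Vinf_cases simp: LS_def)
  show kV: "kk \<subseteq> Vinf" using VinfI[of 1] emb_in_LS[of "[:a:]" for a] by (fastforce simp: kk_def)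
  have "emb [:1:] = 1" using emb_1 by (simp only: one_pCons)
  moreover from this have "emb [:- 1:] = - 1" using emb_minus[of "[:1:]"] by simp
  ultimately show "1 \<in> Vinf" "- 1 \<in> Vinf" using kV unfolding kk_def by (metis rangeI subsetD)+
  have "emb [:0, 1:] / emb 1 \<notin> Vinf" by (subst in_Vinf_iff) (auto simp: LS_def dg_emb)
  moreover have "emb [:0, 1:] / emb 1 \<in> KK" by (intro KKI) auto
  ultimately show "Vinf \<noteq> KK" by blast
next
  fix x z assume "x \<in> Vinf" "z \<in> Vinf"
  then obtain a s b r where *: "x = a / emb s" "s \<noteq> 0" "a \<in> LS (Suc (2 * degree s))"
    "z = b / emb r" "r \<noteq> 0" "b \<in> LS (Suc (2 * degree r))" by (metis Vinf_cases)
  have d: "2 * degree (s * r) = 2 * degree s + 2 * degree r" using * by (simp add: degree_mult_eq)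
  have "a * emb r \<in> LS (Suc (2 * degree (s * r)))" "b * emb s \<in> LS (Suc (2 * degree (s * r)))"
    unfolding d using LS_mult[OF *(3) emb_in_LS[of r]] LS_mult[OF *(6) emb_in_LS[of s]] by (simp_all add: add.commute)
  then have "(a * emb r + b * emb s) / emb (s * r) \<in> Vinf" using * LS_add by (intro VinfI) auto
  also have "(a * emb r + b * emb s) / emb (s * r) = x + z" using * by (simp add: emb_mult field_simps)
  finally show "x + z \<in> Vinf" .
  have "a * b \<in> LS (Suc (2 * degree (s * r)))" unfolding d by (rule LS_mult[OF *(3,6)])
  then have "(a * b) / emb (s * r) \<in> Vinf" using * by (intro VinfI) auto
  also have "(a * b) / emb (s * r) = x * z" using * by (simp add: emb_mult)
  finally show "x * z \<in> Vinf" .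
next
  fix z assume z: "z \<in> KK" "z \<noteq> 0"
  then obtain x s where xs: "z = x / emb s" "x \<in> RD" "s \<noteq> 0" by (auto elim: KK_cases)
  show "z \<in> Vinf \<or> inverse z \<in> Vinf"
  proof (cases "dg x \<le> 2 * degree s")
    case True
    then show ?thesis using xs by (auto simp: in_Vinf_iff LS_def)
  next
    case False
    then have "emb s \<in> LS (Suc (dg x))" by (simp add: LS_def dg_emb)
    then have "emb s / x \<in> Vinf" using xs z by (intro quotient_in_Vinf) auto
    then show ?thesis using xs by simp
  qed
qed

lemma mx_Vinf_iff:
  assumes "x \<in> RD" "s \<noteq> 0" shows "x / emb s \<in> mx Vinf \<longleftrightarrow> x \<in> LS (2 * degree s)"
proof (cases "x = 0")
  case True
  then show ?thesis using K.mx_zero[OF is_place_Vinf] by (simp add: LS_def)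
next
  case False
  have "inverse (x / emb s) \<in> Vinf \<longleftrightarrow> 2 * degree s \<le> dg x"
  proof
    assume "inverse (x / emb s) \<in> Vinf"
    then have "emb s * inverse x \<in> Vinf" by (simp add: divide_inverse mult.commute)
    then have "(emb s * cj x) / emb (nm x) \<in> Vinf" using inverse_RD[OF assms(1) False] by simp
    then have "emb s * cj x \<in> LS (Suc (2 * degree (nm x)))"
      using assms False by (subst (asm) in_Vinf_iff) (auto simp: nm_eq_0_iff RD_mult)
    moreover have "dg (cj x) = dg x" using assms(1) by (auto simp: dg_def nm_el elim!: RD_cases)
    moreover have "cj x \<noteq> 0" by (rule cj_nonzero[OF assms(1) False])
    ultimately show "2 * degree s \<le> dg x" using assms by (simp add: LS_def dg_mult dg_emb) (simp add: dg_def)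
  next
    assume "2 * degree s \<le> dg x"
    then have "emb s / x \<in> Vinf" using assms False by (intro quotient_in_Vinf) (auto simp: LS_def dg_emb)
    then show "inverse (x / emb s) \<in> Vinf" by simp
  qed
  then show ?thesis using False assms by (auto simp: K.mx_def in_Vinf_iff LS_def)
qed

lemma lco_emb: "lco (2 * degree s) (emb s) = lead_coeff s"
  by (simp add: lco_def flip: el_emb)

text \<open>The quotient of the coefficients at order \<open>2 * degree s\<close> is the residue;
  subtracting it lowers the order. So the infinite place has degree one.\<close>

lemma residue_const: assumes "z \<in> Vinf" shows "\<exists>r\<in>kk. z - r \<in> mx Vinf"
proof -
  from assms obtain x s where z: "z = x / emb s" "s \<noteq> 0" "x \<in> LS (Suc (2 * degree s))" by (rule Vinf_cases)
  then have xR: "x \<in> RD" by (simp add: LS_def)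
  let ?k = "lco (2 * degree s) x / lead_coeff s"
  let ?w = "emb [:- ?k:] * emb s + x"
  have "emb [:- ?k:] * emb s = emb ([:- ?k:] * s)" by (simp only: emb_mult)
  moreover have "degree ([:- ?k:] * s) \<le> degree s" by simp
  then have "emb ([:- ?k:] * s) \<in> LS (Suc (2 * degree s))" using emb_in_LS[of "[:- ?k:] * s"] LS_mono
    by (meson Suc_le_mono mult_le_mono2 subsetD)
  ultimately have w: "?w \<in> LS (Suc (2 * degree s))" using z(3) LS_add by simp
  have "lco (2 * degree s) ?w = - ?k * lead_coeff s + lco (2 * degree s) x"
    using lco_linear[OF emb_in_RD xR] lco_emb by simp
  then have "lco (2 * degree s) ?w = 0" using z(2) by simp
  then have "?w \<in> LS (2 * degree s)" using LS_Suc_iff[OF w] by simp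
  then have "?w / emb s \<in> mx Vinf" using w z(2) by (subst mx_Vinf_iff) (auto simp: LS_def)
  moreover have "emb [:- ?k:] = - emb [:?k:]" using emb_minus[of "[:?k:]"] by simp
  then have "?w / emb s = z - emb [:?k:]" using z by (simp add: field_simps)
  ultimately show ?thesis unfolding kk_def by (intro bexI[of _ "emb [:?k:]"]) auto
qed

lemma place_norm_Vinf: "place_norm (field_ring KK) Vinf = CARD('f)"
proof -
  have "place_norm (field_ring KK) Vinf = card kk"
  proof (rule K.place_norm_eq[OF is_place_Vinf])
    show "kk \<subseteq> Vinf" by (rule K.place_const[OF is_place_Vinf])
  next
    show "\<exists>r\<in>kk. z - r \<in> mx Vinf" if "z \<in> Vinf" for z by (rule residue_const[OF that])
  next
    fix r r' assume "r \<in> kk" "r' \<in> kk" "r - r' \<in> mx Vinf"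
    then obtain a b where ab: "r = emb [:a:]" "r' = emb [:b:]" by (auto simp: kk_def)
    then have "r - r' = emb [:a - b:] / emb 1" using emb_diff[of "[:a:]" "[:b:]"] by simp
    then have "emb [:a - b:] \<in> LS 0" using \<open>r - r' \<in> mx Vinf\<close> by (simp add: mx_Vinf_iff del: emb_1)
    then show "r = r'" using ab by (simp add: LS_def)
  qed
  also have "card kk = card (UNIV :: 'f set)" unfolding kk_def by (rule card_image) (auto simp: inj_on_def)
  finally show ?thesis .
qed

lemma t_not_in_Vinf: "emb [:0, 1:] \<notin> Vinf"
proof -
  have "emb [:0, 1:] / emb 1 \<notin> Vinf" by (subst in_Vinf_iff) (auto simp: LS_def dg_emb)
  then show ?thesis by simp
qed

text \<open>Since \<open>1 / t\<close> is in the maximal ideal, \<open>V\<close> contains all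
  fractions \<open>a / s\<close> of polynomials with \<open>degree a \<le> degree s\<close>. Trace
  and norm of an element of \<open>Vinf\<close> are of this kind, so the element is integral over
  \<open>V\<close>. Conversely, an element of \<open>V\<close> outside \<open>Vinf\<close> would
  force \<open>t\<close> into \<open>V\<close>.\<close>

lemma infinite_place_is_Vinf:
  assumes V: "is_pl V" and t: "emb [:0, 1:] \<notin> V"
  shows "V = Vinf"
proof -
  define t where "t = emb [:0, 1:]"
  have t0: "t \<noteq> 0" by (simp add: t_def)
  have tK: "t \<in> KK" using RD_subset_KK by (auto simp: t_def)
  have ti: "inverse t \<in> V" using K.place_inverse[OF V tK t0] t by (simp add: t_def)
  then have tm: "inverse t \<in> mx V" using t by (simp add: K.mx_def t_def)
  have cV: "emb [:c:] \<in> V" for c using K.place_const[OF V] by (auto simp: kk_def)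
  have step: "emb (pCons c s) * inverse t ^ Suc n = inverse t ^ Suc n * emb [:c:] + emb s * inverse t ^ n" for c s n
  proof -
    have "emb (pCons c s) = emb ([:c:] + [:0, 1:] * s)" by simp
    also have "\<dots> = emb [:c:] + t * emb s" by (simp only: emb_add emb_mult t_def)
    finally have "emb (pCons c s) * inverse t ^ Suc n = inverse t ^ Suc n * emb [:c:] + (t * inverse t) * emb s * inverse t ^ n"
      by (simp add: algebra_simps)
    then show ?thesis using t0 by simp
  qed
  have pow: "inverse t ^ n \<in> V" for n
    by (induction n) (use K.place_1[OF V] K.place_mult[OF V ti] in auto)
  have powm: "inverse t ^ Suc n \<in> mx V" for n
    using K.mx_mult[OF V tm pow[of n]] by (simp add: mult.commute)
  have small: "emb s * inverse t ^ n \<in> V" if "s \<in> below (Suc n)" for s n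
    using that
  proof (induction n arbitrary: s)
    case 0
    then obtain c where "s = [:c:]" by (auto simp: below_Suc)
    then show ?case using cV by simp
  next
    case (Suc n)
    then obtain c r where s: "s = pCons c r" "r \<in> below (Suc n)" by (auto simp: below_Suc[of "Suc n"])
    show ?case unfolding s(1) step
      by (rule K.place_add[OF V K.place_mult[OF V pow cV] Suc.IH[OF s(2)]])
  qed
  have smallm: "emb s * inverse t ^ n \<in> mx V" if "s \<in> below n" for s n
  proof (cases n)
    case 0 then show ?thesis using that K.mx_zero[OF V] by simp
  next
    case (Suc k)
    have "emb s * inverse t ^ n = (emb s * inverse t ^ k) * inverse t" by (simp add: Suc mult_ac)
    moreover have "(emb s * inverse t ^ k) * inverse t \<in> mx V"
      by (rule K.mx_mult[OF V tm small]) (use that Suc in simp)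
    ultimately show ?thesis by metis
  qed
  \<comment> \<open>Modulo the maximal ideal \<open>s / t ^ degree s\<close> is the leading
    coefficient of \<open>s\<close>, a nonzero constant.\<close>
  have unit: "inverse (emb s * inverse t ^ degree s) \<in> V" if "s \<noteq> 0" for s
  proof -
    let ?c = "lead_coeff s" and ?n = "degree s"
    let ?u = "emb s * inverse t ^ ?n"
    have "?u \<notin> mx V"
    proof
      assume u: "?u \<in> mx V"
      have "monom ?c ?n \<in> below (Suc ?n)" "s \<in> below (Suc ?n)" using that by (auto simp: below_def degree_monom_eq)
      then have "s - monom ?c ?n \<in> below (Suc ?n)" by (rule below_diff[rotated])
      then have "s - monom ?c ?n \<in> below ?n" using below_Suc_iff by simp
      then have "emb (s - monom ?c ?n) * inverse t ^ ?n \<in> mx V" by (rule smallm)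
      then have "?u - emb (s - monom ?c ?n) * inverse t ^ ?n \<in> mx V" by (rule K.mx_diff[OF V u])
      also have "?u - emb (s - monom ?c ?n) * inverse t ^ ?n = emb (monom ?c ?n) * inverse t ^ ?n"
        by (simp add: emb_diff algebra_simps)
      also have "monom ?c ?n = [:?c:] * [:0, 1:] ^ ?n" by (simp add: monom_altdef)
      also have "emb ([:?c:] * [:0, 1:] ^ ?n) = emb [:?c:] * t ^ ?n"
      proof -
        have "emb ([:0, 1:] ^ n) = t ^ n" for n
          by (induction n) (simp, simp only: power_Suc emb_mult t_def)
        then show ?thesis by (simp only: emb_mult)
      qed
      also have "emb [:?c:] * t ^ ?n * inverse t ^ ?n = emb [:?c:]" using t0 by (simp add: power_inverse)
      finally have m: "emb [:?c:] \<in> mx V" .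
      have "emb [:inverse ?c:] * emb [:?c:] = 1" using that by (simp flip: emb_mult one_pCons)
      then have "1 \<in> mx V" using K.mx_mult[OF V m cV[of "inverse ?c"]] by simp
      then show False using K.one_not_mx[OF V] by simp
    qed
    moreover have "?u \<in> V" using small[of s ?n] by (simp add: below_def)
    ultimately show ?thesis by (simp add: K.mx_def)
  qed
  have rat: "emb a / emb s \<in> V" if "s \<noteq> 0" "a = 0 \<or> degree a \<le> degree s" for a s
  proof -
    have "a \<in> below (Suc (degree s))" using that by (auto simp: below_def)
    then have "(emb a * inverse t ^ degree s) * inverse (emb s * inverse t ^ degree s) \<in> V"
      using K.place_mult[OF V small unit[OF that(1)]] by blast
    moreover have "(emb a * inverse t ^ degree s) * inverse (emb s * inverse t ^ degree s) = emb a / emb s"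
      using t0 by (simp add: field_simps)
    ultimately show ?thesis by simp
  qed
  have sub: "Vinf \<subseteq> V"
  proof
    fix z assume zV: "z \<in> Vinf"
    then obtain x s where z: "z = x / emb s" "s \<noteq> 0" "x \<in> LS (Suc (2 * degree s))" by (rule Vinf_cases)
    obtain a b where x: "x = el a b" using z(3) by (auto simp: LS_def elim: RD_cases)
    have "a \<in> below (Suc (degree s))" using z(3) unfolding x by (simp add: el_in_LS_iff)
    then have "emb a / emb s \<in> V" using z(2) by (intro rat) (auto simp: below_def)
    then have A: "emb a / emb s + emb a / emb s \<in> V" using K.place_add[OF V] by blast
    have "nm x = 0 \<or> degree (nm x) \<le> degree (s * s)"
      using z(3) by (auto simp: LS_def dg_def degree_square nm_eq_0_iff)
    then have "emb (nm x) / emb (s * s) \<in> V" using z(2) by (intro rat) auto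
    then have B: "- (emb (nm x) / emb (s * s)) \<in> V" by (rule K.place_minus[OF V])
    have "x + cj x = emb a + emb a" by (simp add: x el_add flip: el_emb)
    then have "cj x = (emb a + emb a) - x" by (simp add: algebra_simps)
    then have "x * ((emb a + emb a) - x) = emb (nm x)" using mult_cj[of x] x by simp
    then have xx: "x * x = (emb a + emb a) * x - emb (nm x)" by (simp add: algebra_simps)
    have "z * z = (x * x) / emb (s * s)" by (simp add: z(1) emb_mult)
    also have "\<dots> = (emb a / emb s + emb a / emb s) * z + - (emb (nm x) / emb (s * s))"
      using z(2) unfolding xx by (simp add: z(1) emb_mult field_simps)
    finally show "z \<in> V" using K.place_quadratic[OF V _ A B] zV K.place_subset[OF is_place_Vinf] by blast
  qed
  moreover have "V \<subseteq> Vinf"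
  proof
    fix v assume v: "v \<in> V"
    then have "v \<in> KK" using K.place_subset[OF V] by blast
    then obtain x s where xs: "v = x / emb s" "x \<in> RD" "s \<noteq> 0" by (rule KK_cases)
    show "v \<in> Vinf"
    proof (rule ccontr)
      assume "v \<notin> Vinf"
      then have d: "x \<noteq> 0" "2 * degree s < dg x" using xs by (auto simp: in_Vinf_iff LS_def)
      \<comment> \<open>A pole of \<open>v\<close> has order at least one, hence
        \<open>v * v\<close> has a pole of order at least two, which is the order of
        \<open>t\<close>: the place is ramified.\<close>
      have "emb ([:0, 1:] * (s * s)) / (x * x) \<in> Vinf"
        using d xs by (intro quotient_in_Vinf)
          (auto simp: RD_mult LS_def dg_emb dg_mult degree_mult_eq degree_square simp del: mult_pCons_left)
      then have "v * v * (emb ([:0, 1:] * (s * s)) / (x * x)) \<in> V"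
        using sub K.place_mult[OF V] v by blast
      moreover have "v * v * (emb ([:0, 1:] * (s * s)) / (x * x)) = t"
        using d xs by (simp add: emb_mult t_def del: mult_pCons_left)
      ultimately show False using t by (simp add: t_def)
    qed
  qed
  ultimately show ?thesis by blast
qed

lemma places_eq: "places (field_ring KK) kk = insert Vinf (loc ` {p. prime_ideal p})"
proof
  show "places (field_ring KK) kk \<subseteq> insert Vinf (loc ` {p. prime_ideal p})"
  proof
    fix V assume "V \<in> places (field_ring KK) kk"
    then have V: "is_pl V" by (simp add: K.places_iff)
    show "V \<in> insert Vinf (loc ` {p. prime_ideal p})"
    proof (cases "emb [:0, 1:] \<in> V")
      case True
      then obtain p where "prime_ideal p" "V = loc p" using finite_place_is_loc[OF V] by metis
      then show ?thesis by blast
    next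
      case False
      then show ?thesis using infinite_place_is_Vinf[OF V] by blast
    qed
  qed
qed (auto simp: K.places_iff is_place_Vinf is_place_loc)

lemma Vinf_not_loc: "prime_ideal p \<Longrightarrow> Vinf \<noteq> loc p"
  using t_not_in_Vinf emb_in_loc by blast

end

section \<open>Unique factorization of ideals\<close>

text \<open>The ideal product over a multiset, with the unit ideal \<open>R\<close> as the value on
  the empty one.\<close>

definition fprod :: "'a::comm_ring_1 set \<Rightarrow> 'a set multiset \<Rightarrow> 'a set" where
  "fprod R A = fold_mset imul R A"

lemma comp_fun_commute_imul: "comp_fun_commute (imul :: 'a::comm_ring_1 set \<Rightarrow> _)"
  by standard (auto simp: fun_eq_iff imul_left_commute)

lemma fprod_empty [simp]: "fprod R {#} = R"
  by (simp add: fprod_def)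

lemma fprod_add [simp]: "fprod R (add_mset p A) = imul p (fprod R A)"
  unfolding fprod_def by (rule comp_fun_commute.fold_mset_add_mset[OF comp_fun_commute_imul])

context hyperelliptic begin

definition prime_msets :: "'o set multiset set" where
  "prime_msets = {A. \<forall>p\<in>#A. prime_ideal p}"

lemma ideal_fprod: "A \<in> prime_msets \<Longrightarrow> ideal (fprod RD A)"
  by (induction A) (auto simp: prime_msets_def ideal_RD intro: ideal_imul prime_ideal_ideal)

lemma ideg_fprod: "A \<in> prime_msets \<Longrightarrow> ideg (fprod RD A) = (\<Sum>p\<in>#A. ideg p)"
proof (induction A)
  case empty
  then show ?case using ideg_0_iff[OF ideal_RD] by simp
next
  case (add p A)
  then have "prime_ideal p" "A \<in> prime_msets" by (auto simp: prime_msets_def)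
  then show ?case using add ideg_imul[OF prime_ideal_ideal ideal_fprod] by simp
qed

lemma ideg_strict_mono:
  assumes "ideal I" "ideal J" "I \<subseteq> J" "I \<noteq> J" shows "ideg J < ideg I"
proof -
  obtain K where K: "ideal K" "imul J K = I" using ideal_divides[OF assms(1-3)] by blast
  then have "K \<noteq> RD" using imul_RD'[OF assms(2)] assms(4) by auto
  then have "ideg K > 0" using ideg_0_iff[OF K(1)] by simp
  then show ?thesis using ideg_imul[OF assms(2) K(1)] K(2) by simp
qed

text \<open>A proper ideal above \<open>I\<close> of least degree is maximal, because proper
  inclusions lower the degree; maximal ideals are prime.\<close>

lemma prime_ideal_above:
  assumes "ideal I" "I \<noteq> RD" shows "\<exists>p. prime_ideal p \<and> I \<subseteq> p"
proof -
  let ?P = "\<lambda>n. \<exists>M. ideal M \<and> I \<subseteq> M \<and> M \<noteq> RD \<and> ideg M = n"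
  define n where "n = (LEAST n. ?P n)"
  have "?P (ideg I)" using assms by blast
  then have "?P n" unfolding n_def by (rule LeastI)
  have least: "\<And>m. ?P m \<Longrightarrow> n \<le> m" unfolding n_def by (rule Least_le)
  from \<open>?P n\<close> obtain M where M: "ideal M" "I \<subseteq> M" "M \<noteq> RD" "ideg M = n" by blast
  have "prime_ideal M" unfolding prime_ideal_def
  proof (intro conjI ballI impI M(1,3))
    fix a b assume ab: "a \<in> RD" "b \<in> RD" "a * b \<in> M"
    have "b \<in> M" if a: "a \<notin> M"
    proof -
      note s = ideal_isum[OF M(1) ab(1)]
      have "ideg (isum M a) < n" using ideg_strict_mono[OF M(1) s(1,2)] s(3) a M(4) by blast
      moreover have "I \<subseteq> isum M a" using s(2) M(2) by blast
      ultimately have "isum M a = RD" using least s(1) by (metis not_less)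
      then have "1 \<in> isum M a" by simp
      then obtain x r where x: "1 = x + a * r" "x \<in> M" "r \<in> RD" by (auto simp: isum_def)
      have "b = b * (x + a * r)" using x(1) by (metis mult_1_right)
      also have "\<dots> = b * x + r * (a * b)" by (simp add: algebra_simps)
      also have "\<dots> \<in> M" by (intro ideal_add[OF M(1)] ideal_mult[OF M(1)] x ab)
      finally show ?thesis .
    qed
    then show "a \<in> M \<or> b \<in> M" by blast
  qed
  then show ?thesis using M(2) by blast
qed

text \<open>Splitting off a prime above \<open>I\<close> leaves a cofactor of smaller
  degree.\<close>

lemma fprod_surj: assumes "ideal I" shows "\<exists>A\<in>prime_msets. fprod RD A = I"
  using assms
proof (induction "ideg I" arbitrary: I rule: less_induct)
  case less
  show ?case
  proof (cases "I = RD")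
    case True
    then show ?thesis by (intro bexI[of _ "{#}"]) (auto simp: prime_msets_def)
  next
    case False
    obtain p where p: "prime_ideal p" "I \<subseteq> p" using prime_ideal_above[OF less.prems False] by blast
    note pI = prime_ideal_ideal[OF p(1)]
    obtain K where K: "ideal K" "imul p K = I" using ideal_divides[OF less.prems pI p(2)] by blast
    have "p \<noteq> RD" using prime_ideal_not_1[OF p(1)] RD_1 by blast
    then have "ideg K < ideg I" using ideg_imul[OF pI K(1)] K(2) ideg_0_iff[OF pI] by simp
    then obtain A where "A \<in> prime_msets" "fprod RD A = K" using less.hyps K(1) by blast
    then show ?thesis using K p by (intro bexI[of _ "add_mset p A"]) (auto simp: prime_msets_def)
  qed
qed

lemma fprod_subset_prime:
  assumes "A \<in> prime_msets" "prime_ideal p" "fprod RD A \<subseteq> p" shows "p \<in># A"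
  using assms(1,3)
proof (induction A)
  case empty
  then have "RD \<subseteq> p" by simp
  then show ?case using prime_ideal_not_1[OF assms(2)] RD_1 by blast
next
  case (add r A)
  then have r: "prime_ideal r" and A: "A \<in> prime_msets" by (auto simp: prime_msets_def)
  have "r \<subseteq> p \<or> fprod RD A \<subseteq> p"
    using prime_ideal_imul[OF assms(2) prime_ideal_ideal[OF r] ideal_fprod[OF A]] add.prems(2) by simp
  then show ?case
  proof
    assume "r \<subseteq> p"
    then have "p = r" using prime_ideal_maximal[OF r prime_ideal_ideal[OF assms(2)]] prime_ideal_not_1[OF assms(2)] RD_1 by blast
    then show ?thesis by simp
  qed (use add.IH A in auto)
qed

lemma fprod_inject:
  assumes "A \<in> prime_msets" "Y \<in> prime_msets" "fprod RD A = fprod RD Y" shows "A = Y"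
  using assms
proof (induction A arbitrary: Y)
  case empty
  show ?case
  proof (rule ccontr)
    assume "{#} \<noteq> Y"
    then obtain p Z where Y: "Y = add_mset p Z" by (metis multiset_cases)
    then have p: "prime_ideal p" and Z: "Z \<in> prime_msets" using empty by (auto simp: prime_msets_def)
    have "imul p (fprod RD Z) \<subseteq> p"
      using imul_subset[OF ideal_fprod[OF Z] prime_ideal_ideal[OF p]] by (simp add: imul_commute)
    moreover have "imul p (fprod RD Z) = RD" using empty Y by simp
    ultimately show False using prime_ideal_not_1[OF p] RD_1 by blast
  qed
next
  case (add p A)
  then have p: "prime_ideal p" and A: "A \<in> prime_msets" by (auto simp: prime_msets_def)
  have "imul p (fprod RD A) \<subseteq> p"
    using imul_subset[OF ideal_fprod[OF A] prime_ideal_ideal[OF p]] by (simp add: imul_commute)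
  then have "p \<in># Y" using fprod_subset_prime[OF add.prems(2) p] add.prems(3) by simp
  then obtain Z where Y: "Y = add_mset p Z" by (metis multi_member_split)
  then have Z: "Z \<in> prime_msets" using add.prems by (auto simp: prime_msets_def)
  have "fprod RD A = fprod RD Z"
    using imul_cancel[OF prime_ideal_ideal[OF p] ideal_fprod[OF A] ideal_fprod[OF Z]] add.prems Y by simp
  then show ?case using add.IH[OF A Z] Y by simp
qed

lemma bij_betw_fprod: "bij_betw (fprod RD) prime_msets {I. ideal I}"
proof (rule bij_betw_imageI)
  show "inj_on (fprod RD) prime_msets" by (rule inj_onI) (rule fprod_inject)
  show "fprod RD ` prime_msets = {I. ideal I}"
  proof
    show "{I. ideal I} \<subseteq> fprod RD ` prime_msets" using fprod_surj by blast
  qed (auto intro: ideal_fprod)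
qed

section \<open>The zeta series\<close>

text \<open>An effective divisor splits into a multiset of primes, that is, a factored ideal, and a
  multiplicity at infinity.\<close>

definition eff :: "'o set multiset \<times> nat \<Rightarrow> 'o set multiset" where
  "eff = (\<lambda>(A, n). image_mset loc A + replicate_mset n Vinf)"

lemma image_mset_loc_inject:
  assumes "A \<in> prime_msets" "Y \<in> prime_msets" "image_mset loc A = image_mset loc Y" shows "A = Y"
proof -
  let ?h = "inv_into {p. prime_ideal p} loc"
  have inj: "inj_on loc {p. prime_ideal p}" by (rule inj_onI) (simp add: loc_inject)
  have *: "image_mset ?h (image_mset loc Z) = Z" if "Z \<in> prime_msets" for Z
  proof -
    have "image_mset ?h (image_mset loc Z) = image_mset (\<lambda>p. p) Z"
      unfolding multiset.map_comp by (rule image_mset_cong) (use that inj in \<open>auto simp: prime_msets_def\<close>)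
    then show ?thesis by simp
  qed
  show ?thesis using *[OF assms(1)] *[OF assms(2)] assms(3) by metis
qed

lemma bij_betw_eff: "bij_betw eff (prime_msets \<times> UNIV) (effective_divisors (field_ring KK) kk)"
proof (rule bij_betw_imageI)
  have nV: "Vinf \<notin># image_mset loc A" if "A \<in> prime_msets" for A
    using that Vinf_not_loc by (auto simp: prime_msets_def)
  show "inj_on eff (prime_msets \<times> UNIV)"
  proof (rule inj_onI)
    fix u v assume u: "u \<in> prime_msets \<times> UNIV" "v \<in> prime_msets \<times> UNIV" "eff u = eff v"
    obtain A n Y m where uv: "u = (A, n)" "v = (Y, m)" by fastforce
    have A: "A \<in> prime_msets" "Y \<in> prime_msets" using u uv by auto
    have "count (eff u) Vinf = n" "count (eff v) Vinf = m"
      using nV[OF A(1)] nV[OF A(2)] unfolding not_in_iff by (simp_all add: uv eff_def)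
    then have "n = m" using u(3) by simp
    then have "image_mset loc A = image_mset loc Y" using u(3) by (simp add: uv eff_def)
    then show "u = v" using image_mset_loc_inject[OF A] \<open>n = m\<close> uv by simp
  qed
  show "eff ` (prime_msets \<times> UNIV) = effective_divisors (field_ring KK) kk"
  proof (intro equalityI subsetI)
    fix E assume "E \<in> eff ` (prime_msets \<times> UNIV)"
    then show "E \<in> effective_divisors (field_ring KK) kk"
      by (auto simp: effective_divisors_def places_eq eff_def prime_msets_def split: if_splits)
  next
    fix E assume "E \<in> effective_divisors (field_ring KK) kk"
    then have E: "set_mset E \<subseteq> insert Vinf (loc ` {p. prime_ideal p})" by (simp add: effective_divisors_def places_eq)
    let ?h = "inv_into {p. prime_ideal p} loc"
    let ?F = "filter_mset (\<lambda>V. V \<noteq> Vinf) E"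
    have F: "V \<in> loc ` {p. prime_ideal p}" if "V \<in># ?F" for V using that E by auto
    have "image_mset loc (image_mset ?h ?F) = image_mset (\<lambda>V. V) ?F"
      unfolding multiset.map_comp by (rule image_mset_cong) (use F in \<open>auto simp: f_inv_into_f\<close>)
    moreover have "E = ?F + replicate_mset (count E Vinf) Vinf"
      by (rule multiset_eqI) simp
    ultimately have "E = eff (image_mset ?h ?F, count E Vinf)" by (simp add: eff_def)
    moreover have "image_mset ?h ?F \<in> prime_msets"
      using F inv_into_into[of _ loc "{p. prime_ideal p}"] by (fastforce simp: prime_msets_def)
    ultimately show "E \<in> eff ` (prime_msets \<times> UNIV)" by blast
  qed
qed

lemma divisor_norm_eff:
  assumes "A \<in> prime_msets"
  shows "divisor_norm (field_ring KK) (eff (A, n)) = CARD('f) ^ (ideg (fprod RD A) + n)"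
proof -
  have "divisor_norm (field_ring KK) (image_mset loc A) = CARD('f) ^ (\<Sum>p\<in>#A. ideg p)"
    using assms by (induction A) (auto simp: prime_msets_def divisor_norm_def place_norm_loc power_add)
  then show ?thesis
    using assms by (simp add: ideg_fprod eff_def divisor_norm_def place_norm_Vinf power_add)
qed

lemma zeta_series_eq_infsum:
  "zeta_series (field_ring KK) kk s =
    (\<Sum>\<^sub>\<infinity>(I, n)\<in>{I. ideal I} \<times> UNIV. of_nat (CARD('f) ^ (ideg I + n)) powr (- s))"
proof -
  have "zeta_series (field_ring KK) kk s =
    (\<Sum>\<^sub>\<infinity>u\<in>prime_msets \<times> UNIV. of_nat (divisor_norm (field_ring KK) (eff u)) powr (- s))"
    unfolding zeta_series_def by (rule infsum_reindex_bij_betw[OF bij_betw_eff, symmetric])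
  also have "\<dots> = (\<Sum>\<^sub>\<infinity>u\<in>prime_msets \<times> UNIV. (\<lambda>(I, n). of_nat (CARD('f) ^ (ideg I + n)) powr (- s))
      (map_prod (fprod RD) id u))"
    by (rule infsum_cong) (auto simp: divisor_norm_eff)
  also have "\<dots> = (\<Sum>\<^sub>\<infinity>(I, n)\<in>{I. ideal I} \<times> UNIV. of_nat (CARD('f) ^ (ideg I + n)) powr (- s))"
    by (rule infsum_reindex_bij_betw) (intro bij_betw_map_prod bij_betw_fprod bij_betw_id)
  finally show ?thesis .
qed

text \<open>For positive integers \<open>Ln\<close> is the real logarithm, so no multiple of
  \<open>2 \<pi> i\<close> enters when the exponent is pulled out.\<close>

lemma powr_of_nat_power: "(of_nat (n ^ k) :: complex) powr z = (of_nat n powr z) ^ k" if "n > 0"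
proof -
  have Ln: "Ln (of_nat m) = of_real (ln (real m))" if "m > 0" for m
    using Ln_of_real[of "real m"] that by simp
  have pw: "(of_nat m :: complex) powr z = exp (z * of_real (ln (real m)))" if "m > 0" for m
    using that Ln[OF that] by (simp add: powr_def)
  have "n ^ k > 0" using that by simp
  then have "(of_nat (n ^ k) :: complex) powr z = exp (z * of_real (ln (real (n ^ k))))" by (rule pw)
  also have "ln (real (n ^ k)) = real k * ln (real n)" using that by (simp add: ln_realpow)
  also have "z * of_real (real k * ln (real n)) = of_nat k * (z * of_real (ln (real n)))" by simp
  also have "exp (of_nat k * (z * of_real (ln (real n)))) = exp (z * of_real (ln (real n))) ^ k"
    by (rule exp_of_nat_mult)
  also have "exp (z * of_real (ln (real n))) = of_nat n powr z" by (rule pw[OF that, symmetric])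
  finally show ?thesis .
qed

definition zeta_poly :: "complex \<Rightarrow> complex" where
  "zeta_poly u = (\<Sum>m<2 * g. of_nat (card (ideals m)) * u ^ m)"

text \<open>From degree \<open>2 * g\<close> on the coefficients are \<open>rho * q ^ m\<close>, so
  the tail is a geometric series with ratio \<open>q * u\<close>; the rest is
  \<open>zeta_poly\<close>.\<close>

lemma ideals_sums:
  fixes u :: complex
  assumes u: "norm u < 1 / real CARD('f)"
  shows "summable (\<lambda>m. norm (of_nat (card (ideals m)) * u ^ m))"
    and "(\<lambda>m. of_nat (card (ideals m)) * u ^ m) sums
      (zeta_poly u + of_real rho * (of_nat CARD('f) * u) ^ (2 * g) / (1 - of_nat CARD('f) * u))"
proof -
  let ?q = "of_nat CARD('f) :: complex"
  have qu: "norm (?q * u) < 1" using u by (simp add: norm_mult field_simps)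
  have shift: "of_nat (card (ideals (m + 2 * g))) * u ^ (m + 2 * g) = of_real rho * (?q * u) ^ (2 * g) * (?q * u) ^ m" for m
  proof -
    have "(of_nat (card (ideals (m + 2 * g))) :: complex) = of_real (real (card (ideals (m + 2 * g))))" by simp
    also have "\<dots> = of_real rho * ?q ^ (m + 2 * g)" using card_ideals_large[of "m + 2 * g"] by simp
    finally show ?thesis by (simp add: power_mult_distrib power_add mult_ac)
  qed
  have "summable (\<lambda>m. norm (of_real rho * (?q * u) ^ (2 * g)) * norm (?q * u) ^ m)"
    using qu by (intro summable_mult summable_geometric) simp
  then have "summable (\<lambda>m. norm (of_nat (card (ideals (m + 2 * g))) * u ^ (m + 2 * g)))"
    unfolding shift by (simp only: norm_mult norm_power)
  then show "summable (\<lambda>m. norm (of_nat (card (ideals m)) * u ^ m))"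
    by (subst (asm) summable_iff_shift)
  have "(\<lambda>m. of_real rho * (?q * u) ^ (2 * g) * (?q * u) ^ m) sums
      (of_real rho * (?q * u) ^ (2 * g) * (1 / (1 - ?q * u)))"
    using qu by (intro sums_mult geometric_sums)
  then have "(\<lambda>m. of_nat (card (ideals (m + 2 * g))) * u ^ (m + 2 * g)) sums
      (of_real rho * (?q * u) ^ (2 * g) / (1 - ?q * u))"
    unfolding shift by simp
  then show "(\<lambda>m. of_nat (card (ideals m)) * u ^ m) sums
      (zeta_poly u + of_real rho * (?q * u) ^ (2 * g) / (1 - ?q * u))"
    unfolding zeta_poly_def by (subst (asm) sums_iff_shift) (simp add: add.commute)
qed

lemma abs_summable_ideals:
  fixes u :: complex
  assumes u: "norm u < 1 / real CARD('f)"
  shows "(\<lambda>x. norm (u ^ fst x)) summable_on (SIGMA m:UNIV. ideals m)"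
    and "(\<Sum>\<^sub>\<infinity>x\<in>(SIGMA m:UNIV. ideals m). u ^ fst x) =
      zeta_poly u + of_real rho * (of_nat CARD('f) * u) ^ (2 * g) / (1 - of_nat CARD('f) * u)"
proof -
  note S = ideals_sums[OF u]
  have "(\<lambda>m. norm (of_nat (card (ideals m)) * u ^ m)) summable_on UNIV"
    using S(1) by (subst summable_on_UNIV_nonneg_real_iff) auto
  then have "(\<lambda>m. norm (\<Sum>\<^sub>\<infinity>I\<in>ideals m. norm (u ^ fst (m, I)))) summable_on UNIV"
    by (simp add: norm_mult)
  then show 1: "(\<lambda>x. norm (u ^ fst x)) summable_on (SIGMA m:UNIV. ideals m)"
    using Infinite_Sum.abs_summable_on_Sigma_iff[of "\<lambda>x. u ^ fst x" UNIV ideals] by simp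
  have "(\<lambda>x. u ^ fst x) summable_on (SIGMA m:UNIV. ideals m)" using 1 by (rule abs_summable_summable)
  then have "(\<Sum>\<^sub>\<infinity>x\<in>(SIGMA m:UNIV. ideals m). u ^ fst x) = (\<Sum>\<^sub>\<infinity>m\<in>UNIV. \<Sum>\<^sub>\<infinity>I\<in>ideals m. u ^ m)"
    using infsum_Sigma_banach[of "\<lambda>x. u ^ fst x" UNIV ideals] by simp
  also have "\<dots> = (\<Sum>\<^sub>\<infinity>m\<in>UNIV. of_nat (card (ideals m)) * u ^ m)" by simp
  also have "\<dots> = zeta_poly u + of_real rho * (of_nat CARD('f) * u) ^ (2 * g) / (1 - of_nat CARD('f) * u)"
    by (rule infsumI[OF norm_summable_imp_has_sum[OF S]])
  finally show "(\<Sum>\<^sub>\<infinity>x\<in>(SIGMA m:UNIV. ideals m). u ^ fst x) =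
      zeta_poly u + of_real rho * (of_nat CARD('f) * u) ^ (2 * g) / (1 - of_nat CARD('f) * u)" .
qed

text \<open>Absolute convergence lets the double sum factor: the finite places give the series over
  ideals, the infinite place of degree one gives \<open>1 / (1 - u)\<close>.\<close>

theorem zeta_series_rational:
  assumes s: "Re s > 1"
  defines "u \<equiv> of_nat CARD('f) powr (- s)"
  shows "zeta_series (field_ring KK) kk s =
    (zeta_poly u + of_real rho * (of_nat CARD('f) * u) ^ (2 * g) / (1 - of_nat CARD('f) * u)) / (1 - u)"
proof -
  have q: "real CARD('f) > 1" using CARD_ge_2 by simp
  have "norm u = real CARD('f) powr (- Re s)"
    using q by (simp add: u_def norm_powr_real_powr)
  also have "\<dots> < real CARD('f) powr (- 1)" using s q by (intro powr_less_mono) auto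
  also have "\<dots> = 1 / real CARD('f)" using q by (simp add: powr_minus divide_simps)
  finally have u: "norm u < 1 / real CARD('f)" .
  also have "\<dots> < 1" using q by simp
  finally have u1: "norm u < 1" .
  let ?T = "(SIGMA m:UNIV. ideals m)"
  have bij: "bij_betw (map_prod snd id) (?T \<times> (UNIV :: nat set)) ({I. ideal I} \<times> UNIV)"
  proof (intro bij_betw_map_prod bij_betw_id bij_betw_imageI)
    show "inj_on snd ?T" by (rule inj_onI) (auto simp: ideals_def)
    show "snd ` ?T = {I. ideal I}" by (force simp: ideals_def)
  qed
  have "zeta_series (field_ring KK) kk s = (\<Sum>\<^sub>\<infinity>(I, n)\<in>{I. ideal I} \<times> UNIV. u ^ (ideg I + n))"
    unfolding zeta_series_eq_infsum u_def using q by (simp add: powr_of_nat_power del: of_nat_power)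
  also have "\<dots> = (\<Sum>\<^sub>\<infinity>x\<in>?T \<times> UNIV. (\<lambda>(I, n). u ^ (ideg I + n)) (map_prod snd id x))"
    by (rule infsum_reindex_bij_betw[OF bij, symmetric])
  also have "\<dots> = (\<Sum>\<^sub>\<infinity>x\<in>?T \<times> UNIV. u ^ fst (fst x) * u ^ snd x)"
    by (rule infsum_cong) (auto simp: ideals_def power_add)
  also have "\<dots> = (\<Sum>\<^sub>\<infinity>x\<in>?T. \<Sum>\<^sub>\<infinity>n\<in>UNIV. u ^ fst x * u ^ n)"
  proof -
    let ?h = "\<lambda>x::(nat \<times> 'o set) \<times> nat. u ^ fst (fst x) * u ^ snd x"
    have "summable (\<lambda>n. norm (u ^ n))" using u1 by (simp add: norm_power summable_geometric)
    then have n: "(\<lambda>n. norm (u ^ n)) summable_on UNIV" by (subst summable_on_UNIV_nonneg_real_iff) auto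
    have "(\<lambda>k. norm (?h (x, k))) summable_on UNIV" for x
      using summable_on_cmult_right[OF n, of "norm (u ^ fst x)"] by (simp add: norm_mult)
    moreover have "(\<lambda>x. norm (u ^ fst x) * (\<Sum>\<^sub>\<infinity>n. norm (u ^ n))) summable_on ?T"
      by (intro summable_on_cmult_left abs_summable_ideals(1)[OF u])
    moreover have "(\<Sum>\<^sub>\<infinity>n. norm (u ^ n)) \<ge> 0" by (intro infsum_nonneg) auto
    ultimately have "(\<lambda>x. norm (?h x)) summable_on (?T \<times> UNIV)"
      using Infinite_Sum.abs_summable_on_Sigma_iff[of ?h ?T "\<lambda>_. UNIV"]
      by (simp add: norm_mult infsum_cmult_right' abs_mult)
    then have "?h summable_on (?T \<times> UNIV)" by (rule abs_summable_summable)
    then show ?thesis using infsum_Sigma_banach[of ?h ?T "\<lambda>_. UNIV"] by simp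
  qed
  also have "\<dots> = (\<Sum>\<^sub>\<infinity>x\<in>?T. u ^ fst x) * (\<Sum>\<^sub>\<infinity>n. u ^ n)"
    by (simp add: infsum_cmult_right' infsum_cmult_left')
  also have "(\<Sum>\<^sub>\<infinity>n. u ^ n) = 1 / (1 - u)"
    using u1 by (intro infsumI norm_summable_imp_has_sum geometric_sums) (auto simp: norm_power summable_geometric)
  also have "(\<Sum>\<^sub>\<infinity>x\<in>?T. u ^ fst x) = zeta_poly u + of_real rho * (of_nat CARD('f) * u) ^ (2 * g) / (1 - of_nat CARD('f) * u)"
    by (rule abs_summable_ideals(2)[OF u])
  finally show ?thesis by simp
qed

end

section \<open>The residue of the zeta function\<close>

lemma isolated_singularity_of_meromorphic:
  "f meromorphic_on UNIV \<Longrightarrow> isolated_singularity_at f z"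
  using meromorphic_on_isolated_singularity meromorphic_on_subset by blast

text \<open>By the identity theorem the two functions agree near every point apart from the point
  itself. Hence they share limits and poles there, and the normalization of values at such points
  makes them equal.\<close>

lemma nicely_meromorphic_unique:
  assumes f: "f nicely_meromorphic_on UNIV" and h: "h nicely_meromorphic_on UNIV"
    and eq: "\<And>s. Re s > 1 \<Longrightarrow> f s = h s"
  shows "f = h"
proof
  fix z
  have fm: "f meromorphic_on UNIV" and hm: "h meromorphic_on UNIV"
    using f h by (auto simp: nicely_meromorphic_on_def)
  let ?d = "\<lambda>s. f s - h s"
  have dm: "?d meromorphic_on UNIV" using fm hm by (intro meromorphic_intros)
  have op: "open {s::complex. Re s > 1}" by (rule open_halfspace_Re_gt)
  have "eventually (\<lambda>s. Re s > 1) (at (2::complex))"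
    using eventually_at_in_open'[OF op, of 2] by simp
  then have "eventually (\<lambda>s. remove_sings ?d s = 0) (at 2)"
    using eventually_remove_sings_eq_at[OF isolated_singularity_of_meromorphic[OF dm], of 2]
    by eventually_elim (use eq in auto)
  then have "frequently (\<lambda>s. remove_sings ?d s = 0) (at (2::complex))"
    by (rule eventually_frequently[rotated]) simp
  from frequently_eq_meromorphic_imp_constant[OF this remove_sings_nicely_meromorphic[OF dm]]
  have 0: "remove_sings ?d w = 0" for w by auto
  have ev: "eventually (\<lambda>s. f s = h s) (at z)"
    using eventually_remove_sings_eq_at[OF isolated_singularity_of_meromorphic[OF dm], of z]
    by eventually_elim (use 0 in auto)
  have lim_iff: "f \<midarrow>z\<rightarrow> c \<longleftrightarrow> h \<midarrow>z\<rightarrow> c" for c by (rule tendsto_cong[OF ev])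
  have pole_iff: "is_pole f z \<longleftrightarrow> is_pole h z" by (rule is_pole_cong[OF ev refl])
  have no: "\<not> (is_pole w z \<and> w \<midarrow>z\<rightarrow> c)" for w :: "complex \<Rightarrow> complex" and c
    unfolding is_pole_def using not_tendsto_and_filterlim_at_infinity[of "at z" w c] by auto
  have "is_pole f z \<and> f z = 0 \<or> f \<midarrow>z\<rightarrow> f z" "is_pole h z \<and> h z = 0 \<or> h \<midarrow>z\<rightarrow> h z"
    using f h by (auto simp: nicely_meromorphic_on_def)
  then show "f z = h z" using no lim_iff pole_iff LIM_unique by metis
qed

lemma zeta_eq_remove_sings:
  assumes G: "G meromorphic_on UNIV" and an: "\<And>s. Re s > 1 \<Longrightarrow> G analytic_on {s}"
    and eq: "\<And>s. Re s > 1 \<Longrightarrow> zeta_series K k s = G s"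
  shows "zeta K k = remove_sings G"
  unfolding zeta_def
proof (rule the_equality)
  show *: "remove_sings G nicely_meromorphic_on UNIV \<and> (\<forall>s. 1 < Re s \<longrightarrow> remove_sings G s = zeta_series K k s)"
    using remove_sings_nicely_meromorphic[OF G] an eq by simp
  show "f = remove_sings G" if "f nicely_meromorphic_on UNIV \<and> (\<forall>s. 1 < Re s \<longrightarrow> f s = zeta_series K k s)" for f
    using nicely_meromorphic_unique[of f "remove_sings G"] that * by simp
qed

text \<open>The limit is the constant coefficient of \<open>fls_X * F\<close>; being nonzero, it
  places the lowest term of \<open>F\<close> in degree \<open>-1\<close>.\<close>

lemma leading_coeff_simple_pole:
  assumes f: "f meromorphic_on UNIV" and lim: "((\<lambda>s. (s - z) * f s) \<longlongrightarrow> r) (at z)" and "r \<noteq> 0"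
  shows "fls_nth (laurent_expansion f z) (fls_subdegree (laurent_expansion f z)) = r"
proof -
  obtain F where F: "(\<lambda>w. f (z + w)) has_laurent_expansion F"
    using f unfolding meromorphic_on_def by blast
  have FG: "(\<lambda>w. w * f (z + w)) has_laurent_expansion (fls_X * F)"
    by (intro laurent_expansion_intros F)
  have "((\<lambda>w. (z + w - z) * f (z + w)) \<longlongrightarrow> r) (at 0)"
    using lim by (subst (asm) at_to_0) (simp add: filterlim_filtermap add.commute)
  then have l: "((\<lambda>w. w * f (z + w)) \<longlongrightarrow> r) (at 0)" by simp
  have sd: "fls_subdegree (fls_X * F) \<ge> 0"
  proof (rule ccontr)
    assume "\<not> fls_subdegree (fls_X * F) \<ge> 0"
    then have "is_pole (\<lambda>w. w * f (z + w)) 0" using has_laurent_expansion_imp_is_pole_0[OF FG] by simp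
    then show False using l not_tendsto_and_filterlim_at_infinity[of "at (0::complex)"]
      unfolding is_pole_def by auto
  qed
  have "((\<lambda>w. w * f (z + w)) \<longlongrightarrow> fls_nth (fls_X * F) 0) (at 0)"
    by (rule has_laurent_expansion_imp_tendsto_0[OF FG sd])
  then have c: "fls_nth (fls_X * F) 0 = r" using l LIM_unique by blast
  then have "fls_subdegree (fls_X * F) = 0" using sd \<open>r \<noteq> 0\<close> by (metis fls_subdegree_leI order_antisym)
  moreover have "F \<noteq> 0" using c \<open>r \<noteq> 0\<close> by auto
  ultimately have "fls_subdegree F = -1" by simp
  moreover have "fls_nth F (-1) = r" using c by (simp add: fls_X_times_conv_shift)
  ultimately show ?thesis using laurent_expansion_eqI[OF F] by simp
qed

lemma zeta_star_eq:
  assumes G: "G meromorphic_on UNIV" and an: "\<And>s. Re s > 1 \<Longrightarrow> G analytic_on {s}"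
    and eq: "\<And>s. Re s > 1 \<Longrightarrow> zeta_series K k s = G s"
    and lim: "((\<lambda>s. (s - z) * G s) \<longlongrightarrow> r) (at z)" and "r \<noteq> 0"
  shows "zeta_star K k z = r"
proof -
  have "eventually (\<lambda>s. remove_sings G s = G s) (at z)"
    by (intro eventually_remove_sings_eq_at isolated_singularity_of_meromorphic G)
  then have "eventually (\<lambda>s. (s - z) * remove_sings G s = (s - z) * G s) (at z)" by eventually_elim simp
  from tendsto_cong[OF this] have l: "((\<lambda>s. (s - z) * remove_sings G s) \<longlongrightarrow> r) (at z)" using lim by blast
  have "zeta K k = remove_sings G"
    by (rule zeta_eq_remove_sings[OF G]) (use an eq in auto)
  then show ?thesis
    using leading_coeff_simple_pole[OF remove_sings_meromorphic[OF G] l \<open>r \<noteq> 0\<close>] by (simp add: zeta_star_def)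
qed

context hyperelliptic begin

text \<open>At \<open>s = 1\<close> one has \<open>q * u = 1\<close>. Of the two denominators only
  \<open>1 - q * u\<close> vanishes there, with derivative \<open>ln q\<close>; the other equals
  \<open>1 - 1 / q\<close>.\<close>

theorem zeta_star_1:
  "zeta_star (field_ring KK) kk 1 = of_real (rho / ((1 - 1 / real CARD('f)) * ln (real CARD('f))))"
proof -
  let ?q = "of_nat CARD('f) :: complex" and ?L = "of_real (ln (real CARD('f))) :: complex"
  define u where "u = (\<lambda>s::complex. exp (- s * ?L))"
  define G where "G = (\<lambda>s. (zeta_poly (u s) + of_real rho * (?q * u s) ^ (2 * g) / (1 - ?q * u s)) / (1 - u s))"
  have q: "real CARD('f) > 1" using CARD_ge_2 by simp
  have L: "Ln ?q = ?L" using q Ln_of_real[of "real CARD('f)"] by simp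
  have uq: "u s = ?q powr (- s)" for s using q by (simp add: u_def powr_def L)
  have expL: "exp ?L = ?q" using q by (simp add: exp_of_real)
  have u1: "u 1 = 1 / ?q" using q by (simp add: u_def exp_minus expL divide_inverse)
  have an_u: "u analytic_on T" for T unfolding u_def by (intro analytic_intros)
  have an_p: "(\<lambda>s. zeta_poly (u s)) analytic_on T" for T
    unfolding zeta_poly_def by (intro analytic_intros an_u)
  have G: "G meromorphic_on UNIV"
    unfolding G_def by (intro meromorphic_intros analytic_on_imp_meromorphic_on an_u an_p)
  have small: "norm (?q * u s) < 1" "norm (u s) < 1" if "Re s > 1" for s
  proof -
    have "norm (u s) = real CARD('f) powr (- Re s)" using q by (simp add: uq norm_powr_real_powr)
    also have "\<dots> < real CARD('f) powr (- 1)" using that q by (intro powr_less_mono) auto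
    also have "\<dots> = 1 / real CARD('f)" using q by (simp add: powr_minus divide_simps)
    finally have *: "norm (u s) < 1 / real CARD('f)" .
    then show "norm (?q * u s) < 1" using q by (simp add: norm_mult field_simps)
    have "1 / real CARD('f) < 1" using q by simp
    with * show "norm (u s) < 1" by linarith
  qed
  have ne: "1 - ?q * u s \<noteq> 0" "1 - u s \<noteq> 0" if "Re s > 1" for s
    using small[OF that] by auto
  have an: "G analytic_on {s}" if "Re s > 1" for s
    unfolding G_def by (intro analytic_intros an_u an_p) (use ne[OF that] in auto)
  have eq: "zeta_series (field_ring KK) kk s = G s" if "Re s > 1" for s
    using zeta_series_rational[OF that] by (simp add: G_def uq)
  have u_lim: "(u \<longlongrightarrow> u 1) (at 1)" by (rule isContD[OF analytic_at_imp_isCont[OF an_u]])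
  have p_lim: "((\<lambda>s. zeta_poly (u s)) \<longlongrightarrow> zeta_poly (u 1)) (at 1)"
    by (rule isContD[OF analytic_at_imp_isCont[OF an_p]])
  have d: "((\<lambda>s. 1 - ?q * u s) has_field_derivative - (?q * (exp (- 1 * ?L) * - ?L))) (at 1)"
    unfolding u_def by (auto intro!: derivative_eq_intros)
  have dL: "- (?q * (exp (- 1 * ?L) * - ?L)) = ?L"
    using u1 q by (simp add: u_def)
  from d[unfolded dL] have "((\<lambda>s. ((1 - ?q * u s) - (1 - ?q * u 1)) / (s - 1)) \<longlongrightarrow> ?L) (at 1)"
    by (simp only: has_field_derivative_iff)
  then have d_lim: "((\<lambda>s. (1 - ?q * u s) / (s - 1)) \<longlongrightarrow> ?L) (at 1)" using u1 q by simp
  have L0: "?L \<noteq> 0" using q by simp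
  let ?r = "(0 * zeta_poly (u 1) + of_real rho * (?q * u 1) ^ (2 * g) / ?L) / (1 - u 1)"
  have q1: "1 - u 1 \<noteq> 0" using q u1 by simp
  \<comment> \<open>Replacing \<open>1 - q * u\<close> by its difference quotient absorbs the factor
    \<open>s - 1\<close> and leaves only terms with finite limits.\<close>
  have "((\<lambda>s. ((s - 1) * zeta_poly (u s) + of_real rho * (?q * u s) ^ (2 * g) / ((1 - ?q * u s) / (s - 1))) / (1 - u s)) \<longlongrightarrow> ?r) (at 1)"
    by (intro tendsto_intros u_lim p_lim d_lim L0 q1) (auto intro!: tendsto_eq_intros)
  moreover have "eventually (\<lambda>s::complex. s \<noteq> 1) (at 1)" by (simp add: eventually_at_filter)
  then have ev: "eventually (\<lambda>s. (s - 1) * G s = ((s - 1) * zeta_poly (u s) + of_real rho * (?q * u s) ^ (2 * g) / ((1 - ?q * u s) / (s - 1))) / (1 - u s)) (at 1)"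
    by eventually_elim (simp add: G_def distrib_left)
  ultimately have lim: "((\<lambda>s. (s - 1) * G s) \<longlongrightarrow> ?r) (at 1)" using tendsto_cong[OF ev] by blast
  have r: "?r = of_real (rho / ((1 - 1 / real CARD('f)) * ln (real CARD('f))))"
    using q by (simp add: u1 field_simps)
  have "rho / ((1 - 1 / real CARD('f)) * ln (real CARD('f))) > 0" using rho_pos q by simp
  then have "?r \<noteq> 0" unfolding r by (metis less_irrefl of_real_eq_0_iff)
  from zeta_star_eq[OF G an eq lim this] show ?thesis unfolding r .
qed

end

section \<open>Invariance under isomorphism\<close>

lemma residue_field_carrier:
  "carrier (residue_field K V) = (\<lambda>x. (\<lambda>i. i \<oplus>\<^bsub>K\<^esub> x) ` place_ideal K V) ` V"
  by (auto simp: residue_field_def FactRing_def A_RCOSETS_def RCOSETS_def r_coset_def image_def)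

locale field_isomorphism =
  fixes K :: "'a ring" and L :: "'b ring" and h
  assumes K: "field K" and L: "field L" and h: "h \<in> ring_iso K L"
begin

interpretation K: field K by (rule K)
interpretation L: field L by (rule L)
interpretation ring_hom_ring K L h
  using h by unfold_locales (simp add: ring_iso_def)

lemma inj_h: "inj_on h (carrier K)" and img_h: "h ` carrier K = carrier L"
  using h by (auto simp: ring_iso_def bij_betw_def)

lemma h_inv: assumes "x \<in> carrier K" "x \<noteq> \<zero>\<^bsub>K\<^esub>" shows "h (inv\<^bsub>K\<^esub> x) = inv\<^bsub>L\<^esub> h x"
proof -
  have u: "x \<in> Units K" using assms by (simp add: K.field_Units)
  then have i: "inv\<^bsub>K\<^esub> x \<in> carrier K" "x \<otimes>\<^bsub>K\<^esub> inv\<^bsub>K\<^esub> x = \<one>\<^bsub>K\<^esub>" by auto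
  then have "h x \<otimes>\<^bsub>L\<^esub> h (inv\<^bsub>K\<^esub> x) = \<one>\<^bsub>L\<^esub>" using assms by (metis hom_mult hom_one)
  then show ?thesis using i assms by (metis L.comm_inv_char hom_closed)
qed

lemma image_place: assumes V: "V \<in> places K k" shows "h ` V \<in> places L (h ` k)"
proof -
  have s: "subring V K" and k: "k \<subseteq> V" and p: "V \<noteq> carrier K"
    and i: "\<And>z. z \<in> carrier K - {\<zero>\<^bsub>K\<^esub>} \<Longrightarrow> z \<in> V \<or> inv\<^bsub>K\<^esub> z \<in> V" using V by (auto simp: places_def)
  have sub: "V \<subseteq> carrier K" using subringE(1)[OF s] .
  have "h ` V \<noteq> carrier L" using p sub inj_h img_h by (metis inj_on_image_eq_iff order_refl)
  moreover have "w \<in> h ` V \<or> inv\<^bsub>L\<^esub> w \<in> h ` V" if "w \<in> carrier L - {\<zero>\<^bsub>L\<^esub>}" for w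
  proof -
    from that img_h obtain z where z: "z \<in> carrier K" "w = h z" by blast
    with that have "z \<noteq> \<zero>\<^bsub>K\<^esub>" by auto
    then show ?thesis using i[of z] z h_inv by force
  qed
  ultimately show ?thesis using img_is_subring[OF s] k by (auto simp: places_def)
qed

lemma image_Units:
  assumes V: "V \<subseteq> carrier K"
  shows "Units (L\<lparr>carrier := h ` V\<rparr>) = h ` Units (K\<lparr>carrier := V\<rparr>)"
proof -
  have "h x \<otimes>\<^bsub>L\<^esub> h z = \<one>\<^bsub>L\<^esub> \<longleftrightarrow> x \<otimes>\<^bsub>K\<^esub> z = \<one>\<^bsub>K\<^esub>" if "x \<in> V" "z \<in> V" for x z
  proof -
    have xz: "x \<in> carrier K" "z \<in> carrier K" using that V by auto
    then have "h x \<otimes>\<^bsub>L\<^esub> h z = \<one>\<^bsub>L\<^esub> \<longleftrightarrow> h (x \<otimes>\<^bsub>K\<^esub> z) = h \<one>\<^bsub>K\<^esub>" by simp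
    also have "\<dots> \<longleftrightarrow> x \<otimes>\<^bsub>K\<^esub> z = \<one>\<^bsub>K\<^esub>" by (rule inj_on_eq_iff[OF inj_h]) (use xz in auto)
    finally show ?thesis .
  qed
  then show ?thesis by (auto simp: Units_def)
qed

lemma image_place_ideal:
  assumes V: "V \<subseteq> carrier K" shows "place_ideal L (h ` V) = h ` place_ideal K V"
proof -
  have U: "Units (K\<lparr>carrier := V\<rparr>) \<subseteq> V" by (auto simp: Units_def)
  show ?thesis unfolding place_ideal_def image_Units[OF V]
    by (rule inj_on_image_set_diff[OF inj_h, symmetric]) (use V U in auto)
qed

lemma place_norm_image: assumes V: "V \<subseteq> carrier K" shows "place_norm L (h ` V) = place_norm K V"
proof -
  have I: "place_ideal K V \<subseteq> carrier K" using V by (auto simp: place_ideal_def)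
  have "carrier (residue_field L (h ` V)) = image h ` carrier (residue_field K V)"
    unfolding residue_field_carrier image_place_ideal[OF V] image_image
    by (intro image_cong refl) (simp add: subsetD[OF V] subsetD[OF I])
  moreover have "carrier (residue_field K V) \<subseteq> Pow (carrier K)"
    using I V unfolding residue_field_carrier by (auto intro!: K.a_closed)
  then have "inj_on (image h) (carrier (residue_field K V))"
    using inj_on_image_Pow[OF inj_h] inj_on_subset by blast
  ultimately show ?thesis by (simp add: place_norm_def card_image)
qed

end

lemma places_subset: "V \<in> places K k \<Longrightarrow> V \<subseteq> carrier K"
  by (auto simp: places_def dest: subringE(1))

context field_isomorphism begin

lemma field_isomorphism_inverse: "field_isomorphism L K (inv_into (carrier K) h)"
  using K L h ring_iso_set_sym[OF field.is_ring[OF K] h] by (simp add: field_isomorphism_def)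

lemma bij_places:
  assumes k: "k \<subseteq> carrier K" shows "bij_betw (image h) (places K k) (places L (h ` k))"
proof -
  have "inj_on (image h) (places K k)"
    by (rule inj_on_subset[OF inj_on_image_Pow[OF inj_h]]) (auto dest: places_subset)
  moreover have "W \<in> image h ` places K k" if W: "W \<in> places L (h ` k)" for W
  proof -
    have "inv_into (carrier K) h ` W \<in> places K (inv_into (carrier K) h ` h ` k)"
      by (rule field_isomorphism.image_place[OF field_isomorphism_inverse W])
    also have "inv_into (carrier K) h ` h ` k = k" by (rule inv_into_image_cancel[OF inj_h k])
    finally have "inv_into (carrier K) h ` W \<in> places K k" .
    moreover have "h ` inv_into (carrier K) h ` W = W"
      using places_subset[OF W] img_h by (intro image_inv_into_cancel) auto
    ultimately show ?thesis by (metis imageI)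
  qed
  ultimately show ?thesis using image_place by (auto simp: bij_betw_def)
qed

text \<open>The isomorphism induces a norm-preserving bijection of effective divisors. The series
  therefore coincide, and with them the continuations.\<close>

theorem zeta_star_image:
  assumes k: "k \<subseteq> carrier K" shows "zeta_star L (h ` k) = zeta_star K k"
proof -
  let ?H = "image_mset (image h)"
  note b = bij_places[OF k]
  have "inj_on ?H (effective_divisors K k)"
  proof (rule inj_onI)
    fix M N assume M: "M \<in> effective_divisors K k" and N: "N \<in> effective_divisors K k" and e: "?H M = ?H N"
    have "image_mset (inv_into (places K k) (image h)) (?H A) = A" if "A \<in> effective_divisors K k" for A
    proof -
      have "image_mset (inv_into (places K k) (image h)) (?H A) = image_mset (\<lambda>V. V) A"
        unfolding image_mset.compositionality comp_def
        using that bij_betw_inv_into_left[OF b] by (intro image_mset_cong) (auto simp: effective_divisors_def)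
      then show ?thesis by simp
    qed
    then show "M = N" using M N e by metis
  qed
  moreover have "?H ` effective_divisors K k = effective_divisors L (h ` k)"
  proof
    show "?H ` effective_divisors K k \<subseteq> effective_divisors L (h ` k)"
      using bij_betw_imp_surj_on[OF b] by (fastforce simp: effective_divisors_def)
    show "effective_divisors L (h ` k) \<subseteq> ?H ` effective_divisors K k"
    proof
      fix N assume N: "N \<in> effective_divisors L (h ` k)"
      let ?i = "inv_into (places K k) (image h)"
      have "?H (image_mset ?i N) = image_mset (\<lambda>V. V) N"
        unfolding image_mset.compositionality comp_def
        using N bij_betw_inv_into_right[OF b] by (intro image_mset_cong) (auto simp: effective_divisors_def)
      then have "N = ?H (image_mset ?i N)" by simp
      moreover have "image_mset ?i N \<in> effective_divisors K k"
        using N bij_betw_apply[OF bij_betw_inv_into[OF b]] by (auto simp: effective_divisors_def)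
      ultimately show "N \<in> ?H ` effective_divisors K k" by blast
    qed
  qed
  ultimately have bH: "bij_betw ?H (effective_divisors K k) (effective_divisors L (h ` k))"
    by (simp add: bij_betw_def)
  have n: "divisor_norm L (?H M) = divisor_norm K M" if "M \<in> effective_divisors K k" for M
  proof -
    have "image_mset (place_norm L) (?H M) = image_mset (place_norm K) M"
      unfolding image_mset.compositionality comp_def
      using that by (intro image_mset_cong place_norm_image places_subset) (auto simp: effective_divisors_def)
    then show ?thesis by (simp add: divisor_norm_def)
  qed
  have "zeta_series L (h ` k) s = zeta_series K k s" for s
    unfolding zeta_series_def infsum_reindex_bij_betw[OF bH, symmetric]
    by (rule infsum_cong) (simp add: n)
  then show ?thesis unfolding zeta_star_def zeta_def by simp
qed

end

section \<open>Function fields from hyperelliptic fields\<close>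

context hyperelliptic begin

lemma card_kk: "card kk = CARD('f)"
  unfolding kk_def by (rule card_image) (auto simp: inj_on_def)

lemma finite_kk: "finite kk"
  by (simp add: kk_def)

lemma kk_subset_KK: "kk \<subseteq> KK"
  using kk_subset_RD RD_subset_KK by blast

lemma emb_const_mult: "emb [:a:] * emb [:b:] = emb [:a * b:]"
  using emb_mult[of "[:a:]" "[:b:]"] by (simp add: mult.commute)

lemma emb_const_add: "emb [:a:] + emb [:b:] = emb [:a + b:]"
  using emb_add[of "[:a:]" "[:b:]"] by simp

lemma subfield_kk: "subfield kk (field_ring KK)"
proof (rule field.subfieldI'[OF K.field_field_ring ring.subringI])
  show "ring (field_ring KK)" using K.field_field_ring by (rule field.is_ring)
  show "kk \<subseteq> carrier (field_ring KK)" using kk_subset_KK by simp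
  show "\<one>\<^bsub>field_ring KK\<^esub> \<in> kk" using rangeI[of "\<lambda>a. emb [:a:]" 1] by (simp add: kk_def pCons_one)
  show "\<ominus>\<^bsub>field_ring KK\<^esub> z \<in> kk" if "z \<in> kk" for z
  proof -
    from that obtain a where a: "z = emb [:a:]" by (auto simp: kk_def)
    then have "- z = emb [:- a:]" using emb_minus[of "[:a:]"] by simp
    then show ?thesis using that kk_subset_KK K.a_inv_field_ring[of z] by (auto simp: kk_def)
  qed
  show "z \<otimes>\<^bsub>field_ring KK\<^esub> w \<in> kk" "z \<oplus>\<^bsub>field_ring KK\<^esub> w \<in> kk" if "z \<in> kk" "w \<in> kk" for z w
    using that by (auto simp: kk_def emb_const_mult emb_const_add)
  show "inv\<^bsub>field_ring KK\<^esub> z \<in> kk" if "z \<in> kk - {\<zero>\<^bsub>field_ring KK\<^esub>}" for z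
  proof -
    from that obtain a where a: "z = emb [:a:]" "z \<noteq> 0" by (auto simp: kk_def)
    then have "a \<noteq> 0" by auto
    then have "z * emb [:inverse a:] = 1" using emb_const_mult[of a "inverse a"] a by (simp add: pCons_one)
    then have "inverse z = emb [:inverse a:]" by (rule inverse_unique)
    then show ?thesis using that kk_subset_KK K.inv_field_ring[of z] by (auto simp: kk_def)
  qed
qed

lemma poly_in_Vinf:
  assumes "\<And>i. Polynomial.coeff P i \<in> kk" "w \<in> Vinf" shows "poly P w \<in> Vinf"
  using assms(1)
proof (induction P)
  case (pCons a P)
  have "a \<in> kk" using pCons.prems[of 0] by simp
  moreover have "Polynomial.coeff P i \<in> kk" for i using pCons.prems[of "Suc i"] by simp
  then have "poly P w \<in> Vinf" by (rule pCons.IH)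
  ultimately show ?case
    using K.place_add[OF is_place_Vinf _ K.place_mult[OF is_place_Vinf assms(2)], of a "poly P w"]
      K.place_const[OF is_place_Vinf] by auto
qed (use K.place_0[OF is_place_Vinf] in simp)

lemma kk_Int_mx_Vinf: assumes "r \<in> kk" "r \<in> mx Vinf" shows "r = 0"
proof -
  from assms(1) obtain a where a: "r = emb [:a:]" by (auto simp: kk_def)
  then have "emb [:a:] \<in> LS 0" using assms(2) mx_Vinf_iff[of r 1] by simp
  then show "r = 0" using a by (simp add: LS_def)
qed

text \<open>The constant term of a relation for \<open>w\<close> is a multiple of \<open>w\<close>,
  hence a constant in the maximal ideal, hence zero. If \<open>w\<close> were nonzero it could be
  cancelled, and the relation would keep getting shorter.\<close>

lemma no_root_mx_Vinf:
  assumes "\<And>i. Polynomial.coeff P i \<in> kk" "P \<noteq> 0" "w \<in> mx Vinf" "poly P w = 0" shows "w = 0"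
  using assms(1,2,4)
proof (induction P)
  case (pCons a P)
  have P: "Polynomial.coeff P i \<in> kk" for i using pCons.prems(1)[of "Suc i"] by simp
  have w: "w \<in> Vinf" using assms(3) K.mx_subset by blast
  have a: "a \<in> kk" using pCons.prems(1)[of 0] by simp
  have "poly P w * w \<in> mx Vinf" by (rule K.mx_mult[OF is_place_Vinf assms(3) poly_in_Vinf[OF P w]])
  then have "- (poly P w * w) \<in> mx Vinf" by (rule K.mx_minus[OF is_place_Vinf])
  moreover have "a = - (poly P w * w)" using pCons.prems(3) by (simp add: eq_neg_iff_add_eq_0 mult.commute)
  ultimately have "a \<in> mx Vinf" by simp
  then have a0: "a = 0" using kk_Int_mx_Vinf a by blast
  then have "P \<noteq> 0" using pCons.prems(2) by auto
  show ?case
  proof (cases "w = 0")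
    case False
    then have "poly P w = 0" using a0 pCons.prems(3) by simp
    then show ?thesis using pCons.IH[OF P \<open>P \<noteq> 0\<close>] by blast
  qed
qed simp

lemma kk_mult: "a \<in> kk \<Longrightarrow> b \<in> kk \<Longrightarrow> a * b \<in> kk" and kk_add: "a \<in> kk \<Longrightarrow> b \<in> kk \<Longrightarrow> a + b \<in> kk"
  by (auto simp: kk_def emb_const_mult emb_const_add)

lemma kk_0: "0 \<in> kk"
  using rangeI[of "\<lambda>a. emb [:a:]" 0] by (simp add: kk_def)

lemma coeff_pcompose_kk:
  assumes "\<And>i. Polynomial.coeff P i \<in> kk" "c \<in> kk" shows "Polynomial.coeff (pcompose P [:c, 1:]) i \<in> kk"
  using assms(1)
proof (induction P arbitrary: i)
  case (pCons a P)
  have a: "a \<in> kk" using pCons.prems[of 0] by simp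
  have *: "Polynomial.coeff (pcompose P [:c, 1:]) i \<in> kk" for i
    by (rule pCons.IH) (use pCons.prems[of "Suc j" for j] in simp)
  have "poly P c \<in> kk" using *[of 0] by simp
  then show ?case using a * assms(2)
    by (cases i) (auto simp: pcompose_pCons coeff_pCons intro!: kk_add kk_mult)
qed (simp add: kk_0)

text \<open>The residue field of the infinite place is the constant field, so an algebraic element
  differs from a constant by an algebraic element of positive valuation.\<close>

lemma algebraic_imp_const:
  assumes z: "z \<in> KK" and P: "\<And>i. Polynomial.coeff P i \<in> kk" "P \<noteq> 0" "poly P z = 0" shows "z \<in> kk"
proof -
  have "z \<in> Vinf"
  proof (rule ccontr)
    assume n: "z \<notin> Vinf"
    then have z0: "z \<noteq> 0" using K.place_0[OF is_place_Vinf] by auto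
    then have i: "inverse z \<in> Vinf" using K.place_inverse[OF is_place_Vinf z] n by blast
    then have "inverse z \<in> mx Vinf" using n by (simp add: K.mx_def)
    moreover have "poly (reflect_poly P) (inverse z) = 0" using poly_reflect_poly_nz[of "inverse z" P] z0 P(3) by simp
    moreover have "Polynomial.coeff (reflect_poly P) i \<in> kk" for i
      using P(1) kk_0 by (simp add: coeff_reflect_poly)
    moreover have "reflect_poly P \<noteq> 0" using P(2) by simp
    ultimately have "inverse z = 0" using no_root_mx_Vinf by blast
    then show False using z0 by simp
  qed
  then obtain c where c: "c \<in> kk" "z - c \<in> mx Vinf" using residue_const by blast
  have "poly (pcompose P [:c, 1:]) (z - c) = 0" using P(3) by (simp add: poly_pcompose)
  moreover have "pcompose P [:c, 1:] \<noteq> 0" using P(2) pcompose_eq_0[of P "[:c, 1:]"] by auto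
  ultimately have "z - c = 0" using no_root_mx_Vinf[OF coeff_pcompose_kk[OF P(1) c(1)] _ c(2)] by blast
  then show ?thesis using c by simp
qed

end

context subfield_of_type begin

lemma field_ring_nat_pow: "z [^]\<^bsub>field_ring C\<^esub> (n::nat) = z ^ n"
proof -
  interpret field "field_ring C" by (rule field_field_ring)
  show ?thesis by (induction n) (simp_all add: mult.commute)
qed

text \<open>\<open>ring.eval\<close> reads coefficient lists with the leading coefficient at the
  head, \<open>Poly\<close> with the constant term at the head; hence \<open>rev\<close>.\<close>

lemma field_ring_eval: "ring.eval (field_ring C) ps z = poly (Poly (rev ps)) z"
proof -
  interpret field "field_ring C" by (rule field_field_ring)
  show ?thesis
    by (induction ps) (simp_all add: field_ring_nat_pow Poly_snoc poly_monom)
qed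

end

context hyperelliptic begin

lemma Poly_emb: "poly (Poly (map (\<lambda>a. emb [:a:]) as)) (emb [:0, 1:]) = emb (Poly as)"
proof (induction as)
  case (Cons a as)
  have "emb (pCons a (Poly as)) = emb ([:a:] + [:0, 1:] * Poly as)" by simp
  also have "\<dots> = emb [:a:] + emb [:0, 1:] * emb (Poly as)" by (simp only: emb_add emb_mult)
  finally show ?case using Cons by simp
qed simp

section \<open>Transport to an isomorphic copy of the field\<close>

context
  fixes N :: "'b ring" and h
  assumes iso: "field_isomorphism (field_ring KK) N h"
begin

interpretation F: field_isomorphism "field_ring KK" N h by (rule iso)
interpretation R: field "field_ring KK" by (rule K.field_field_ring)
interpretation N: field N by (rule F.L)
interpretation H: ring_hom_ring "field_ring KK" N h
  using F.h by unfold_locales (simp add: ring_iso_def)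

lemma subfield_image_kk: "subfield (h ` kk) N"
  by (rule H.img_is_subfield(2)[OF subfield_kk]) simp

text \<open>Pulls a polynomial relation over the constants of \<open>N\<close> back to the original
  field. It serves both the transcendence of \<open>t\<close> and the algebraic closedness of the
  constants.\<close>

lemma polynomial_image_cases:
  assumes p: "p \<in> carrier ((h ` kk)[X]\<^bsub>N\<^esub>)" and z: "z \<in> KK" and "N.eval p (h z) = \<zero>\<^bsub>N\<^esub>"
  obtains as where "p = map (\<lambda>a. h (emb [:a:])) as" "as \<noteq> [] \<longrightarrow> hd as \<noteq> 0"
    "poly (Poly (rev (map (\<lambda>a. emb [:a:]) as))) z = 0"
proof -
  have pol: "polynomial\<^bsub>N\<^esub> (h ` kk) p" using p by (simp add: univ_poly_carrier)
  then have "set p \<subseteq> range (\<lambda>a. h (emb [:a:]))" by (auto simp: polynomial_def kk_def)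
  then have "\<exists>as. p = map (\<lambda>a. h (emb [:a:])) as" unfolding ex_map_conv by blast
  then obtain as where as: "p = map (\<lambda>a. h (emb [:a:])) as" ..
  let ?qs = "map (\<lambda>a. emb [:a:]) as"
  have qs: "set ?qs \<subseteq> KK" "p = map h ?qs" using kk_subset_KK as by (auto simp: kk_def)
  have "N.eval (map h ?qs) (h z) = h (R.eval ?qs z)" using H.eval_hom'[of z ?qs] z qs by simp
  then have e: "h (poly (Poly (rev ?qs)) z) = h 0"
    using assms(3) qs(2) H.hom_zero by (simp add: K.field_ring_eval)
  have "poly (Poly (rev ?qs)) z \<in> KK" using R.eval_in_carrier[of ?qs z] qs z by (simp add: K.field_ring_eval)
  then have "poly (Poly (rev ?qs)) z = 0" using inj_onD[OF F.inj_h e] by simp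
  moreover have "hd as \<noteq> 0" if "as \<noteq> []"
  proof
    assume "hd as = 0"
    then have "hd p = \<zero>\<^bsub>N\<^esub>" using as that H.hom_zero by (simp add: hd_map)
    then show False using pol as that by (auto simp: polynomial_def)
  qed
  ultimately show ?thesis using that as by blast
qed

lemma Poly_rev_nonzero: assumes "as \<noteq> []" "hd as \<noteq> 0" shows "Poly (rev as) \<noteq> 0"
proof -
  obtain a bs where "as = a # bs" using assms(1) by (cases as) auto
  then have "Polynomial.coeff (Poly (rev as)) (length bs) \<noteq> 0" using assms(2) by (simp add: nth_default_def nth_append)
  then show ?thesis by (metis coeff_0)
qed

lemma transcendental_image: "N.transcendental (h ` kk) (h (emb [:0, 1:]))"
proof -
  have t: "emb [:0, 1:] \<in> KK" using RD_subset_KK by auto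
  have "p = []" if p: "p \<in> carrier ((h ` kk)[X]\<^bsub>N\<^esub>)" "N.eval p (h (emb [:0, 1:])) = \<zero>\<^bsub>N\<^esub>" for p
  proof (rule ccontr)
    assume "p \<noteq> []"
    from polynomial_image_cases[OF p(1) t p(2)] obtain as where as: "p = map (\<lambda>a. h (emb [:a:])) as"
      "as \<noteq> [] \<longrightarrow> hd as \<noteq> 0" "poly (Poly (rev (map (\<lambda>a. emb [:a:]) as))) (emb [:0, 1:]) = 0" .
    have "emb (Poly (rev as)) = 0" using as(3) by (simp only: rev_map Poly_emb)
    then show False using Poly_rev_nonzero[of as] as \<open>p \<noteq> []\<close> by simp
  qed
  then have "{p \<in> carrier ((h ` kk)[X]\<^bsub>N\<^esub>). N.eval p (h (emb [:0, 1:])) = \<zero>\<^bsub>N\<^esub>} \<subseteq> {[]}" by blast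
  moreover have "[] \<in> {p \<in> carrier ((h ` kk)[X]\<^bsub>N\<^esub>). N.eval p (h (emb [:0, 1:])) = \<zero>\<^bsub>N\<^esub>}"
    using univ_poly_zero_closed by simp
  ultimately have "a_kernel ((h ` kk)[X]\<^bsub>N\<^esub>) N (\<lambda>p. N.eval p (h (emb [:0, 1:]))) = {[]}"
    unfolding a_kernel_def' by (intro equalityI) simp_all
  then show ?thesis
    using N.trivial_ker_imp_transcendental[OF subfieldE(1)[OF subfield_image_kk], of "h (emb [:0, 1:])"] t
    by (simp add: over_def)
qed

lemma algebraic_image:
  assumes "x \<in> carrier N" "N.algebraic (h ` kk) x" shows "x \<in> h ` kk"
proof -
  obtain z where z: "z \<in> KK" "x = h z" using assms(1) F.img_h by auto
  obtain p where p: "p \<in> carrier ((h ` kk)[X]\<^bsub>N\<^esub>)" "p \<noteq> []" "N.eval p x = \<zero>\<^bsub>N\<^esub>"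
    using N.algebraicE[OF subfieldE(1)[OF subfield_image_kk] assms(1)] assms(2) unfolding over_def by metis
  from polynomial_image_cases[OF p(1) z(1)] p(3) z(2) obtain as where as: "p = map (\<lambda>a. h (emb [:a:])) as"
      "as \<noteq> [] \<longrightarrow> hd as \<noteq> 0" "poly (Poly (rev (map (\<lambda>a. emb [:a:]) as))) z = 0" by metis
  let ?P = "Poly (rev (map (\<lambda>a. emb [:a:]) as))"
  have ne: "as \<noteq> []" using p(2) as(1) by auto
  have "hd (map (\<lambda>a. emb [:a:]) as) \<noteq> 0" using as(2) ne by (simp add: hd_map)
  then have "?P \<noteq> 0" using ne by (intro Poly_rev_nonzero) auto
  moreover have "Polynomial.coeff ?P i \<in> kk" for i
  proof -
    have "set (rev (map (\<lambda>a. emb [:a:]) as)) \<subseteq> kk" by (auto simp: kk_def)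
    then show ?thesis using kk_0 nth_mem by (auto simp: nth_default_def coeff_Poly_eq simp del: set_rev set_map)
  qed
  ultimately have "z \<in> kk" using algebraic_imp_const[OF z(1) _ _ as(3)] by blast
  then show ?thesis using z by blast
qed

text \<open>The field has degree two over the rational functions: \<open>1\<close> and
  \<open>y\<close> span it.\<close>

lemma finite_dimension_image:
  "N.finite_dimension (generate_field N (insert (h (emb [:0, 1:])) (h ` kk))) (carrier N)"
proof -
  let ?G = "generate_field N (insert (h (emb [:0, 1:])) (h ` kk))"
  have KK: "emb a \<in> KK" for a using RD_subset_KK by auto
  have sub: "insert (h (emb [:0, 1:])) (h ` kk) \<subseteq> carrier N" using KK[of "[:0, 1:]"] kk_subset_KK by auto
  have sf: "subfield ?G N" by (rule N.generate_field_is_subfield[OF sub])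
  have G: "h (emb a) \<in> ?G" for a
  proof (induction a)
    case 0
    show ?case using N.zero_in_generate H.hom_zero by simp
  next
    case (pCons c a)
    have "emb (pCons c a) = emb ([:c:] + [:0, 1:] * a)" by simp
    also have "\<dots> = emb [:c:] + emb [:0, 1:] * emb a" by (simp only: emb_add emb_mult)
    finally have "h (emb (pCons c a)) = h (emb [:c:]) \<oplus>\<^bsub>N\<^esub> h (emb [:0, 1:]) \<otimes>\<^bsub>N\<^esub> h (emb a)"
      using H.hom_add[of "emb [:c:]" "emb [:0, 1:] * emb a"] H.hom_mult[of "emb [:0, 1:]" "emb a"] KK K.mult_C by simp
    moreover have "h (emb [:c:]) \<in> ?G" by (rule generate_field.incl) (simp add: kk_def)
    moreover have "h (emb [:0, 1:]) \<in> ?G" by (rule generate_field.incl) simp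
    ultimately show ?case using pCons by (simp add: generate_field.eng_add generate_field.eng_mult)
  qed
  have Gq: "h (emb a / emb s) \<in> ?G" if "s \<noteq> 0" for a s
  proof -
    have "h (emb a / emb s) = h (emb a) \<otimes>\<^bsub>N\<^esub> h (inverse (emb s))"
      using H.hom_mult[of "emb a" "inverse (emb s)"] KK K.inverse_C by (simp add: divide_inverse)
    also have "h (inverse (emb s)) = inv\<^bsub>N\<^esub> h (emb s)"
      using F.h_inv[of "emb s"] K.inv_field_ring[of "emb s"] KK that by simp
    moreover have "h (emb s) \<noteq> \<zero>\<^bsub>N\<^esub>"
      using inj_onD[OF F.inj_h, of "emb s" 0] H.hom_zero KK[of s] that by auto
    ultimately show ?thesis by (simp add: generate_field.eng_mult generate_field.m_inv G)
  qed
  have "el 0 1 \<in> KK" using RD_subset_KK el_in_RD by blast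
  then have yK: "y \<in> KK" by (simp add: el_def)
  then have set: "set [h 1, h y] \<subseteq> carrier N" by auto
  have "carrier N \<subseteq> N.Span ?G [h 1, h y]"
  proof
    fix x assume "x \<in> carrier N"
    then obtain z where z: "z \<in> KK" "x = h z" using F.img_h by auto
    then obtain a b s where "z = (emb a + emb b * y) / emb s" "s \<noteq> 0"
      by (elim KK_cases RD_cases) (auto simp: el_def)
    then have s: "z = emb a / emb s * 1 + (emb b / emb s * y + 0)" "s \<noteq> 0" by (auto simp: add_divide_distrib)
    let ?u = "emb a / emb s" and ?v = "emb b / emb s"
    have uv: "?u \<in> KK" "?v \<in> KK" using s(2) by (auto intro!: KKI)
    have "x = h ?u \<otimes>\<^bsub>N\<^esub> h 1 \<oplus>\<^bsub>N\<^esub> (h ?v \<otimes>\<^bsub>N\<^esub> h y \<oplus>\<^bsub>N\<^esub> \<zero>\<^bsub>N\<^esub>)"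
      unfolding z(2) s(1)
      using H.hom_add[of "?u * 1" "?v * y + 0"] H.hom_mult[of ?u 1] H.hom_add[of "?v * y" 0] H.hom_mult[of ?v y]
        H.hom_zero uv yK K.mult_C[OF uv(2) yK] by simp
    moreover have "h ?v \<otimes>\<^bsub>N\<^esub> h y \<oplus>\<^bsub>N\<^esub> \<zero>\<^bsub>N\<^esub> \<in> N.line_extension ?G (h y) {\<zero>\<^bsub>N\<^esub>}"
      unfolding N.line_extension_mem_iff using Gq[OF s(2)] by blast
    ultimately have "x \<in> N.line_extension ?G (h 1) (N.line_extension ?G (h y) {\<zero>\<^bsub>N\<^esub>})"
      unfolding N.line_extension_mem_iff[of x] using Gq[OF s(2)] by blast
    then show "x \<in> N.Span ?G [h 1, h y]" by simp
  qed
  moreover have "N.Span ?G [h 1, h y] \<subseteq> carrier N" by (rule N.Span_in_carrier[OF _ set]) (use subfieldE(3)[OF sf] in auto)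
  ultimately have "N.Span ?G [h 1, h y] = carrier N" by blast
  then show ?thesis using N.Span_finite_dimension[OF sf set] by simp
qed

theorem global_function_field_image: "global_function_field CARD('f) N (h ` kk)"
proof -
  have "emb [:0, 1:] \<in> KK" using RD_subset_KK by auto
  then have "h (emb [:0, 1:]) \<in> carrier N" by simp
  moreover have "inj_on h kk" using F.inj_h kk_subset_KK by (auto intro: inj_on_subset)
  ultimately show ?thesis
    unfolding global_function_field_def function_field_def
    using subfield_image_kk transcendental_image finite_dimension_image algebraic_image N.field_axioms finite_kk
    by (auto simp: card_image card_kk)
qed

end

end

section \<open>Hyperelliptic fields with small zeta value\<close>

lemma field_isomorphism_image_ring:
  assumes "field K" "inj_on h (carrier K)" shows "field_isomorphism K (image_ring h K) h"
  using assms field.inj_imp_image_ring_is_field[of K h] inj_imp_image_ring_iso[of h K]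
  by (simp add: field_isomorphism_def)

lemma countable_UNIV_poly: "countable (UNIV :: 'f::{zero,countable} poly set)"
proof -
  have "p \<in> range Poly" for p :: "'f poly" using rangeI[of Poly "coeffs p"] by simp
  then show ?thesis using countable_image[OF countableI_type, of Poly "UNIV :: 'f list set"] by (metis UNIV_eq_I)
qed

context hyperelliptic begin

lemma countable_KK: "countable KK"
proof -
  have "KK \<subseteq> (\<lambda>((a, b), s). el a b / emb s) ` ((UNIV \<times> UNIV) \<times> UNIV)"
  proof
    fix z assume "z \<in> KK"
    then obtain a b s where "z = el a b / emb s" by (elim KK_cases RD_cases) auto
    then show "z \<in> (\<lambda>((a, b), s). el a b / emb s) ` ((UNIV \<times> UNIV) \<times> UNIV)"
      by (intro image_eqI[of _ _ "((a, b), s)"]) auto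
  qed
  then show ?thesis
    using countable_image countable_SIGMA countable_UNIV_poly countable_subset by meson
qed

end

text \<open>An algebraic closure of the rational function field contains a square root of
  \<open>D\<close>.\<close>

lemma hyperelliptic_exists:
  fixes D :: "'f::{field_gcd,finite} poly"
  assumes "lead_coeff D = 1" "degree D = 2 * g + 1" "squarefree D" "(2::'f) \<noteq> 0"
  shows "\<exists>(emb :: 'f poly \<Rightarrow> 'f poly fract alg_closure) y. hyperelliptic emb y D g"
proof -
  obtain y where "y ^ 2 = to_ac (to_fract D)" using nth_root_exists[of 2 "to_ac (to_fract D)"] by auto
  then have "hyperelliptic (\<lambda>a. to_ac (to_fract a)) y D g"
    by unfold_locales (use assms in \<open>simp_all add: power2_eq_square\<close>)
  then show ?thesis by blast
qed

text \<open>Combines \<open>rho_bound\<close> with \<open>few_ideals_exists\<close>. In the bound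
  \<open>\<epsilon> * c / 2\<close>, the 2 compensates the factor in \<open>rho_bound\<close>, and
  \<open>c\<close> is the denominator of the residue.\<close>

theorem small_zeta_star_exists:
  fixes \<epsilon> :: real
  assumes two: "(2::'f::{field_gcd,finite}) \<noteq> 0" and "\<epsilon> > 0"
  shows "\<exists>(N :: nat ring) k. global_function_field CARD('f) N k \<and> 0 < norm (zeta_star N k 1) \<and> norm (zeta_star N k 1) \<le> \<epsilon>"
proof -
  define q where "q = real CARD('f)"
  define c where "c = (1 - 1 / q) * ln q"
  have "q \<ge> 3" using CARD_ge_3[OF two] by (simp add: q_def)
  then have q: "q > 1" by simp
  then have c: "c > 0" by (auto simp: c_def)
  obtain D :: "'f poly" and g m where D: "lead_coeff D = 1" "degree D = 2 * g + 1" "squarefree D" "g + 1 \<le> m"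
    and few: "real (\<Sum>j\<le>m. card (triples j D)) \<le> \<epsilon> * c / 2 * real (CARD('f) ^ m)"
    using few_ideals_exists[OF two, of "\<epsilon> * c / 2"] \<open>\<epsilon> > 0\<close> c by auto
  obtain emb y where "hyperelliptic (emb :: 'f poly \<Rightarrow> 'f poly fract alg_closure) y D g"
    using hyperelliptic_exists[OF D(1-3) two] by blast
  then interpret hyperelliptic "emb :: 'f poly \<Rightarrow> 'f poly fract alg_closure" y D g .
  \<comment> \<open>The field is countable and can be copied onto natural numbers, where isomorphism
    classes are formed.\<close>
  let ?h = "to_nat_on KK"
  let ?N = "image_ring ?h (field_ring KK)"
  have iso: "field_isomorphism (field_ring KK) ?N ?h"
    using K.field_field_ring inj_on_to_nat_on[OF countable_KK] by (intro field_isomorphism_image_ring) auto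
  have z: "zeta_star ?N (?h ` kk) 1 = of_real (rho / c)"
    using field_isomorphism.zeta_star_image[OF iso] kk_subset_KK zeta_star_1 by (simp add: c_def q_def)
  have "rho * q ^ m \<le> 2 * real (\<Sum>j\<le>m. card (ideals j))" using rho_bound[of m] D(4) by (simp add: q_def)
  also have "\<dots> \<le> 2 * (\<epsilon> * c / 2 * q ^ m)" using few by (simp add: card_ideals q_def)
  finally have "rho * q ^ m \<le> (\<epsilon> * c) * q ^ m" by simp
  then have "rho \<le> \<epsilon> * c" using q by simp
  then have "rho / c \<le> \<epsilon>" using c by (simp add: divide_le_eq)
  moreover have "rho / c > 0" using rho_pos c by simp
  ultimately show ?thesis
    using global_function_field_image[OF iso] z
    by (intro exI[of _ ?N] exI[of _ "?h ` kk"]) (simp only: norm_of_real abs_of_pos simp_thms)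
qed

section \<open>Isomorphism classes\<close>

lemma constants_image:
  assumes iso: "field_isomorphism K L h" and k: "global_function_field q K k" and l: "global_function_field q L l"
  shows "h ` k = l"
proof -
  interpret F: field_isomorphism K L h by (rule iso)
  interpret K: field K by (rule F.K)
  interpret L: field L by (rule F.L)
  interpret H: ring_hom_ring K L h
    using F.h by unfold_locales (simp add: ring_iso_def)
  have k': "subfield k K" "finite k" "card k = q" and l': "subfield l L" "finite l" "card l = q"
    and alg: "\<And>x. x \<in> carrier L \<Longrightarrow> L.algebraic l x \<Longrightarrow> x \<in> l"
    using k l by (auto simp: global_function_field_def function_field_def)
  have sub: "subring (h ` k) L" using H.img_is_subring[OF subfieldE(1)[OF k'(1)]] .
  have "x \<in> l" if x: "x \<in> h ` k" for x
  proof (rule alg)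
    show xL: "x \<in> carrier L" using subringE(1)[OF sub] x by blast
    show "L.algebraic l x"
    proof
      assume "L.transcendental l x"
      then have inj: "inj_on (\<lambda>p. L.eval p x) (carrier (l[X]\<^bsub>L\<^esub>))" by (simp add: L.transcendental_def)
      \<comment> \<open>The coefficient list of \<open>X ^ n\<close>, leading coefficient
        first.\<close>
      define p where "p = (\<lambda>n. \<one>\<^bsub>L\<^esub> # replicate n \<zero>\<^bsub>L\<^esub>)"
      have p: "p n \<in> carrier (l[X]\<^bsub>L\<^esub>)" for n
        using subringE(2,3)[OF subfieldE(1)[OF l'(1)]]
        by (auto simp: p_def polynomial_def set_replicate_conv_if simp flip: univ_poly_carrier)
      have z: "L.eval (replicate n \<zero>\<^bsub>L\<^esub>) x = \<zero>\<^bsub>L\<^esub>" for n using xL by (induction n) auto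
      then have "L.eval (p n) x = x [^]\<^bsub>L\<^esub> n" for n using xL by (simp add: p_def)
      moreover have "x [^]\<^bsub>L\<^esub> (n::nat) \<in> h ` k" for n
        using x subringE(3,6)[OF sub] by (induction n) auto
      ultimately have "(\<lambda>n. L.eval (p n) x) ` UNIV \<subseteq> h ` k" by auto
      moreover have "inj (\<lambda>n. L.eval (p n) x)"
      proof (rule injI)
        fix i j assume "L.eval (p i) x = L.eval (p j) x"
        then have "p i = p j" using inj_onD[OF inj] p by blast
        then have "length (p i) = length (p j)" by (rule arg_cong)
        then show "i = j" by (simp add: p_def)
      qed
      ultimately have "finite (UNIV :: nat set)"
        using k'(2) finite_imageD finite_subset by (metis finite_imageI)
      then show False by simp
    qed
  qed
  moreover have "card (h ` k) = card l"
    using card_image[OF inj_on_subset[OF F.inj_h]] subfieldE(3)[OF k'(1)] k'(3) l'(3) by simp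
  ultimately show ?thesis using card_subset_eq[OF l'(2)] by (metis subsetI)
qed

lemma zeta_star_isomorphic:
  assumes k: "global_function_field q K k" and l: "global_function_field q L l" and "K \<simeq> L"
  shows "zeta_star K k s = zeta_star L l s"
proof -
  obtain h where "h \<in> ring_iso K L" using assms(3) by (auto simp: is_ring_iso_def)
  then have iso: "field_isomorphism K L h"
    using k l by (simp add: field_isomorphism_def global_function_field_def function_field_def)
  have "k \<subseteq> carrier K" using k subfieldE(3) by (auto simp: global_function_field_def function_field_def)
  then show ?thesis
    using field_isomorphism.zeta_star_image[OF iso, of k] constants_image[OF iso k l] by simp
qed

text \<open>Finitely many classes would give finitely many positive values up to \<open>B\<close>; a
  field with a positive value at most half their minimum is a contradiction.\<close>

lemma not_northcott_if_small:
  assumes small: "\<And>\<epsilon>. \<epsilon> > 0 \<Longrightarrow> \<exists>(N :: nat ring) k. global_function_field q N k \<and> 0 < norm (zeta_star N k s) \<and> norm (zeta_star N k s) \<le> \<epsilon>"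
    and "B > 0"
  shows "\<not> northcott_property q s B"
proof
  assume "northcott_property q s B"
  then have fin: "finite (northcott_set q s B)" by (simp add: northcott_property_def)
  \<comment> \<open>By \<open>zeta_star_isomorphic\<close> all members of a class have the same
    value, so the choice is immaterial.\<close>
  define val where "val C = (SOME r. \<exists>K\<in>(C :: nat ring set). \<exists>k. global_function_field q K k \<and> r = norm (zeta_star K k s))" for C
  define T where "T = {norm (zeta_star K k s) | (K :: nat ring) k. global_function_field q K k \<and> norm (zeta_star K k s) \<le> B}"
  have "T \<subseteq> val ` northcott_set q s B"
  proof
    fix r assume "r \<in> T"
    then obtain K :: "nat ring" and k
      where K: "global_function_field q K k" "r = norm (zeta_star K k s)" "r \<le> B" by (auto simp: T_def)
    let ?C = "isomorphism_rel q `` {K}"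
    have "K \<simeq> K" using ring_iso_set_refl by (auto simp: is_ring_iso_def)
    then have "K \<in> ?C" using K(1) by (auto simp: isomorphism_rel_def global_function_fields_def)
    then have "\<exists>r. \<exists>L\<in>?C. \<exists>l. global_function_field q L l \<and> r = norm (zeta_star L l s)" using K(1) by blast
    then have "\<exists>L\<in>?C. \<exists>l. global_function_field q L l \<and> val ?C = norm (zeta_star L l s)"
      unfolding val_def by (rule someI_ex)
    then obtain L l where "L \<in> ?C" "global_function_field q L l" "val ?C = norm (zeta_star L l s)" by blast
    moreover from this have "K \<simeq> L" by (simp add: isomorphism_rel_def)
    ultimately have "r = val ?C" using zeta_star_isomorphic[OF K(1)] K(2) by metis
    moreover have "?C \<in> northcott_set q s B" using K by (auto simp: northcott_set_def quotient_def)
    ultimately show "r \<in> val ` northcott_set q s B" by blast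
  qed
  then have finT: "finite {r \<in> T. r > 0}" using fin by (auto intro: finite_subset)
  have pos: "\<exists>r\<in>{r \<in> T. r > 0}. r \<le> \<epsilon>" if "\<epsilon> > 0" "\<epsilon> \<le> B" for \<epsilon>
    using small[OF that(1)] that(2) by (force simp: T_def)
  have ne: "{r \<in> T. r > 0} \<noteq> {}" using pos[of B] \<open>B > 0\<close> by blast
  let ?m = "Min {r \<in> T. r > 0}"
  have m: "?m \<in> {r \<in> T. r > 0}" by (rule Min_in[OF finT ne])
  moreover have "r \<le> B" if "r \<in> T" for r using that by (auto simp: T_def)
  ultimately have "?m / 2 > 0" "?m \<le> B" by auto
  then have "?m / 2 > 0" "?m / 2 \<le> B" by linarith+
  from pos[OF this] obtain r where r: "r \<in> {r \<in> T. r > 0}" "r \<le> ?m / 2" by blast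
  have "?m \<le> r" by (rule Min_le[OF finT r(1)])
  then show False using r m by auto
qed

section \<open>The field with \<open>q\<close> elements as a type\<close>

text \<open>A type cannot depend on the \<open>q\<close> of the theorem. Instead \<open>fq\<close> has as many elements as a hypothetical
  counterexample \<open>q\<close>, chosen once and for all; the default \<open>5\<close> only makes the choice total.\<close>

definition counterexample :: "nat \<Rightarrow> bool" where
  "counterexample q \<longleftrightarrow> primepow q \<and> q mod 4 = 1 \<and> (\<exists>B>0. northcott_property q 1 B)"

definition q0 :: nat where
  "q0 = (if \<exists>q. counterexample q then SOME q. counterexample q else 5)"

lemma counterexample_q0: "counterexample q \<Longrightarrow> counterexample q0"
  unfolding q0_def by (simp add: exI someI[of counterexample q])

lemma q0: "primepow q0" "q0 mod 4 = 1"
proof -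
  have "primepow q0 \<and> q0 mod 4 = 1"
  proof (cases "\<exists>q. counterexample q")
    case True
    then show ?thesis using counterexample_q0 by (auto simp: counterexample_def)
  next
    case False
    moreover have "primepow (5 :: nat)" by (rule primepow_prime) simp
    ultimately show ?thesis by (simp add: q0_def)
  qed
  then show "primepow q0" "q0 mod 4 = 1" by auto
qed

section \<open>The prime field of characteristic \<open>p0\<close>\<close>

definition p0 :: nat where "p0 = aprimedivisor q0"

lemma p0: "prime p0" and q0_eq: "q0 = p0 ^ multiplicity p0 q0" and p0_dvd: "p0 dvd q0"
  using q0(1) prime_aprimedivisor'[of q0] primepow_decompose[of q0] primepow_gt_Suc_0[of q0] aprimedivisor_dvd'[of q0]
  by (auto simp: p0_def)

typedef fp = "{0..<int p0}"
  using prime_gt_0_nat[OF p0] by (intro exI[of _ 0]) auto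

definition fp_of :: "int \<Rightarrow> fp" where "fp_of a = Abs_fp (a mod int p0)"

lemma Rep_fp_of: "Rep_fp (fp_of a) = a mod int p0"
  using prime_gt_0_nat[OF p0] by (simp add: fp_of_def Abs_fp_inverse)

lemma fp_of_eq_iff: "fp_of a = fp_of b \<longleftrightarrow> a mod int p0 = b mod int p0"
  by (simp add: Rep_fp_of flip: Rep_fp_inject)

lemma fp_cases: obtains a where "x = fp_of a"
  using Rep_fp[of x] Rep_fp_inverse[of x] by (metis fp_of_def atLeastLessThan_iff mod_pos_pos_trivial)

instantiation fp :: comm_ring_1
begin

definition "0 = fp_of 0"
definition "1 = fp_of 1"
definition "x + y = fp_of (Rep_fp x + Rep_fp y)"
definition "x - y = fp_of (Rep_fp x - Rep_fp y)"
definition "- x = fp_of (- Rep_fp x)"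
definition "x * y = fp_of (Rep_fp x * Rep_fp y)"

lemma fp_of_hom:
  "fp_of a + fp_of b = fp_of (a + b)" "fp_of a - fp_of b = fp_of (a - b)" "- fp_of a = fp_of (- a)"
  "fp_of a * fp_of b = fp_of (a * b)"
  by (simp_all add: plus_fp_def minus_fp_def uminus_fp_def times_fp_def Rep_fp_of fp_of_eq_iff mod_simps)

instance
proof
  fix x y z :: fp
  obtain a b c where [simp]: "x = fp_of a" "y = fp_of b" "z = fp_of c" by (metis fp_cases)
  show "x + y + z = x + (y + z)" "x + y = y + x" "0 + x = x" "- x + x = 0" "x - y = x + - y"
    "x * y * z = x * (y * z)" "x * y = y * x" "1 * x = x" "(x + y) * z = x * z + y * z"
    by (simp_all add: zero_fp_def one_fp_def fp_of_hom algebra_simps)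
  show "(0 :: fp) \<noteq> 1"
    using prime_gt_1_nat[OF p0] by (simp add: zero_fp_def one_fp_def fp_of_eq_iff)
qed

end

lemma fp_inverse_exists: assumes "x \<noteq> (0 :: fp)" shows "\<exists>z. z * x = 1"
proof -
  obtain a where a: "x = fp_of a" by (rule fp_cases)
  then have "\<not> int p0 dvd a" using assms by (auto simp: zero_fp_def fp_of_eq_iff dvd_eq_mod_eq_0)
  then have "coprime a (int p0)" using prime_imp_coprime[of "int p0" a] p0 by (simp add: coprime_commute)
  then obtain b c where "b * a + c * int p0 = 1" using bezout_int[of a "int p0"] by auto
  then have "(b * a) mod int p0 = 1 mod int p0" by (metis mod_mult_self1)
  then have "fp_of b * x = 1" by (simp add: a fp_of_hom one_fp_def fp_of_eq_iff)
  then show ?thesis ..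
qed

instantiation fp :: field
begin

definition "inverse (x :: fp) = (if x = 0 then 0 else SOME z. z * x = 1)"
definition "x div (z :: fp) = x * inverse z"

instance
  by standard (use someI_ex[OF fp_inverse_exists] in \<open>auto simp: inverse_fp_def divide_fp_def\<close>)

end

lemma CHAR_fp: "CHAR(fp) = p0"
proof -
  have "of_nat n = fp_of (int n)" for n
    by (induction n) (simp_all add: zero_fp_def one_fp_def fp_of_hom)
  then have "of_nat n = (0 :: fp) \<longleftrightarrow> p0 dvd n" for n
    by (simp add: zero_fp_def fp_of_eq_iff flip: dvd_eq_mod_eq_0)
  then show ?thesis by (intro CHAR_eqI) auto
qed

section \<open>The field with \<open>q0\<close> elements as fixed points of a power of
  Frobenius\<close>

typedef fq = "{x :: fp alg_closure. x ^ q0 = x}"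
  by (rule exI[of _ 1]) simp

lemma Rep_fq_power: "Rep_fq x ^ q0 = Rep_fq x"
  using Rep_fq[of x] by simp

lemma Rep_Abs_fq: "x ^ q0 = x \<Longrightarrow> Rep_fq (Abs_fq x) = x"
  by (simp add: Abs_fq_inverse)

lemma CHAR_closure: "CHAR(fp alg_closure) = p0"
  by (simp add: CHAR_fp)

text \<open>\<open>q0\<close> is a power of the characteristic. This closes the fixed points under
  addition.\<close>

lemma frobenius_add: "(x + y :: fp alg_closure) ^ q0 = x ^ q0 + y ^ q0"
  using freshmans_dream'[of q0 "multiplicity p0 q0" x y] p0 q0_eq CHAR_closure by simp

lemma frobenius_minus: "(- x :: fp alg_closure) ^ q0 = - (x ^ q0)"
proof -
  have "odd q0" using q0(2) by presburger
  then show ?thesis by (rule power_minus_odd)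
qed

lemma q0_pos: "q0 > 0"
  using q0(2) by (cases q0) auto

instantiation fq :: field
begin

definition "0 = Abs_fq 0"
definition "1 = Abs_fq 1"
definition "x + y = Abs_fq (Rep_fq x + Rep_fq y)"
definition "x - y = Abs_fq (Rep_fq x - Rep_fq y)"
definition "- x = Abs_fq (- Rep_fq x)"
definition "x * y = Abs_fq (Rep_fq x * Rep_fq y)"
definition "inverse x = Abs_fq (inverse (Rep_fq x))"
definition "x div y = Abs_fq (Rep_fq x / Rep_fq y)"

lemma Rep_fq_hom:
  "Rep_fq 0 = 0" "Rep_fq 1 = 1" "Rep_fq (x + y) = Rep_fq x + Rep_fq y" "Rep_fq (x - y) = Rep_fq x - Rep_fq y"
  "Rep_fq (- x) = - Rep_fq x" "Rep_fq (x * y) = Rep_fq x * Rep_fq y" "Rep_fq (inverse x) = inverse (Rep_fq x)"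
  "Rep_fq (x div y) = Rep_fq x / Rep_fq y"
  using frobenius_add[of "Rep_fq x" "- Rep_fq y"]
  by (simp_all add: zero_fq_def one_fq_def plus_fq_def minus_fq_def uminus_fq_def times_fq_def inverse_fq_def
      divide_fq_def Rep_Abs_fq Rep_fq_power frobenius_add frobenius_minus power_mult_distrib power_inverse
      power_divide q0_pos)

instance
proof
  fix x y z :: fq
  show "x + y + z = x + (y + z)" "x + y = y + x" "0 + x = x" "- x + x = 0" "x - y = x + - y"
    "x * y * z = x * (y * z)" "x * y = y * x" "1 * x = x" "(x + y) * z = x * z + y * z" "(0 :: fq) \<noteq> 1"
    "x \<noteq> 0 \<Longrightarrow> inverse x * x = 1" "x div y = x * inverse y" "inverse (0 :: fq) = 0"
    by (simp_all add: Rep_fq_hom algebra_simps divide_inverse flip: Rep_fq_inject)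
qed

end

text \<open>Leads to the class \<open>field_gcd\<close>, over which polynomials have gcds and unique
  factorization.\<close>

instantiation fq :: "{unique_euclidean_ring, normalization_euclidean_semiring, normalization_semidom_multiplicative}"
begin

definition [simp]: "normalize_fq = (normalize_field :: fq \<Rightarrow> _)"
definition [simp]: "unit_factor_fq = (unit_factor_field :: fq \<Rightarrow> _)"
definition [simp]: "modulo_fq = (mod_field :: fq \<Rightarrow> _)"
definition [simp]: "euclidean_size_fq = (euclidean_size_field :: fq \<Rightarrow> _)"
definition [simp]: "division_segment (x :: fq) = 1"

instance
  by standard (simp_all add: dvd_field_iff field_split_simps split: if_splits)

end

instantiation fq :: euclidean_ring_gcd
begin

definition "gcd = (Euclidean_Algorithm.gcd :: fq \<Rightarrow> _)"
definition "lcm = (Euclidean_Algorithm.lcm :: fq \<Rightarrow> _)"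
definition "Gcd = (Euclidean_Algorithm.Gcd :: fq set \<Rightarrow> _)"
definition "Lcm = (Euclidean_Algorithm.Lcm :: fq set \<Rightarrow> _)"

instance
  by standard (simp_all add: gcd_fq_def lcm_fq_def Gcd_fq_def Lcm_fq_def)

end

instance fq :: field_gcd ..

text \<open>The derivative of \<open>X\<^sup>q - X\<close> is \<open>-1\<close>, so its roots are simple.\<close>

lemma card_frobenius_fixed: "finite {x :: fp alg_closure. x ^ q0 = x}" "card {x :: fp alg_closure. x ^ q0 = x} = q0"
proof -
  let ?P = "monom 1 q0 + [:0, - 1:] :: fp alg_closure poly"
  have q: "q0 > 1" using primepow_gt_Suc_0[OF q0(1)] by simp
  have "degree ?P = degree (monom 1 q0 :: fp alg_closure poly)"
    by (rule degree_add_eq_left) (use q in \<open>simp add: degree_monom_eq\<close>)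
  then have deg: "degree ?P = q0" by (simp add: degree_monom_eq)
  then have lc: "lead_coeff ?P = 1" using q by (simp add: coeff_pCons split: nat.split)
  have nz: "?P \<noteq> 0" using deg q by auto
  obtain A where "size A = degree ?P" "?P = smult (lead_coeff ?P) (\<Prod>x\<in>#A. [:- x, 1:])"
    using alg_closed_imp_factorization[OF nz] by blast
  then have A: "size A = q0" "?P = (\<Prod>x\<in>#A. [:- x, 1:])" by (simp_all only: deg lc[unfolded deg] smult_1_left)
  have "of_nat q0 = (0 :: fp alg_closure)" using p0_dvd CHAR_closure of_nat_eq_0_iff_char_dvd by metis
  then have d: "pderiv ?P = [:- 1:]" by (simp add: pderiv_add pderiv_monom pderiv_pCons)
  have le: "count A x \<le> 1" for x
  proof (rule ccontr)
    assume "\<not> count A x \<le> 1"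
    then have "replicate_mset 2 x \<subseteq># A" unfolding count_le_replicate_mset_subset_eq[symmetric] by simp
    then have "{#x, x#} \<subseteq># A" by (simp add: numeral_2_eq_2)
    then obtain B where "A = {#x, x#} + B" by (metis mset_subset_eq_exists_conv)
    then have "?P = [:- x, 1:] * ([:- x, 1:] * (\<Prod>x\<in>#B. [:- x, 1:]))" using A(2) by simp
    then have "poly (pderiv ?P) x = 0" by (simp only: pderiv_mult poly_add poly_mult) simp
    then show False by (simp add: d)
  qed
  have "count A x = 1" if "x \<in># A" for x using le[of x] count_greater_zero_iff[of A x] that by linarith
  then have "A = mset_set (set_mset A)" by (intro multiset_eqI) (simp add: count_mset_set' not_in_iff)
  then have c: "card (set_mset A) = q0" using A(1) by (metis size_mset_set)
  have "{x :: fp alg_closure. x ^ q0 = x} = {x. poly ?P x = 0}" by (simp add: poly_monom)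
  also have "\<dots> = set_mset A" unfolding A(2) by (auto simp: poly_prod_mset prod_mset_zero_iff)
  finally show "finite {x :: fp alg_closure. x ^ q0 = x}" "card {x :: fp alg_closure. x ^ q0 = x} = q0" using c by simp_all
qed

lemma UNIV_fq: "Rep_fq ` UNIV = {x. x ^ q0 = x}"
  using type_definition.Rep_range[OF type_definition_fq] .

instance fq :: finite
  by standard (metis UNIV_fq card_frobenius_fixed(1) finite_imageD inj_on_def Rep_fq_inject)

lemma CARD_fq: "CARD(fq) = q0"
proof -
  have "card (Rep_fq ` UNIV) = CARD(fq)" by (rule card_image) (simp add: inj_on_def Rep_fq_inject)
  then show ?thesis by (simp add: UNIV_fq card_frobenius_fixed(2))
qed

lemma two_fq: "(2 :: fq) \<noteq> 0"
proof
  assume "(2 :: fq) = 0"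
  then have "1 + 1 = (0 :: fq)" by simp
  then have "Rep_fq (1 + 1) = Rep_fq 0" by (rule arg_cong)
  then have "1 + 1 = (0 :: fp alg_closure)" unfolding Rep_fq_hom .
  then have "of_nat 2 = (0 :: fp alg_closure)" by simp
  then have "p0 dvd 2" using CHAR_closure of_nat_eq_0_iff_char_dvd by metis
  then have "p0 = 2" using p0 prime_nat_iff by (metis dvd_imp_le le_antisym prime_ge_2_nat zero_less_numeral)
  then have "even q0" using p0_dvd by simp
  then show False using q0(2) by presburger
qed

text \<open>A counterexample \<open>q\<close> makes the fixed \<open>q0\<close> a counterexample as
  well, with a bound \<open>B0\<close> of its own; the fields over \<open>fq\<close> refute that
  one.\<close>

theorem theorem5p2:
  fixes q :: nat and B :: real
  assumes "primepow q" and "q mod 4 = 1" and "B > 0"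
  shows "\<not> northcott_property q 1 B"
proof
  assume "northcott_property q 1 B"
  then have "counterexample q0" using assms by (intro counterexample_q0[of q]) (auto simp: counterexample_def)
  then obtain B0 where "B0 > 0" "northcott_property q0 1 B0" by (auto simp: counterexample_def)
  moreover have "\<not> northcott_property q0 1 B0"
    by (rule not_northcott_if_small[OF _ \<open>B0 > 0\<close>]) (use small_zeta_star_exists[OF two_fq] CARD_fq in metis)
  ultimately show False by blast
qed

end
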